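(* Let $d\ge 1$ and let $g\in M^{*}(\mathbb{R}^{d})$ with $\|g\|_{2}=1$. There exists a constant $C_g>0$, depending only on $g$, such that for every compact set $\Omega\subset\mathbb{R}^{2d}$ with finite perimeter and $|\partial\Omega|\ge 1$, $$\left\|\rho_{g,\Omega}-1_{\Omega}\right\|_{L^{1}(\mathbb{R}^{2d})}\le C_{g}\,|\partial\Omega|.$$
   Context: For $f,g\in L^2(\mathbb{R}^d)$ the short-time Fourier transform of $f$ with window $g$ is $$V_gf(z)=\int_{\mathbb{R}^d} f(t)\overline{g(t-x)}e^{-2\pi i \xi t}\,dt,\qquad z=(x,\xi)\in\mathbb{R}^{2d},$$ where $\xi t$ denotes the Euclidean inner product of $\xi,t\in\mathbb{R}^d$. The class $M^{*}(\mathbb{R}^d)$ consists of all $g\in L^2(\mathbb{R}^d)$ with $$\|g\|_{M^*}^2:=\int_{\mathbb{R}^{2d}}|z|\,|V_gg(z)|^2\,dz<+\infty.$$ For $\|g\|_2=1$ and $\Omega\subset\mathbb{R}^{2d}$ compact, the time-frequency localization operator $H_\Omega:L^2(\mathbb{R}^d)\to L^2(\mathbb{R}^d)$ (with window $g$) is $$H_\Omega f(t)=\int_{\mathbb{R}^{2d}}1_\Omega(x,\xi)\,V_gf(x,\xi)\,g(t-x)e^{2\pi i\xi t}\,dx\,d\xi,$$ understood in the weak sense; equivalently, it is the bounded operator with $\langle H_\Omega f,h\rangle=\int_\Omega V_gf(z)\overline{V_gh(z)}\,dz$ for all $f,h\in L^2(\mathbb{R}^d)$. It is compact and positive, so $H_\Omega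 f=\sum_{k\ge1}\lambda_k^\Omega\langle f,h_k^\Omega\rangle h_k^\Omega$, where $\lambda_1^\Omega\ge\lambda_2^\Omega\ge\cdots$ are the non-zero eigenvalues of $H_\Omega$, ordered non-increasingly and counted with multiplicity, and $\{h_k^\Omega\}_{k\ge1}$ are corresponding orthonormal eigenfunctions. Let $|\Omega|$ be the Lebesgue measure of $\Omega$ and let $A_\Omega$ be the smallest integer greater than or equal to $|\Omega|$. The accumulated spectrogram is $$\rho_{g,\Omega}(z):=\sum_{k=1}^{A_\Omega}|V_gh_k^\Omega(z)|^2,\qquad z\in\mathbb{R}^{2d}.$$ For $f\in L^1(\mathbb{R}^{n})$, the variation is $\mathrm{Var}(f):=\sup\{\int_{\mathbb{R}^{n}}f\,\mathrm{div}\,\phi\,dx:\phi\in C_c^1(\mathbb{R}^{n},\mathbb{R}^{n}),\ |\phi(x)|_2\le1 \text{ for all } x\}$. A compact set $\Omega\subset\mathbb{R}^{2d}$ has finite perimeter if its indicator function $1_\Omega$ is of bounded variation, and its perimeter is then $|\partial\Omega|:=\mathrm{Var}(1_\Omega)$ (so $|\partial\Omega|$ denotes this number). *)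

theory Defs
  imports "HOL-Analysis.Analysis"
begin

text \<open>
  \<open>\<real>\<^sup>d\<close> is \<open>real ^ 'n\<close> with \<open>d = CARD('n) \<ge> 1\<close>. The phase space \<open>\<real>\<^sup>2\<^sup>d\<close> is
  \<open>(real ^ 'n) \<times> (real ^ 'n)\<close>; its library norm is the Euclidean one and its
  \<open>lborel\<close> is the Lebesgue measure of \<open>\<real>\<^sup>2\<^sup>d\<close>.

  Elements of \<open>L\<^sup>2\<close> are given by representatives, which are taken Borel measurable: every
  Lebesgue measurable function agrees almost everywhere with a Borel measurable one, and all
  notions below depend only on the almost-everywhere classes of the functions involved.
\<close>

definition L2 :: "('a::euclidean_space \<Rightarrow> complex) set" where
  "L2 = {f. f \<in> borel_measurable lborel \<and> integrable lborel (\<lambda>t. (norm (f t))\<^sup>2)}"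

definition L2_inner ::
  "('a::euclidean_space \<Rightarrow> complex) \<Rightarrow> ('a \<Rightarrow> complex) \<Rightarrow> complex" where
  "L2_inner f h = (LINT t|lborel. f t * cnj (h t))"

definition L2_norm :: "('a::euclidean_space \<Rightarrow> complex) \<Rightarrow> real" where
  "L2_norm f = sqrt (LINT t|lborel. (norm (f t))\<^sup>2)"

text \<open>Short-time Fourier transform \<open>V\<^sub>g f\<close> with window \<open>g\<close>; the window is the first argument.\<close>

definition stft ::
  "(real ^ 'n \<Rightarrow> complex) \<Rightarrow> (real ^ 'n \<Rightarrow> complex) \<Rightarrow> (real ^ 'n) \<times> (real ^ 'n) \<Rightarrow> complex" where
  "stft g f = (\<lambda>(x, \<xi>). LINT t|lborel.
     f t * cnj (g (t - x)) * exp (- 2 * of_real pi * \<i> * of_real (\<xi> \<bullet> t)))"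

definition M_star :: "(real ^ 'n \<Rightarrow> complex) set" where
  "M_star = {g. g \<in> L2 \<and> integrable lborel (\<lambda>z. norm z * (norm (stft g g z))\<^sup>2)}"

text \<open>
  The localization operator in the weak sense. The condition determines the function
  \<open>u\<close> up to a null set, so equations for the operator are to be read almost everywhere.
\<close>

definition localization_operator ::
  "(real ^ 'n \<Rightarrow> complex) \<Rightarrow> ((real ^ 'n) \<times> (real ^ 'n)) set \<Rightarrow>
   (real ^ 'n \<Rightarrow> complex) \<Rightarrow> (real ^ 'n \<Rightarrow> complex)" where
  "localization_operator g \<Omega> f =
     (SOME u. u \<in> L2 \<and>
        (\<forall>h\<in>L2. L2_inner u h = (LINT z:\<Omega>|lborel. stft g f z * cnj (stft g h z))))"

text \<open>
  \<open>eigensystem g \<Omega> r \<mu> h\<close>: the sequences \<open>\<mu>\<^sub>k\<close>, \<open>h\<^sub>k\<close> (\<open>k = 1, 2, \<dots>\<close>, up to the rank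
  \<open>r \<le> \<infinity>\<close>) are the non-zero eigenvalues of the localization operator in non-increasing order
  together with corresponding orthonormal eigenfunctions. The expansion in the last clause, which
  converges in \<open>L\<^sup>2\<close>, ensures that every non-zero eigenvalue is listed, with its multiplicity.
\<close>

definition eigensystem ::
  "(real ^ 'n \<Rightarrow> complex) \<Rightarrow> ((real ^ 'n) \<times> (real ^ 'n)) set \<Rightarrow>
   enat \<Rightarrow> (nat \<Rightarrow> real) \<Rightarrow> (nat \<Rightarrow> real ^ 'n \<Rightarrow> complex) \<Rightarrow> bool" where
  "eigensystem g \<Omega> r \<mu> h \<longleftrightarrow>
     (let K = {k. 1 \<le> k \<and> enat k \<le> r} in
      (\<forall>k\<in>K. \<mu> k \<noteq> 0) \<and>
      (\<forall>j\<in>K. \<forall>k\<in>K. j \<le> k \<longrightarrow> \<mu> k \<le> \<mu> j) \<and>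
      (\<forall>k\<in>K. h k \<in> L2) \<and>
      (\<forall>j\<in>K. \<forall>k\<in>K. L2_inner (h j) (h k) = (if j = k then 1 else 0)) \<and>
      (\<forall>k\<in>K. AE t in lborel. localization_operator g \<Omega> (h k) t = of_real (\<mu> k) * h k t) \<and>
      (\<forall>f\<in>L2. (\<lambda>n. L2_norm (\<lambda>t. localization_operator g \<Omega> f t
                 - (\<Sum>k\<in>K \<inter> {..n}. of_real (\<mu> k) * L2_inner f (h k) * h k t)))
               \<longlonglongrightarrow> 0))"

text \<open>
  Since the eigenvalues are at most \<open>1\<close> when \<open>g\<close> is normalized and they add up to the measure of
  \<open>\<Omega>\<close>, there are at least as many of them as there are summands here.
\<close>

definition accumulated_spectrogram ::
  "(real ^ 'n \<Rightarrow> complex) \<Rightarrow> ((real ^ 'n) \<times> (real ^ 'n)) set \<Rightarrow>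
   (nat \<Rightarrow> real ^ 'n \<Rightarrow> complex) \<Rightarrow> (real ^ 'n) \<times> (real ^ 'n) \<Rightarrow> real" where
  "accumulated_spectrogram g \<Omega> h z =
     (\<Sum>k = 1..nat \<lceil>measure lborel \<Omega>\<rceil>. (norm (stft g (h k) z))\<^sup>2)"

definition divergence :: "('a::euclidean_space \<Rightarrow> 'a) \<Rightarrow> 'a \<Rightarrow> real" where
  "divergence \<phi> x = (\<Sum>b\<in>Basis. frechet_derivative \<phi> (at x) b \<bullet> b)"

definition C1_compact_support :: "('a::euclidean_space \<Rightarrow> 'a) set" where
  "C1_compact_support =
     {\<phi>. (\<forall>x. \<phi> differentiable (at x)) \<and>
         (\<forall>v. continuous_on UNIV (\<lambda>x. frechet_derivative \<phi> (at x) v)) \<and>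
         compact (closure {x. \<phi> x \<noteq> 0})}"

definition variation :: "('a::euclidean_space \<Rightarrow> real) \<Rightarrow> ereal" where
  "variation f =
     (SUP \<phi> \<in> {\<phi> \<in> C1_compact_support. \<forall>x. norm (\<phi> x) \<le> 1}.
        ereal (LINT x|lborel. f x * divergence \<phi> x))"

definition finite_perimeter :: "('a::euclidean_space) set \<Rightarrow> bool" where
  "finite_perimeter \<Omega> \<longleftrightarrow>
     integrable lborel (indicat_real \<Omega>) \<and> variation (indicat_real \<Omega>) < \<infinity>"

definition perimeter :: "('a::euclidean_space) set \<Rightarrow> real" where
  "perimeter \<Omega> = real_of_ereal (variation (indicat_real \<Omega>))"

end

theory Submission
  imports Defs "HOL-Probability.Characteristic_Functions"
begin

text \<open>
  Let \<open>k = |V\<^sub>g g|\<^sup>2\<close>. By Moyal's identity \<open>k\<close> is a probability density on phase space, and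
  \<open>g \<in> M_star\<close> says that its first moment \<open>M = \<integral> |z| k(z) dz\<close> is finite. The spectrogram sum
  \<open>\<rho>\<close> and the indicator function of \<open>\<Omega>\<close> are both compared with the smoothed indicator function
  \<open>\<Theta>(z) = \<integral>\<^sub>\<Omega> k(w - z) dw\<close>.

  The number \<open>\<Theta>(z)\<close> is the quadratic form of the localization operator at the time-frequency shift
  of \<open>g\<close> by \<open>z\<close>, since \<open>|V\<^sub>g|\<close> of that shift is a translate of \<open>|V\<^sub>g g|\<close>. The spectral expansion
  therefore gives \<open>\<Theta> = \<Sum> \<lambda>\<^sub>k |V\<^sub>g h\<^sub>k|\<^sup>2\<close>, summed over all eigenvalues
  (\<open>weighted_spectrogram_sums\<close>), whereas \<open>\<rho>\<close> replaces the weights \<open>\<lambda>\<^sub>k\<close> by \<open>1\<close> for the first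
  \<open>A = \<lceil>|\<Omega>|\<rceil>\<close> indices and by \<open>0\<close> for the others.

  \<^item> \<open>\<Theta>\<close> is close to the indicator function: translating \<open>\<Omega>\<close> by \<open>v\<close> changes its indicator function by
    at most \<open>|v| |\<partial>\<Omega>|\<close> in \<open>L\<^sup>1\<close> (\<open>translation_le_perimeter\<close>), and averaging this over the density \<open>k\<close>
    costs \<open>M |\<partial>\<Omega>|\<close> (\<open>smoothing_error\<close>).

  \<^item> \<open>\<rho>\<close> is close to \<open>\<Theta>\<close>: each \<open>|V\<^sub>g h\<^sub>k|\<^sup>2\<close> has integral \<open>1\<close>, so the \<open>L\<^sup>1\<close> distance is at most
    \<open>\<Sum>\<^sub>k\<^sub>\<le>\<^sub>A (1 - \<lambda>\<^sub>k) + \<Sum>\<^sub>k\<^sub>>\<^sub>A \<lambda>\<^sub>k\<close> (\<open>accumulated_spectrogram_error\<close>). Integrating \<open>\<Theta>\<close> over phase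
    space yields \<open>\<Sum> \<lambda>\<^sub>k = |\<Omega>|\<close>, integrating it over \<open>\<Omega>\<close> yields \<open>\<Sum> \<lambda>\<^sub>k\<^sup>2\<close> (\<open>eig_value_sums\<close>). Hence
    \<open>\<Sum> \<lambda>\<^sub>k (1 - \<lambda>\<^sub>k) = \<integral>\<^sub>\<Omega> (1 - \<Theta>) \<le> M |\<partial>\<Omega>|\<close> by the first comparison. Because the sum is cut at
    the total mass of the eigenvalues, rounded up, this controls both partial sums
    (\<open>truncated_spectrum_defect\<close>): together they are at most \<open>2 M |\<partial>\<Omega>| + 1\<close>.

  The total is \<open>3 M |\<partial>\<Omega>| + 1\<close>, which is at most \<open>(1 + 3 M) |\<partial>\<Omega>|\<close> as \<open>|\<partial>\<Omega>| \<ge> 1\<close>.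

  Two classical facts are needed on the way. Moyal's identity rests on the Plancherel theorem, which
  is obtained by Gaussian summation from the continuity of translations in \<open>L\<^sup>2\<close>. The perimeter
  estimate is dual to writing a difference \<open>\<psi>(x - w) - \<psi>(x)\<close> as the divergence of a test field.
\<close>

section \<open>Square integrable functions\<close>

lemma borel_measurable_cnj [measurable (raw)]:
  "f \<in> borel_measurable M \<Longrightarrow> (\<lambda>x. cnj (f x)) \<in> borel_measurable M"
  by (rule borel_measurable_continuous_on[where f=cnj]) (auto intro: continuous_intros)

lemma L2_measurable: "f \<in> L2 \<Longrightarrow> f \<in> borel_measurable borel"
  by (simp add: L2_def)

lemma L2_square_integrable: "f \<in> L2 \<Longrightarrow> integrable lborel (\<lambda>t. (norm (f t))\<^sup>2)"
  by (simp add: L2_def)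

text \<open>
  The bound \<open>|f h| \<le> |f|\<^sup>2 + |h|\<^sup>2\<close> makes the inner product an absolutely convergent integral.
\<close>

lemma L2_mult_integrable:
  assumes f: "f \<in> L2" and h: "h \<in> L2"
  shows "integrable lborel (\<lambda>t. f t * cnj (h t))"
proof (rule Bochner_Integration.integrable_bound)
  show "integrable lborel (\<lambda>t. (norm (f t))\<^sup>2 + (norm (h t))\<^sup>2)"
    using f h by (simp add: L2_square_integrable)
  show "AE t in lborel. norm (f t * cnj (h t)) \<le> norm ((norm (f t))\<^sup>2 + (norm (h t))\<^sup>2)"
  proof (rule AE_I2)
    fix t
    have "2 * (norm (f t) * norm (h t)) \<le> (norm (f t))\<^sup>2 + (norm (h t))\<^sup>2"
      using sum_squares_bound[of "norm (f t)" "norm (h t)"] by (simp add: mult.assoc)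
    moreover have "0 \<le> norm (f t) * norm (h t)" by simp
    ultimately have "norm (f t) * norm (h t) \<le> (norm (f t))\<^sup>2 + (norm (h t))\<^sup>2" by linarith
    thus "norm (f t * cnj (h t)) \<le> norm ((norm (f t))\<^sup>2 + (norm (h t))\<^sup>2)"
      by (simp add: norm_mult)
  qed
  have [measurable]: "f \<in> borel_measurable borel" "h \<in> borel_measurable borel"
    using f h by (auto simp: L2_measurable)
  show "(\<lambda>t. f t * cnj (h t)) \<in> borel_measurable lborel" by simp
qed

lemma L2_add: assumes f: "f \<in> L2" and h: "h \<in> L2" shows "(\<lambda>t. f t + h t) \<in> L2"
proof -
  have [measurable]: "f \<in> borel_measurable borel" "h \<in> borel_measurable borel"
    using f h by (auto simp: L2_measurable)
  have "integrable lborel (\<lambda>t. (norm (f t + h t))\<^sup>2)"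
  proof (rule Bochner_Integration.integrable_bound)
    show "integrable lborel (\<lambda>t. 2 * (norm (f t))\<^sup>2 + 2 * (norm (h t))\<^sup>2)"
      using f h by (simp add: L2_square_integrable)
    show "AE t in lborel. norm ((norm (f t + h t))\<^sup>2) \<le> norm (2 * (norm (f t))\<^sup>2 + 2 * (norm (h t))\<^sup>2)"
    proof (rule AE_I2)
      fix t
      have "(norm (f t + h t))\<^sup>2 \<le> (norm (f t) + norm (h t))\<^sup>2"
        by (intro power_mono norm_triangle_ineq) auto
      also have "\<dots> \<le> 2 * (norm (f t))\<^sup>2 + 2 * (norm (h t))\<^sup>2"
        using sum_squares_bound[of "norm (f t)" "norm (h t)"] by (simp add: power2_sum)
      finally show "norm ((norm (f t + h t))\<^sup>2) \<le> norm (2 * (norm (f t))\<^sup>2 + 2 * (norm (h t))\<^sup>2)" by simp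
    qed
  qed simp
  thus ?thesis by (simp add: L2_def)
qed

lemma L2_cmult: assumes f: "f \<in> L2" shows "(\<lambda>t. c * f t) \<in> L2"
proof -
  have [measurable]: "f \<in> borel_measurable borel" using f by (auto simp: L2_measurable)
  show ?thesis using f by (simp add: L2_def norm_mult power_mult_distrib)
qed

lemma L2_diff: assumes f: "f \<in> L2" and h: "h \<in> L2" shows "(\<lambda>t. f t - h t) \<in> L2"
  using L2_add[OF f L2_cmult[OF h, of "-1"]] by simp

lemma L2_zero: "(\<lambda>t. 0) \<in> L2" by (simp add: L2_def)

lemma L2_sum: "finite K \<Longrightarrow> (\<And>k. k \<in> K \<Longrightarrow> f k \<in> L2) \<Longrightarrow> (\<lambda>t. \<Sum>k\<in>K. f k t) \<in> L2"
  by (induction K rule: finite_induct) (auto intro: L2_add L2_zero)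

lemma L2_inner_add_left:
  "f \<in> L2 \<Longrightarrow> g \<in> L2 \<Longrightarrow> h \<in> L2 \<Longrightarrow> L2_inner (\<lambda>t. f t + g t) h = L2_inner f h + L2_inner g h"
  by (simp add: L2_inner_def distrib_right L2_mult_integrable)

lemma L2_inner_diff_left:
  "f \<in> L2 \<Longrightarrow> g \<in> L2 \<Longrightarrow> h \<in> L2 \<Longrightarrow> L2_inner (\<lambda>t. f t - g t) h = L2_inner f h - L2_inner g h"
  by (simp add: L2_inner_def left_diff_distrib L2_mult_integrable)

lemma L2_inner_cmult_left: "L2_inner (\<lambda>t. c * f t) h = c * L2_inner f h"
  by (simp add: L2_inner_def mult.assoc)

lemma L2_inner_sum_left:
  "finite K \<Longrightarrow> (\<And>k. k \<in> K \<Longrightarrow> f k \<in> L2) \<Longrightarrow> h \<in> L2 \<Longrightarrow>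
    L2_inner (\<lambda>t. \<Sum>k\<in>K. f k t) h = (\<Sum>k\<in>K. L2_inner (f k) h)"
proof (induction K rule: finite_induct)
  case empty show ?case by (simp add: L2_inner_def)
next
  case (insert k K)
  thus ?case using L2_inner_add_left[of "f k" "\<lambda>t. \<Sum>k\<in>K. f k t" h] L2_sum[of K f] by simp
qed

lemma L2_inner_commute: "L2_inner f h = cnj (L2_inner h f)"
  unfolding L2_inner_def Bochner_Integration.integral_cnj[symmetric] by (simp only: complex_cnj_mult complex_cnj_cnj mult.commute)

lemma L2_norm_nonneg: "0 \<le> L2_norm f"
  by (simp add: L2_norm_def integral_nonneg_AE)

lemma L2_norm_square: "(L2_norm f)\<^sup>2 = (LINT t|lborel. (norm (f t))\<^sup>2)"
  by (simp add: L2_norm_def integral_nonneg_AE)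

lemma L2_inner_self: "L2_inner f f = of_real ((L2_norm f)\<^sup>2)"
  by (simp add: L2_norm_square L2_inner_def complex_norm_square[symmetric] del: of_real_power)

lemma nn_integral_L2:
  assumes "f \<in> L2"
  shows "(\<integral>\<^sup>+t. ennreal ((norm (f t))\<^sup>2) \<partial>lborel) = ennreal ((L2_norm f)\<^sup>2)"
  using assms by (simp add: nn_integral_eq_integral L2_square_integrable L2_norm_square)

text \<open>
  The version with the absolute values inside the integral dominates the integrands in the later
  applications of Fubini's theorem.
\<close>

lemma L2_Cauchy_Schwarz_nn:
  assumes f: "f \<in> L2" and h: "h \<in> L2"
  shows "(\<integral>\<^sup>+t. ennreal (norm (f t) * norm (h t)) \<partial>lborel) \<le> ennreal (L2_norm f * L2_norm h)"
proof -
  have [measurable]: "f \<in> borel_measurable borel" "h \<in> borel_measurable borel"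
    using f h by (auto simp: L2_measurable)
  have "(\<integral>\<^sup>+t. ennreal (norm (f t)) * ennreal (norm (h t)) \<partial>lborel)\<^sup>2
        \<le> (\<integral>\<^sup>+t. (ennreal (norm (f t)))\<^sup>2 \<partial>lborel) * (\<integral>\<^sup>+t. (ennreal (norm (h t)))\<^sup>2 \<partial>lborel)"
    by (rule Cauchy_Schwarz_nn_integral) auto
  also have "\<dots> = (ennreal (L2_norm f * L2_norm h))\<^sup>2"
    using nn_integral_L2[OF f] nn_integral_L2[OF h]
    by (simp add: ennreal_power ennreal_mult[symmetric] power_mult_distrib L2_norm_nonneg)
  finally have "(\<integral>\<^sup>+t. ennreal (norm (f t) * norm (h t)) \<partial>lborel)\<^sup>2 \<le> ennreal ((L2_norm f * L2_norm h)\<^sup>2)"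
    by (simp add: ennreal_mult L2_norm_nonneg power_mult_distrib ennreal_power[symmetric])
  moreover have nn: "0 \<le> L2_norm f * L2_norm h" by (simp add: L2_norm_nonneg)
  ultimately show ?thesis
  proof (cases "\<integral>\<^sup>+t. ennreal (norm (f t) * norm (h t)) \<partial>lborel" rule: ennreal_cases)
    case (real r)
    with \<open>_ \<le> ennreal ((L2_norm f * L2_norm h)\<^sup>2)\<close> have "r\<^sup>2 \<le> (L2_norm f * L2_norm h)\<^sup>2"
      by (simp only: ennreal_power ennreal_le_iff zero_le_power2)
    hence "r \<le> L2_norm f * L2_norm h" using nn by (rule power2_le_imp_le)
    with real show ?thesis by (simp add: ennreal_leI)
  qed (simp add: top_unique)
qed

lemma L2_Cauchy_Schwarz:
  assumes f: "f \<in> L2" and h: "h \<in> L2"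
  shows "norm (L2_inner f h) \<le> L2_norm f * L2_norm h"
proof -
  have "ennreal (norm (L2_inner f h)) \<le> (\<integral>\<^sup>+t. ennreal (norm (f t * cnj (h t))) \<partial>lborel)"
    unfolding L2_inner_def by (rule integral_norm_bound_ennreal[OF L2_mult_integrable[OF f h]])
  also have "\<dots> \<le> ennreal (L2_norm f * L2_norm h)"
    using L2_Cauchy_Schwarz_nn[OF f h] by (simp add: norm_mult)
  finally show ?thesis by (simp add: L2_norm_nonneg)
qed

section \<open>Continuity of translations\<close>

lemma continuous_bounded_support_integrable:
  fixes \<psi> :: "'a::euclidean_space \<Rightarrow> 'b::{banach, second_countable_topology}"
  assumes "continuous_on UNIV \<psi>" and "\<And>x. norm x > R \<Longrightarrow> \<psi> x = 0"
  shows "integrable lborel \<psi>"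
proof -
  have "integrable lborel (\<lambda>x. indicator (cball 0 R) x *\<^sub>R \<psi> x)"
    by (rule borel_integrable_compact) (auto intro: continuous_on_subset[OF assms(1)])
  moreover have "(\<lambda>x. indicator (cball 0 R) x *\<^sub>R \<psi> x) = \<psi>"
    using assms(2) by (auto simp: indicator_def fun_eq_iff not_le)
  ultimately show ?thesis by simp
qed

text \<open>
  By regularity of Lebesgue measure there are a compact \<open>K \<subseteq> E\<close> and an open \<open>U \<supseteq> K\<close> such that
  \<open>E - K\<close> and \<open>U - K\<close> are small. A Urysohn function that is \<open>1\<close> on \<open>K\<close> and \<open>0\<close> outside a bounded part
  of \<open>U\<close> differs from the indicator function only on these two sets.
\<close>

lemma indicator_approx_continuous:
  fixes E :: "'a::euclidean_space set"
  assumes E: "E \<in> sets lborel" "emeasure lborel E < \<infinity>" and e: "0 < e"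
  obtains \<psi> :: "'a \<Rightarrow> real" and R where "continuous_on UNIV \<psi>" "\<And>x. norm x > R \<Longrightarrow> \<psi> x = 0"
    "(LINT x|lborel. \<bar>indicat_real E x - \<psi> x\<bar>) < e"
proof -
  \<comment> \<open>Restricting the measure to \<open>E\<close> makes it finite, as inner regularity requires.\<close>
  let ?M = "density lborel (indicator E)"
  have emM: "emeasure ?M B = emeasure lborel (E \<inter> B)" if "B \<in> sets borel" for B
    using E that by (simp add: emeasure_density nn_integral_indicator indicator_inter_arith[symmetric])
  have "emeasure ?M E = (SUP K \<in> {K. K \<subseteq> E \<and> compact K}. emeasure ?M K)"
  proof (rule inner_regular)
    show "emeasure ?M (space ?M) \<noteq> \<infinity>" using E emM[of UNIV] by auto
  qed (use E in auto)
  hence sup: "emeasure lborel E = (SUP K \<in> {K. K \<subseteq> E \<and> compact K}. emeasure ?M K)"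
    using emM[of E] E by simp
  obtain a where a: "emeasure lborel E = ennreal a" "0 \<le> a"
    using E(2) by (cases "emeasure lborel E") auto
  have "\<exists>K. K \<subseteq> E \<and> compact K \<and> emeasure lborel (E - K) < ennreal (e/2)"
  proof (cases "a = 0")
    case True thus ?thesis using e a by (intro exI[of _ "{}"]) auto
  next
    case False
    hence "ennreal (a - e/2) < emeasure lborel E" using a e by (auto simp: ennreal_lessI)
    then obtain K where K: "K \<subseteq> E" "compact K" "ennreal (a - e/2) < emeasure ?M K"
      unfolding sup by (auto simp: less_SUP_iff)
    have Kb: "K \<in> sets borel" using K borel_compact by auto
    have "E \<inter> K = K" using K by auto
    hence K3: "ennreal (a - e/2) < emeasure lborel K"
      using K emM[OF Kb] by simp
    obtain k where k: "emeasure lborel K = ennreal k" "0 \<le> k"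
      using emeasure_compact_finite[OF K(2)] by (cases "emeasure lborel K") auto
    have "a - e/2 < k" using K3 k by (metis ennreal_leI leD leI)
    have "emeasure lborel (E - K) = emeasure lborel E - emeasure lborel K"
      using K E Kb k by (intro emeasure_Diff) auto
    also have "\<dots> = ennreal (a - k)" using a k by (simp add: ennreal_minus)
    also have "\<dots> < ennreal (e/2)" using \<open>a - e/2 < k\<close> e by (intro ennreal_lessI) auto
    finally show ?thesis using K by blast
  qed
  then obtain K where K: "K \<subseteq> E" "compact K" and m1: "emeasure lborel (E - K) < ennreal (e/2)" by blast
  have Kb[measurable]: "K \<in> sets borel" using K borel_compact by auto
  have "K \<in> sets lebesgue" by (rule sets_completionI_sets) (simp add: Kb)
  moreover have "0 < e/2" using e by simp
  ultimately obtain U where U: "open U" "K \<subseteq> U" "emeasure lebesgue (U - K) < ennreal (e/2)"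
    by (rule sets_lebesgue_outer_open)
  obtain R where R: "\<And>x. x \<in> K \<Longrightarrow> norm x \<le> R" using compact_imp_bounded[OF K(2)] bounded_iff by metis
  let ?U = "U \<inter> ball 0 (R+1)"
  obtain \<psi> :: "'a \<Rightarrow> real" where \<psi>: "continuous_on UNIV \<psi>" "\<And>x. \<psi> x \<in> closed_segment 1 0"
    "\<And>x. x \<in> K \<Longrightarrow> \<psi> x = 1" "\<And>x. x \<in> - ?U \<Longrightarrow> \<psi> x = 0"
  proof (rule Urysohn[of K "- ?U" "1::real" 0])
    show "closed K" using K compact_imp_closed by auto
    show "closed (- ?U)" using U(1) by (intro closed_Compl) auto
    show "K \<inter> - ?U = {}" using U(2) R by force
  qed blast
  have \<psi>01: "0 \<le> \<psi> x \<and> \<psi> x \<le> 1" for x using \<psi>(2)[of x] by (auto simp: closed_segment_eq_real_ivl)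
  have supp: "\<psi> x = 0" if "norm x > R + 1" for x using that \<psi>(4)[of x] by auto
  have int\<psi>: "integrable lborel \<psi>"
    by (rule continuous_bounded_support_integrable[OF \<psi>(1) supp])
  have Ub[measurable]: "U \<in> sets borel" using U(1) by (rule borel_open)
  have Eb[measurable]: "E \<in> sets borel" using E(1) by (simp only: sets_lborel)
  have UK: "U - K \<in> sets lborel" unfolding sets_lborel using Ub Kb by (rule sets.Diff)
  have "emeasure lebesgue (U - K) = emeasure lborel (main_part lborel (U - K))"
    by (rule emeasure_completion[OF sets_completionI_sets[OF UK]])
  with U(3) have m2: "emeasure lborel (U - K) < ennreal (e/2)" by (simp only: main_part[OF UK])
  have "ennreal (LINT x|lborel. \<bar>indicat_real E x - \<psi> x\<bar>) = (\<integral>\<^sup>+x. ennreal \<bar>indicat_real E x - \<psi> x\<bar> \<partial>lborel)"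
    using int\<psi> E by (intro nn_integral_eq_integral[symmetric]) (auto intro!: integrable_abs Bochner_Integration.integrable_diff)
  also have "\<dots> \<le> (\<integral>\<^sup>+x. indicator (E - K) x + indicator (U - K) x \<partial>lborel)"
  proof (intro nn_integral_mono)
    fix x 
    have "\<bar>indicat_real E x - \<psi> x\<bar> \<le> indicat_real (E - K) x + indicat_real (U - K) x"
      using \<psi>01[of x] \<psi>(3)[of x] \<psi>(4)[of x] K(1) by (auto simp: indicator_def split: if_splits)
    hence "ennreal \<bar>indicat_real E x - \<psi> x\<bar> \<le> ennreal (indicat_real (E - K) x + indicat_real (U - K) x)"
      by (rule ennreal_leI)
    thus "ennreal \<bar>indicat_real E x - \<psi> x\<bar> \<le> indicator (E - K) x + indicator (U - K) x"
      by (simp add: ennreal_indicator)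
  qed
  also have "\<dots> = emeasure lborel (E - K) + emeasure lborel (U - K)"
    using E by (subst nn_integral_add) auto
  also have "\<dots> < ennreal (e/2) + ennreal (e/2)" using m1 m2 by (rule add_strict_mono)
  also have "\<dots> = ennreal e" using e by (simp add: ennreal_plus[symmetric])
  finally have "(LINT x|lborel. \<bar>indicat_real E x - \<psi> x\<bar>) < e"
    using e by (simp add: ennreal_less_iff integral_nonneg_AE)
  with \<psi>(1) supp show ?thesis by (intro that)
qed

text \<open>
  Compactly supported continuous functions are dense in \<open>L\<^sup>1\<close>: the property passes from indicator
  functions to sums and to dominated limits.
\<close>

lemma integrable_approx_continuous:
  fixes f :: "'a::euclidean_space \<Rightarrow> 'b::{banach, second_countable_topology}"
  assumes "integrable lborel f" and "0 < e"
  shows "\<exists>\<psi>. continuous_on UNIV \<psi> \<and> (\<exists>R. \<forall>x. norm x > R \<longrightarrow> \<psi> x = 0) \<and>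
           (LINT x|lborel. norm (f x - \<psi> x)) < e"
  using assms
proof (induction f arbitrary: e rule: integrable_induct)
  case (base A c)
  have "0 < e / (norm c + 1)" using base by (simp add: add_nonneg_pos)
  from indicator_approx_continuous[OF base(1,2) this]
  obtain \<psi> R where \<psi>: "continuous_on UNIV \<psi>" "\<And>x. norm x > R \<Longrightarrow> \<psi> x = 0"
    "(LINT x|lborel. \<bar>indicat_real A x - \<psi> x\<bar>) < e / (norm c + 1)" by blast
  have "(LINT x|lborel. norm (indicat_real A x *\<^sub>R c - \<psi> x *\<^sub>R c)) = (LINT x|lborel. \<bar>indicat_real A x - \<psi> x\<bar> * norm c)"
    by (simp add: scaleR_diff_left[symmetric])
  also have "\<dots> = (LINT x|lborel. \<bar>indicat_real A x - \<psi> x\<bar>) * norm c" by simp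
  also have "\<dots> \<le> (LINT x|lborel. \<bar>indicat_real A x - \<psi> x\<bar>) * (norm c + 1)"
    by (intro mult_left_mono) auto
  also have "\<dots> < e" using \<psi>(3) by (simp add: pos_less_divide_eq add_nonneg_pos)
  finally show ?case using \<psi>
    by (intro exI[of _ "\<lambda>x. \<psi> x *\<^sub>R c"]) (auto intro!: continuous_intros)
next
  case (add f g)
  from add.IH(1)[of "e/2"] add.prems obtain \<psi>1 R1 where 1: "continuous_on UNIV \<psi>1" "\<And>x. norm x > R1 \<Longrightarrow> \<psi>1 x = 0"
    "(LINT x|lborel. norm (f x - \<psi>1 x)) < e/2" by auto
  from add.IH(2)[of "e/2"] add.prems obtain \<psi>2 R2 where 2: "continuous_on UNIV \<psi>2" "\<And>x. norm x > R2 \<Longrightarrow> \<psi>2 x = 0"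
    "(LINT x|lborel. norm (g x - \<psi>2 x)) < e/2" by auto
  have i: "integrable lborel \<psi>1" "integrable lborel \<psi>2"
    using continuous_bounded_support_integrable 1 2 by blast+
  have "(LINT x|lborel. norm (f x + g x - (\<psi>1 x + \<psi>2 x))) \<le> (LINT x|lborel. norm (f x - \<psi>1 x) + norm (g x - \<psi>2 x))"
    using add.hyps i by (intro integral_mono) (auto simp: add_diff_add norm_triangle_ineq)
  also have "\<dots> < e" using add.hyps i 1(3) 2(3) by simp
  finally show ?case using 1 2
    by (intro exI[of _ "\<lambda>x. \<psi>1 x + \<psi>2 x"] conjI exI[of _ "max R1 R2"]) (auto intro!: continuous_intros)
next
  case (lim f s)
  have "(\<lambda>i. LINT x|lborel. norm (f x - s i x)) \<longlonglongrightarrow> (LINT x|(lborel::'a measure). 0)"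
  proof (rule integral_dominated_convergence[where w="\<lambda>x. 3 * norm (f x)"])
    show "AE x in lborel. (\<lambda>i. norm (f x - s i x)) \<longlonglongrightarrow> 0"
    proof (rule AE_I2)
      fix x assume "x \<in> space (lborel :: 'a measure)"
      from lim.hyps(2)[OF this] have "(\<lambda>i. f x - s i x) \<longlonglongrightarrow> f x - f x" by (intro tendsto_intros)
      thus "(\<lambda>i. norm (f x - s i x)) \<longlonglongrightarrow> 0" by (simp add: tendsto_norm_zero)
    qed
    show "AE x in lborel. norm (norm (f x - s i x)) \<le> 3 * norm (f x)" for i
    proof (rule AE_I2)
      fix x assume "x \<in> space (lborel :: 'a measure)"
      from lim.hyps(3)[OF this, of i] show "norm (norm (f x - s i x)) \<le> 3 * norm (f x)"
        using norm_triangle_ineq4[of "f x" "s i x"] by simp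
    qed
  qed (use lim.hyps in \<open>auto\<close>)
  hence "(\<lambda>i. LINT x|lborel. norm (f x - s i x)) \<longlonglongrightarrow> 0" by simp
  from LIMSEQ_D[OF this, of "e/2"] lim.prems obtain i where i: "\<bar>LINT x|lborel. norm (f x - s i x)\<bar> < e/2" by fastforce
  from lim.IH[of "e/2" i] lim.prems obtain \<psi> R where 1: "continuous_on UNIV \<psi>" "\<And>x. norm x > R \<Longrightarrow> \<psi> x = 0"
    "(LINT x|lborel. norm (s i x - \<psi> x)) < e/2" by auto
  have ii: "integrable lborel \<psi>" using continuous_bounded_support_integrable 1 by blast
  have "(LINT x|lborel. norm (f x - \<psi> x)) \<le> (LINT x|lborel. norm (f x - s i x) + norm (s i x - \<psi> x))"
    using lim.hyps ii by (intro integral_mono) (auto intro: norm_diff_triangle_le)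
  also have "\<dots> < e" using lim.hyps ii 1(3) i by simp
  finally show ?case using 1 by blast
qed

lemma lborel_translation:
  fixes u :: "'a::euclidean_space"
  shows "distr lborel borel (\<lambda>x. x - u) = lborel" "distr lborel borel (\<lambda>x. x + u) = lborel"
    "distr lborel borel (\<lambda>x. u - x) = lborel"
  using lborel_affine[of 1 "-u"] lborel_affine[of 1 u] lborel_affine[of "-1" u] 
  by (simp_all add: density_1 add.commute)

lemma integral_shift:
  fixes f :: "'a::euclidean_space \<Rightarrow> 'b::{banach, second_countable_topology}"
  assumes [measurable]: "f \<in> borel_measurable borel"
  shows "(LINT x|lborel. f (x - u)) = (LINT x|lborel. f x)" "(LINT x|lborel. f (x + u)) = (LINT x|lborel. f x)"
    "(LINT x|lborel. f (u - x)) = (LINT x|lborel. f x)"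
    "integrable lborel (\<lambda>x. f (x - u)) \<longleftrightarrow> integrable lborel f"
    "integrable lborel (\<lambda>x. f (x + u)) \<longleftrightarrow> integrable lborel f"
  using integral_distr[of "\<lambda>x. x - u" lborel borel f] integral_distr[of "\<lambda>x. x + u" lborel borel f]
    integral_distr[of "\<lambda>x. u - x" lborel borel f]
    integrable_distr_eq[of "\<lambda>x. x - u" lborel borel f] integrable_distr_eq[of "\<lambda>x. x + u" lborel borel f]
  by (simp_all add: lborel_translation)

lemma nn_integral_reflect:
  fixes f :: "'a::euclidean_space \<Rightarrow> ennreal"
  assumes [measurable]: "f \<in> borel_measurable borel"
  shows "(\<integral>\<^sup>+x. f (u - x) \<partial>lborel) = (\<integral>\<^sup>+x. f x \<partial>lborel)"
  using nn_integral_distr[of "\<lambda>x. u - x" lborel borel f] by (simp add: lborel_translation)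

text \<open>
  For a continuous function of bounded support this is dominated convergence; translation is an
  isometry of \<open>L\<^sup>1\<close>, so the general case follows by approximation.
\<close>

lemma L1_translation_continuous:
  fixes f :: "'a::euclidean_space \<Rightarrow> 'b::{banach, second_countable_topology}"
  assumes f: "integrable lborel f" and u: "u \<longlonglongrightarrow> 0"
  shows "(\<lambda>n. LINT x|lborel. norm (f x - f (x - u n))) \<longlonglongrightarrow> 0"
proof (rule LIMSEQ_I)
  fix e :: real assume e: "e > 0"
  have [measurable]: "f \<in> borel_measurable borel" using f by auto
  from integrable_approx_continuous[OF f, of "e/3"] e obtain \<psi> R where 
    \<psi>: "continuous_on UNIV \<psi>" "\<And>x. norm x > R \<Longrightarrow> \<psi> x = 0" "(LINT x|lborel. norm (f x - \<psi> x)) < e/3" by auto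
  have i: "integrable lborel \<psi>" using continuous_bounded_support_integrable \<psi> by blast
  have [measurable]: "\<psi> \<in> borel_measurable borel" using i by auto
  have "compact (\<psi> ` cball 0 R)" using \<psi>(1) by (intro compact_continuous_image) (auto intro: continuous_on_subset)
  then obtain B0 where B0: "\<And>x. x \<in> cball 0 R \<Longrightarrow> norm (\<psi> x) \<le> B0" 
    using compact_imp_bounded bounded_iff by (metis imageI)
  define B where "B = max B0 0"
  have B: "norm (\<psi> x) \<le> B" for x using B0[of x] \<psi>(2)[of x] by (cases "norm x > R") (auto simp: B_def)
  have "B \<ge> 0" by (simp add: B_def)
  obtain N where N: "\<And>n. n \<ge> N \<Longrightarrow> norm (u n) < 1" using LIMSEQ_D[OF u, of 1] by auto
  have "(\<lambda>n. LINT x|lborel. norm (\<psi> x - \<psi> (x - u (n+N)))) \<longlonglongrightarrow> (LINT x|(lborel::'a measure). 0)"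
  proof (rule integral_dominated_convergence[where w="\<lambda>x. 2 * B * indicator (cball 0 (R+1)) x"])
    show "AE x in lborel. (\<lambda>n. norm (\<psi> x - \<psi> (x - u (n+N)))) \<longlonglongrightarrow> 0"
    proof (rule AE_I2)
      fix x
      have "(\<lambda>n. x - u (n+N)) \<longlonglongrightarrow> x - 0" using LIMSEQ_ignore_initial_segment[OF u] by (intro tendsto_intros)
      moreover have "isCont \<psi> x" using \<psi>(1) continuous_on_eq_continuous_at by blast
      ultimately have "(\<lambda>n. \<psi> (x - u (n+N))) \<longlonglongrightarrow> \<psi> x" using isCont_tendsto_compose[of x \<psi>] by simp
      hence "(\<lambda>n. \<psi> x - \<psi> (x - u (n+N))) \<longlonglongrightarrow> \<psi> x - \<psi> x" by (intro tendsto_intros)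
      thus "(\<lambda>n. norm (\<psi> x - \<psi> (x - u (n+N)))) \<longlonglongrightarrow> 0" by (simp add: tendsto_norm_zero)
    qed
    show "AE x in lborel. norm (norm (\<psi> x - \<psi> (x - u (n+N)))) \<le> 2 * B * indicator (cball 0 (R+1)) x" for n
    proof (rule AE_I2)
      fix x
      show "norm (norm (\<psi> x - \<psi> (x - u (n+N)))) \<le> 2 * B * indicator (cball 0 (R+1)) x"
      proof (cases "norm x > R + 1")
        case True
        have "norm (x - u (n+N)) \<ge> norm x - norm (u (n+N))" by (rule norm_triangle_ineq2)
        hence "norm (x - u (n+N)) > R" using N[of "n+N"] True by simp
        thus ?thesis using True \<psi>(2) by simp
      next
        case False
        thus ?thesis using B[of x] B[of "x - u (n+N)"] norm_triangle_ineq4[of "\<psi> x" "\<psi> (x - u (n+N))"] by simp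
      qed
    qed
    show "integrable lborel (\<lambda>x::'a. 2 * B * indicator (cball 0 (R+1)) x)"
      using emeasure_lborel_cball_finite[of "0::'a" "R+1"]
      by (intro integrable_mult_right integrable_real_indicator) auto
  qed auto
  hence "(\<lambda>n. LINT x|lborel. norm (\<psi> x - \<psi> (x - u (n+N)))) \<longlonglongrightarrow> 0" by simp
  from LIMSEQ_D[OF this, of "e/3"] e obtain n0 where 
    n0: "\<And>n. n \<ge> n0 \<Longrightarrow> \<bar>LINT x|lborel. norm (\<psi> x - \<psi> (x - u (n+N)))\<bar> < e/3" by auto
  have n0': "(LINT x|lborel. norm (\<psi> x - \<psi> (x - u n))) < e/3" if "n \<ge> n0 + N" for n
    using n0[of "n - N"] that by simp
  have "norm ((LINT x|lborel. norm (f x - f (x - u n))) - 0) < e" if n: "n \<ge> n0 + N" for n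
  proof -
    have [simp]: "integrable lborel (\<lambda>x. f (x - u n))" "integrable lborel (\<lambda>x. \<psi> (x - u n))"
      using f i by (auto simp: integral_shift)
    have "norm (f x - f (x - u n)) \<le> norm (f x - \<psi> x) + norm (\<psi> x - \<psi> (x - u n)) + norm (f (x - u n) - \<psi> (x - u n))" for x
    proof -
      have "f x - f (x - u n) = (f x - \<psi> x) + (\<psi> x - \<psi> (x - u n)) - (f (x - u n) - \<psi> (x - u n))" by simp
      also have "norm \<dots> \<le> norm ((f x - \<psi> x) + (\<psi> x - \<psi> (x - u n))) + norm (f (x - u n) - \<psi> (x - u n))"
        by (rule norm_triangle_ineq4)
      also have "\<dots> \<le> norm (f x - \<psi> x) + norm (\<psi> x - \<psi> (x - u n)) + norm (f (x - u n) - \<psi> (x - u n))"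
        by (intro add_right_mono norm_triangle_ineq)
      finally show ?thesis .
    qed
    hence "(LINT x|lborel. norm (f x - f (x - u n))) \<le> (LINT x|lborel. norm (f x - \<psi> x) + norm (\<psi> x - \<psi> (x - u n)) + norm (f (x - u n) - \<psi> (x - u n)))"
      using f i by (intro integral_mono) auto
    also have "\<dots> = (LINT x|lborel. norm (f x - \<psi> x)) + (LINT x|lborel. norm (\<psi> x - \<psi> (x - u n))) + (LINT x|lborel. norm (f (x - u n) - \<psi> (x - u n)))"
      using f i by simp
    also have "(LINT x|lborel. norm (f (x - u n) - \<psi> (x - u n))) = (LINT x|lborel. norm (f x - \<psi> x))"
      using integral_shift(1)[of "\<lambda>x. norm (f x - \<psi> x)" "u n"] by simp
    finally have "(LINT x|lborel. norm (f x - f (x - u n))) < e"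
      using \<psi>(3) n0'[of n] n by linarith
    thus ?thesis by (simp add: abs_of_nonneg integral_nonneg_AE)
  qed
  thus "\<exists>no. \<forall>n\<ge>no. norm ((LINT x|lborel. norm (f x - f (x - u n))) - 0) < e" by blast
qed

text \<open>
  The map \<open>a \<mapsto> |a| a\<close> sends \<open>L\<^sup>2\<close> to \<open>L\<^sup>1\<close>, and this inequality says that its inverse is continuous.
  It allows continuity of translations in \<open>L\<^sup>2\<close> to be read off from that in \<open>L\<^sup>1\<close>. The proof is the
  monotonicity estimate \<open>(|a| a - |b| b) \<bullet> (a - b) \<ge> (|a| + |b|) |a - b|\<^sup>2 / 2\<close>.
\<close>

lemma norm_diff_square_le:
  fixes a b :: "'a::real_inner"
  shows "(norm (a - b))\<^sup>2 \<le> 2 * norm (norm a *\<^sub>R a - norm b *\<^sub>R b)"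
proof (cases "a = b")
  case False
  let ?p = "norm a" let ?q = "norm b"
  have n2: "(norm (a - b))\<^sup>2 = ?p\<^sup>2 + ?q\<^sup>2 - 2 * (a \<bullet> b)"
    by (simp add: power2_norm_eq_inner inner_diff inner_commute)
  have "norm (a-b) * (norm (a - b))\<^sup>2 \<le> (?p + ?q) * (norm (a - b))\<^sup>2"
    by (intro mult_right_mono norm_triangle_ineq4) auto
  also have "\<dots> \<le> (?p + ?q) * (norm (a - b))\<^sup>2 + (?p - ?q)\<^sup>2 * (?p + ?q)" by simp
  also have "\<dots> = 2 * ((?p *\<^sub>R a - ?q *\<^sub>R b) \<bullet> (a - b))"
    unfolding n2 by (simp add: inner_diff inner_commute power2_norm_eq_inner[symmetric] algebra_simps power2_eq_square)
  also have "\<dots> \<le> 2 * (norm (?p *\<^sub>R a - ?q *\<^sub>R b) * norm (a - b))"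
    using norm_cauchy_schwarz by (intro mult_left_mono) auto
  finally have "norm (a - b) * (norm (a - b))\<^sup>2 \<le> norm (a - b) * (2 * norm (?p *\<^sub>R a - ?q *\<^sub>R b))" by (simp add: mult_ac)
  thus ?thesis using False by (simp add: mult_le_cancel_left)
qed simp

lemma L2_translate:
  assumes f: "f \<in> L2" shows "(\<lambda>t. f (t - u)) \<in> L2" and "L2_norm (\<lambda>t. f (t - u)) = L2_norm f"
proof -
  have [measurable]: "f \<in> borel_measurable borel" using f by (rule L2_measurable)
  show "(\<lambda>t. f (t - u)) \<in> L2"
    using L2_square_integrable[OF f] integral_shift(4)[of "\<lambda>t. (norm (f t))\<^sup>2" u] by (simp add: L2_def)
  show "L2_norm (\<lambda>t. f (t - u)) = L2_norm f"
    using integral_shift(1)[of "\<lambda>t. (norm (f t))\<^sup>2" u] by (simp add: L2_norm_def)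
qed

lemma L2_inner_diff_right:
  "f \<in> L2 \<Longrightarrow> g \<in> L2 \<Longrightarrow> h \<in> L2 \<Longrightarrow> L2_inner f (\<lambda>t. g t - h t) = L2_inner f g - L2_inner f h"
  by (simp add: L2_inner_def right_diff_distrib L2_mult_integrable)

text \<open>
  Applying the preceding inequality pointwise with \<open>G = |F| F\<close>, the squared \<open>L\<^sup>2\<close> distance between
  \<open>F\<close> and its translate is at most twice the \<open>L\<^sup>1\<close> distance between \<open>G\<close> and its translate.
\<close>

lemma L2_autocorrelation_continuous:
  assumes F: "F \<in> L2" and u: "u \<longlonglongrightarrow> 0"
  shows "(\<lambda>n. L2_inner F (\<lambda>t. F (t - u n))) \<longlonglongrightarrow> of_real ((L2_norm F)\<^sup>2)"
proof -
  have [measurable]: "F \<in> borel_measurable borel" using F by (rule L2_measurable)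
  define G where "G = (\<lambda>t. norm (F t) *\<^sub>R F t)"
  have [measurable]: "G \<in> borel_measurable borel" by (simp add: G_def)
  have G: "integrable lborel G"
    by (rule Bochner_Integration.integrable_bound[OF L2_square_integrable[OF F]])
      (auto simp: G_def power2_eq_square)
  let ?D = "\<lambda>n t. F t - F (t - u n)"
  have D: "?D n \<in> L2" for n using F L2_translate(1)[OF F] by (rule L2_diff)
  have "(L2_norm (?D n))\<^sup>2 \<le> 2 * (LINT t|lborel. norm (G t - G (t - u n)))" for n
  proof -
    have i: "integrable lborel (\<lambda>t. norm (G t - G (t - u n)))"
      using G integral_shift(4)[of G "u n"] by (intro integrable_norm Bochner_Integration.integrable_diff) auto
    have "(L2_norm (?D n))\<^sup>2 \<le> (LINT t|lborel. 2 * norm (G t - G (t - u n)))"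
      unfolding L2_norm_square
      by (rule integral_mono[OF L2_square_integrable[OF D] integrable_mult_right[OF i]])
        (use norm_diff_square_le in \<open>auto simp: G_def\<close>)
    thus ?thesis by simp
  qed
  hence "norm (L2_norm (?D n)) \<le> sqrt (2 * (LINT t|lborel. norm (G t - G (t - u n))))" for n
    using L2_norm_nonneg[of "?D n"] by (simp add: real_le_rsqrt)
  moreover have "(\<lambda>n. sqrt (2 * (LINT t|lborel. norm (G t - G (t - u n))))) \<longlonglongrightarrow> sqrt (2 * 0)"
    by (intro tendsto_intros L1_translation_continuous[OF G u])
  ultimately have "(\<lambda>n. L2_norm (?D n)) \<longlonglongrightarrow> 0"
    by (intro Lim_null_comparison[where f="\<lambda>n. L2_norm (?D n)"]) auto
  hence "(\<lambda>n. L2_norm F * L2_norm (?D n)) \<longlonglongrightarrow> 0" by (rule tendsto_mult_right_zero)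
  moreover have bound: "norm (L2_inner F (\<lambda>t. F (t - u n)) - of_real ((L2_norm F)\<^sup>2)) \<le> L2_norm F * L2_norm (?D n)" for n
  proof -
    have "L2_inner F (\<lambda>t. F (t - u n)) - of_real ((L2_norm F)\<^sup>2) = - L2_inner F (?D n)"
      unfolding L2_inner_diff_right[OF F F L2_translate(1)[OF F, of "u n"]] L2_inner_self by simp
    thus ?thesis using L2_Cauchy_Schwarz[OF F D[of n]] by (simp only: norm_minus_cancel)
  qed
  ultimately have "(\<lambda>n. L2_inner F (\<lambda>t. F (t - u n)) - of_real ((L2_norm F)\<^sup>2)) \<longlonglongrightarrow> 0"
    by (intro Lim_null_comparison[OF always_eventually[OF allI[OF bound]]])
  thus ?thesis by (rule LIM_zero_cancel)
qed

section \<open>Gaussians and the Plancherel theorem\<close>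

definition phase :: "real \<Rightarrow> complex" where
  "phase x = exp (- 2 * of_real pi * \<i> * of_real x)"

lemma norm_phase [simp]: "norm (phase x) = 1"
  unfolding phase_def by (simp add: norm_exp_eq_Re)

lemma phase_0 [simp]: "phase 0 = 1"
  by (simp add: phase_def)

lemma phase_add: "phase (x + y) = phase x * phase y"
  by (simp add: phase_def distrib_left exp_add[symmetric])

lemma cnj_phase [simp]: "cnj (phase x) = phase (- x)"
  unfolding phase_def exp_cnj by (simp add: complex_cnj_mult)

lemma phase_sum: "finite B \<Longrightarrow> phase (\<Sum>b\<in>B. f b) = (\<Prod>b\<in>B. phase (f b))"
  by (induction B rule: finite_induct) (auto simp: phase_add)

lemma borel_measurable_phase [measurable]: "phase \<in> borel_measurable borel"
  unfolding phase_def by (intro borel_measurable_continuous_onI continuous_intros)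

lemma integrable_gaussian_real: "integrable lborel (\<lambda>x::real. exp (- (pi * x\<^sup>2)))"
proof -
  have "integrable lborel (\<lambda>x::real. sqrt (2 * pi) * std_normal_density (0 + sqrt (2 * pi) * x))"
    using integrable_normal_density[of 1 0]
    by (intro integrable_mult_right lborel_integrable_real_affine) auto
  thus ?thesis by (simp add: std_normal_density_def power_mult_distrib)
qed

text \<open>
  The characteristic function of the standard normal distribution, rescaled by \<open>\<surd>(2\<pi>)\<close>.
\<close>

lemma fourier_gaussian_real:
  "(LINT x|lborel. of_real (exp (- (pi * x\<^sup>2))) * phase (x * u)) = of_real (exp (- (pi * u\<^sup>2)))"
proof -
  let ?c = "sqrt (2 * pi)"
  have "char std_normal_distribution (- (?c * u)) = of_real (exp (- (pi * u\<^sup>2)))"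
    by (simp add: char_std_normal_distribution power_mult_distrib)
  also have "char std_normal_distribution (- (?c * u)) =
    (LINT x|lborel. std_normal_density x *\<^sub>R iexp (- (?c * u) * x))"
    unfolding char_def by (subst integral_density) (auto simp: normal_density_nonneg)
  also have "\<dots> = ?c *\<^sub>R (LINT x|lborel. std_normal_density (0 + ?c * x) *\<^sub>R iexp (- (?c * u) * (0 + ?c * x)))"
    by (subst lborel_integral_real_affine[of ?c _ 0]) auto
  also have "\<dots> = (LINT x|lborel. ?c *\<^sub>R (std_normal_density (0 + ?c * x) *\<^sub>R iexp (- (?c * u) * (0 + ?c * x))))"
    by (simp only: integral_scaleR_right)
  also have "\<dots> = (LINT x|lborel. of_real (exp (- (pi * x\<^sup>2))) * phase (x * u))"
  proof (intro Bochner_Integration.integral_cong refl)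
    fix x :: real
    have "- (?c * u) * (0 + ?c * x) = - (2 * pi * (x * u))"
      by (simp add: algebra_simps)
    hence "iexp (- (?c * u) * (0 + ?c * x)) = phase (x * u)"
      by (simp add: phase_def mult_ac)
    moreover have "?c * std_normal_density (0 + ?c * x) = exp (- (pi * x\<^sup>2))"
      by (simp add: std_normal_density_def power_mult_distrib)
    ultimately have "?c *\<^sub>R (std_normal_density (0 + ?c * x) *\<^sub>R iexp (- (?c * u) * (0 + ?c * x)))
        = (exp (- (pi * x\<^sup>2))) *\<^sub>R phase (x * u)" by (simp only: scaleR_scaleR)
    thus "?c *\<^sub>R (std_normal_density (0 + ?c * x) *\<^sub>R iexp (- (?c * u) * (0 + ?c * x)))
        = of_real (exp (- (pi * x\<^sup>2))) * phase (x * u)"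
      by (simp only: scaleR_conv_of_real)
  qed
  finally show ?thesis by simp
qed

text \<open>
  With this normalization the Gaussian has integral \<open>1\<close> and is its own Fourier transform.
\<close>

definition gaussian :: "'a::euclidean_space \<Rightarrow> real" where
  "gaussian x = exp (- (pi * (norm x)\<^sup>2))"

lemma gaussian_measurable [measurable]: "gaussian \<in> borel_measurable borel"
  unfolding gaussian_def by measurable

lemma gaussian_pos: "0 < gaussian x" by (simp add: gaussian_def)

lemma gaussian_prod:
  "of_real (gaussian x) * phase (x \<bullet> u)
     = (\<Prod>b\<in>Basis. of_real (exp (- (pi * (x \<bullet> b)\<^sup>2))) * phase ((x \<bullet> b) * (u \<bullet> b)))"
proof -
  have "(norm x)\<^sup>2 = (\<Sum>b\<in>Basis. (x \<bullet> b)\<^sup>2)"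
    by (subst power2_norm_eq_inner, subst euclidean_inner) (simp only: power2_eq_square)
  hence "gaussian x = (\<Prod>b\<in>Basis. exp (- (pi * (x \<bullet> b)\<^sup>2)))"
    by (simp add: gaussian_def exp_sum[symmetric] sum_distrib_left sum_negf)
  moreover have "phase (x \<bullet> u) = (\<Prod>b\<in>Basis. phase ((x \<bullet> b) * (u \<bullet> b)))"
    by (simp add: euclidean_inner[of x u] phase_sum)
  ultimately show ?thesis by (simp add: prod.distrib)
qed

text \<open>
  Both factors split along the standard basis, so the integral is a product of one-dimensional ones.
\<close>

lemma fourier_gaussian:
  fixes u :: "'a::euclidean_space"
  shows "integrable lborel (\<lambda>x::'a. complex_of_real (gaussian x) * phase (x \<bullet> u))" (is ?A)
    and "(LINT x|lborel. of_real (gaussian x) * phase (x \<bullet> u)) = of_real (gaussian u)" (is ?B)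
proof -
  interpret P: product_sigma_finite "\<lambda>_::'a. lborel :: real measure" by standard
  let ?f = "\<lambda>b x. complex_of_real (exp (- (pi * x\<^sup>2))) * phase (x * (u \<bullet> b))"
  let ?T = "\<lambda>f. \<Sum>b\<in>Basis. f b *\<^sub>R (b::'a)"
  have i: "integrable lborel (?f b)" for b
    by (rule Bochner_Integration.integrable_bound[OF integrable_gaussian_real]) (auto simp: norm_mult)
  have coord: "?T f \<bullet> b = f b" if "b \<in> Basis" for f :: "'a \<Rightarrow> real" and b
    using that by (simp add: inner_sum_left inner_Basis if_distrib cong: if_cong)
  have eq: "of_real (gaussian (?T f)) * phase (?T f \<bullet> u) = (\<Prod>b\<in>Basis. ?f b (f b))" for f
    unfolding gaussian_prod by (intro prod.cong) (auto simp: coord)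
  have [measurable]: "?T \<in> borel_measurable (\<Pi>\<^sub>M b\<in>Basis. lborel)" by measurable
  have int: "integrable (\<Pi>\<^sub>M b\<in>Basis. lborel) (\<lambda>f. \<Prod>b\<in>Basis. ?f b (f b))"
    by (rule P.product_integrable_prod) (use i in auto)
  show ?A
    by (subst lborel_eq, subst integrable_distr_eq) (use int eq in auto)
  have "(LINT x|lborel. of_real (gaussian x) * phase (x \<bullet> u)) = (LINT f|(\<Pi>\<^sub>M b\<in>Basis. lborel). (\<Prod>b\<in>Basis. ?f b (f b)))"
    by (subst lborel_eq, subst integral_distr) (use eq in auto)
  also have "\<dots> = (\<Prod>b\<in>Basis. LINT x|lborel. ?f b x)"
    by (rule P.product_integral_prod) (use i in auto)
  also have "\<dots> = (\<Prod>b\<in>Basis. of_real (exp (- (pi * (u \<bullet> b)\<^sup>2))))"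
    by (simp only: fourier_gaussian_real)
  also have "\<dots> = of_real (gaussian u)" using gaussian_prod[of u 0] by simp
  finally show ?B .
qed

lemma integrable_gaussian: "integrable lborel (gaussian :: 'a::euclidean_space \<Rightarrow> real)"
  using fourier_gaussian(1)[of "0::'a"] by (simp add: complex_of_real_integrable_eq)

lemma integral_gaussian: "(LINT x|lborel. gaussian (x::'a::euclidean_space)) = 1"
  using fourier_gaussian(2)[of "0::'a"] by (simp add: gaussian_def)

lemma integral_lborel_scaleR:
  fixes f :: "'a::euclidean_space \<Rightarrow> 'b::{banach, second_countable_topology}"
  assumes [measurable]: "f \<in> borel_measurable borel" and c: "c \<noteq> 0"
  shows "(LINT x|lborel. f x) = \<bar>c\<bar> ^ DIM('a) *\<^sub>R (LINT x|lborel. f (c *\<^sub>R x))"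
    and "integrable lborel (\<lambda>x. f (c *\<^sub>R x)) \<longleftrightarrow> integrable lborel f"
proof -
  have l: "lborel = density (distr lborel borel (\<lambda>x::'a. c *\<^sub>R x)) (\<lambda>_. ennreal (\<bar>c\<bar> ^ DIM('a)))"
    using lborel_affine[OF c, of "0::'a"] by simp
  show "(LINT x|lborel. f x) = \<bar>c\<bar> ^ DIM('a) *\<^sub>R (LINT x|lborel. f (c *\<^sub>R x))"
    by (subst l) (simp add: integral_density integral_distr)
  show "integrable lborel (\<lambda>x. f (c *\<^sub>R x)) \<longleftrightarrow> integrable lborel f"
  proof -
    have "integrable lborel f \<longleftrightarrow> integrable lborel (\<lambda>x. \<bar>c\<bar> ^ DIM('a) *\<^sub>R f (c *\<^sub>R x))"
      by (subst l) (simp add: integrable_density integrable_distr_eq)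
    also have "\<dots> \<longleftrightarrow> integrable lborel (\<lambda>x. f (c *\<^sub>R x))"
    proof
      assume "integrable lborel (\<lambda>x. \<bar>c\<bar> ^ DIM('a) *\<^sub>R f (c *\<^sub>R x))"
      hence "integrable lborel (\<lambda>x. (1 / \<bar>c\<bar> ^ DIM('a)) *\<^sub>R (\<bar>c\<bar> ^ DIM('a) *\<^sub>R f (c *\<^sub>R x)))"
        by - (rule integrable_scaleR_right)
      moreover have "(1 / \<bar>c\<bar> ^ DIM('a)) *\<^sub>R (\<bar>c\<bar> ^ DIM('a) *\<^sub>R y) = y" for y :: 'b
        using c by simp
      ultimately show "integrable lborel (\<lambda>x. f (c *\<^sub>R x))" by (simp only:)
    qed (rule integrable_scaleR_right)
    finally show ?thesis by (rule sym)
  qed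
qed

lemma fourier_gaussian_scaled:
  fixes u :: "'a::euclidean_space"
  assumes e: "0 < e"
  shows "(LINT x|lborel. of_real (gaussian (e *\<^sub>R x)) * phase (x \<bullet> u))
     = of_real (gaussian ((1 / e) *\<^sub>R u) / e ^ DIM('a))"
proof -
  have "of_real (gaussian ((1 / e) *\<^sub>R u)) = (LINT x|lborel. of_real (gaussian x) * phase (x \<bullet> ((1 / e) *\<^sub>R u)))"
    by (simp only: fourier_gaussian(2))
  also have "\<dots> = e ^ DIM('a) *\<^sub>R (LINT x|lborel. of_real (gaussian (e *\<^sub>R x)) * phase ((e *\<^sub>R x) \<bullet> ((1 / e) *\<^sub>R u)))"
    using e by (subst integral_lborel_scaleR(1)[of _ e]) auto
  also have "(\<lambda>x. (e *\<^sub>R x) \<bullet> ((1 / e) *\<^sub>R u)) = (\<lambda>x. x \<bullet> u)" using e by auto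
  finally show ?thesis using e by (simp add: scaleR_conv_of_real field_simps)
qed

lemma integrable_lborel_pair_bound:
  fixes k :: "'a::euclidean_space \<times> 'b::euclidean_space \<Rightarrow> complex"
    and a :: "'a \<Rightarrow> complex" and b :: "'b \<Rightarrow> complex"
  assumes a: "integrable lborel a" and b: "integrable lborel b"
    and k: "k \<in> borel_measurable (lborel \<Otimes>\<^sub>M lborel)"
    and bd: "\<And>x y. norm (k (x, y)) \<le> norm (a x) * norm (b y)"
  shows "integrable (lborel \<Otimes>\<^sub>M lborel) k"
proof (rule Bochner_Integration.integrable_bound[OF _ k])
  have [measurable]: "a \<in> borel_measurable borel" "b \<in> borel_measurable borel"
    using a b by (auto dest: borel_measurable_integrable)
  have a': "integrable lborel (\<lambda>x. norm (a x))" and b': "integrable lborel (\<lambda>y. norm (b y))"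
    by (rule integrable_norm[OF a], rule integrable_norm[OF b])
  show "integrable (lborel \<Otimes>\<^sub>M lborel) (\<lambda>z. norm (a (fst z)) * norm (b (snd z)))"
  proof (rule lborel_pair.Fubini_integrable)
    show "integrable lborel (\<lambda>x. LINT y|lborel. norm (norm (a (fst (x, y))) * norm (b (snd (x, y)))))"
      using integrable_mult_left[OF a', of "LINT y|lborel. norm (b y)"] by (simp add: abs_mult)
    show "AE x in lborel. integrable lborel (\<lambda>y. norm (a (fst (x, y))) * norm (b (snd (x, y))))"
      using b' by simp
  qed measurable
  show "AE z in lborel \<Otimes>\<^sub>M lborel. norm (k z) \<le> norm (norm (a (fst z)) * norm (b (snd z)))"
    using bd by (auto simp: split_paired_all)
qed


definition fourier :: "('a::euclidean_space \<Rightarrow> complex) \<Rightarrow> 'a \<Rightarrow> complex" where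
  "fourier F \<xi> = (LINT t|lborel. F t * phase (\<xi> \<bullet> t))"

lemma fourier_measurable [measurable]:
  assumes [measurable]: "F \<in> borel_measurable borel"
  shows "fourier F \<in> borel_measurable borel"
  unfolding fourier_def[abs_def] by measurable

lemma norm_fourier_le: "norm (fourier F \<xi>) \<le> (LINT t|lborel. norm (F t))"
  unfolding fourier_def using integral_norm_bound[of lborel "\<lambda>t. F t * phase (\<xi> \<bullet> t)"] by (simp add: norm_mult)

text \<open>
  Regularizing \<open>\<integral> |fourier F|\<^sup>2\<close> by a Gaussian makes every change of the order of integration legitimate. The
  Fourier transform of the Gaussian weight is an approximate identity, so the result is an average of
  the autocorrelation of \<open>F\<close> at scale \<open>e\<close>.
\<close>

lemma fourier_gaussian_mean:
  fixes F :: "'a::euclidean_space \<Rightarrow> complex"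
  assumes F1: "integrable lborel F" and F2: "F \<in> L2" and e: "0 < e"
  shows "(LINT \<xi>|lborel. of_real (gaussian (e *\<^sub>R \<xi>)) * (fourier F \<xi> * cnj (fourier F \<xi>)))
     = (LINT v|lborel. of_real (gaussian v) * L2_inner F (\<lambda>s. F (s - e *\<^sub>R v)))"
proof -
  have [measurable]: "F \<in> borel_measurable borel" using F2 by (rule L2_measurable)
  let ?w = "\<lambda>\<xi>::'a. complex_of_real (gaussian (e *\<^sub>R \<xi>))"
  let ?N = "LINT t|lborel. norm (F t)"
  have N0: "0 \<le> ?N" by (simp add: integral_nonneg_AE)
  have w: "integrable lborel ?w"
    using integral_lborel_scaleR(2)[of "\<lambda>x::'a. complex_of_real (gaussian x)" e] integrable_gaussian e by (simp add: complex_of_real_integrable_eq)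
  have "(LINT \<xi>|lborel. ?w \<xi> * (fourier F \<xi> * cnj (fourier F \<xi>)))
      = (LINT \<xi>|lborel. LINT s|lborel. F s * (?w \<xi> * phase (\<xi> \<bullet> s) * cnj (fourier F \<xi>)))"
  proof (rule Bochner_Integration.integral_cong[OF refl])
    fix \<xi> :: 'a
    have "?w \<xi> * (fourier F \<xi> * cnj (fourier F \<xi>)) = (?w \<xi> * cnj (fourier F \<xi>)) * fourier F \<xi>" by (simp only: mult_ac)
    also have "\<dots> = (LINT s|lborel. (?w \<xi> * cnj (fourier F \<xi>)) * (F s * phase (\<xi> \<bullet> s)))"
      by (subst (2) fourier_def) (simp only: integral_mult_right_zero)
    also have "\<dots> = (LINT s|lborel. F s * (?w \<xi> * phase (\<xi> \<bullet> s) * cnj (fourier F \<xi>)))" by (simp only: mult_ac)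
    finally show "?w \<xi> * (fourier F \<xi> * cnj (fourier F \<xi>)) = (LINT s|lborel. F s * (?w \<xi> * phase (\<xi> \<bullet> s) * cnj (fourier F \<xi>)))" .
  qed
  also have "\<dots> = (LINT s|lborel. LINT \<xi>|lborel. F s * (?w \<xi> * phase (\<xi> \<bullet> s) * cnj (fourier F \<xi>)))"
  proof (rule lborel_pair.Fubini_integral[symmetric], rule integrable_lborel_pair_bound[OF integrable_mult_right[OF w, of "of_real ?N"] F1])
    fix \<xi> s :: 'a
    have "norm (F s) * (norm (?w \<xi>) * norm (fourier F \<xi>)) \<le> norm (F s) * (norm (?w \<xi>) * ?N)"
      by (intro mult_left_mono norm_fourier_le) auto
    thus "norm (case (\<xi>, s) of (\<xi>, s) \<Rightarrow> F s * (?w \<xi> * phase (\<xi> \<bullet> s) * cnj (fourier F \<xi>))) \<le> norm (of_real ?N * ?w \<xi>) * norm (F s)"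
      using N0 by (simp add: norm_mult mult_ac)
  qed measurable
  also have "\<dots> = (LINT s|lborel. LINT v|lborel. of_real (gaussian v) * (F s * cnj (F (s - e *\<^sub>R v))))"
  proof (rule Bochner_Integration.integral_cong[OF refl])
    fix s :: 'a
    have "(LINT \<xi>|lborel. ?w \<xi> * phase (\<xi> \<bullet> s) * cnj (fourier F \<xi>))
       = (LINT \<xi>|lborel. LINT t|lborel. cnj (F t) * (?w \<xi> * phase (\<xi> \<bullet> (s - t))))"
    proof (rule Bochner_Integration.integral_cong[OF refl])
      fix \<xi> :: 'a
      have "?w \<xi> * phase (\<xi> \<bullet> s) * cnj (fourier F \<xi>)
          = (LINT t|lborel. (?w \<xi> * phase (\<xi> \<bullet> s)) * cnj (F t * phase (\<xi> \<bullet> t)))"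
        unfolding fourier_def by (simp only: Bochner_Integration.integral_cnj integral_mult_right_zero)
      also have "\<dots> = (LINT t|lborel. cnj (F t) * (?w \<xi> * phase (\<xi> \<bullet> (s - t))))"
        by (intro Bochner_Integration.integral_cong refl)
          (simp add: inner_diff_right phase_add[of "\<xi> \<bullet> s" "- (\<xi> \<bullet> _)", simplified])
      finally show "?w \<xi> * phase (\<xi> \<bullet> s) * cnj (fourier F \<xi>) = (LINT t|lborel. cnj (F t) * (?w \<xi> * phase (\<xi> \<bullet> (s - t))))" .
    qed
    also have "\<dots> = (LINT t|lborel. LINT \<xi>|lborel. cnj (F t) * (?w \<xi> * phase (\<xi> \<bullet> (s - t))))"
      by (rule lborel_pair.Fubini_integral[symmetric], rule integrable_lborel_pair_bound[OF w F1])
        (auto simp: norm_mult)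
    also have "\<dots> = (LINT t|lborel. cnj (F t) * of_real (gaussian ((1 / e) *\<^sub>R (s - t)) / e ^ DIM('a)))"
      by (simp only: integral_mult_right_zero fourier_gaussian_scaled[OF e])
    also have "\<dots> = (LINT u|lborel. cnj (F (s - u)) * of_real (gaussian ((1 / e) *\<^sub>R u) / e ^ DIM('a)))"
      by (subst integral_shift(3)[symmetric, where u=s]) auto
    also have "\<dots> = e ^ DIM('a) *\<^sub>R (LINT v|lborel. cnj (F (s - e *\<^sub>R v)) * of_real (gaussian v / e ^ DIM('a)))"
      using e by (subst integral_lborel_scaleR(1)[of _ e]) auto
    also have "\<dots> = (LINT v|lborel. of_real (gaussian v) * cnj (F (s - e *\<^sub>R v)))"
      using e by (subst integral_scaleR_right[symmetric]) (simp add: scaleR_conv_of_real mult_ac)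
    finally have *: "(LINT \<xi>|lborel. ?w \<xi> * phase (\<xi> \<bullet> s) * cnj (fourier F \<xi>)) = (LINT v|lborel. of_real (gaussian v) * cnj (F (s - e *\<^sub>R v)))" .
    have "(LINT \<xi>|lborel. F s * (?w \<xi> * phase (\<xi> \<bullet> s) * cnj (fourier F \<xi>))) = F s * (LINT v|lborel. of_real (gaussian v) * cnj (F (s - e *\<^sub>R v)))"
      by (simp only: integral_mult_right_zero *)
    also have "\<dots> = (LINT v|lborel. of_real (gaussian v) * (F s * cnj (F (s - e *\<^sub>R v))))"
      by (simp only: integral_mult_right_zero[symmetric] mult.left_commute)
    finally show "(LINT \<xi>|lborel. F s * (?w \<xi> * phase (\<xi> \<bullet> s) * cnj (fourier F \<xi>))) = (LINT v|lborel. of_real (gaussian v) * (F s * cnj (F (s - e *\<^sub>R v))))" .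
  qed
  also have "\<dots> = (LINT v|lborel. LINT s|lborel. of_real (gaussian v) * (F s * cnj (F (s - e *\<^sub>R v))))"
  proof (rule lborel_pair.Fubini_integral, rule lborel_pair.Fubini_integrable)
    have i: "integrable lborel (\<lambda>s. F s * cnj (F (s - e *\<^sub>R v)))" for v
      using F2 L2_translate(1)[OF F2] by (rule L2_mult_integrable)
    show "AE v in lborel. integrable lborel (\<lambda>s. case (v, s) of (v, s) \<Rightarrow> complex_of_real (gaussian v) * (F s * cnj (F (s - e *\<^sub>R v))))"
      using i by (intro AE_I2) (auto intro!: integrable_mult_right)
    show "integrable lborel (\<lambda>v. LINT s|lborel. norm (case (v, s) of (v, s) \<Rightarrow> complex_of_real (gaussian v) * (F s * cnj (F (s - e *\<^sub>R v)))))"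
    proof (rule Bochner_Integration.integrable_bound)
      show "integrable lborel (\<lambda>v::'a. gaussian v * (L2_norm F * L2_norm F))"
        by (intro integrable_mult_left integrable_gaussian)
      show "AE v in lborel. norm (LINT s|lborel. norm (case (v, s) of (v, s) \<Rightarrow> complex_of_real (gaussian v) * (F s * cnj (F (s - e *\<^sub>R v)))))
          \<le> norm (gaussian v * (L2_norm F * L2_norm F))"
      proof (rule AE_I2)
        fix v :: 'a
        have "ennreal (LINT s|lborel. norm (F s * cnj (F (s - e *\<^sub>R v)))) = (\<integral>\<^sup>+s. ennreal (norm (F s) * norm (F (s - e *\<^sub>R v))) \<partial>lborel)"
          using integrable_norm[OF i[of v]] by (subst nn_integral_eq_integral[symmetric]) (auto simp: norm_mult)
        also have "\<dots> \<le> ennreal (L2_norm F * L2_norm F)"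
          using L2_Cauchy_Schwarz_nn[OF F2 L2_translate(1)[OF F2, of "e *\<^sub>R v"]] by (simp only: L2_translate(2)[OF F2])
        finally have le: "(LINT s|lborel. norm (F s * cnj (F (s - e *\<^sub>R v)))) \<le> L2_norm F * L2_norm F"
          by (simp add: ennreal_le_iff L2_norm_nonneg)
        have "(LINT s|lborel. norm (case (v, s) of (v, s) \<Rightarrow> complex_of_real (gaussian v) * (F s * cnj (F (s - e *\<^sub>R v)))))
            = gaussian v * (LINT s|lborel. norm (F s * cnj (F (s - e *\<^sub>R v))))"
          using gaussian_pos[of v] by (simp add: norm_mult)
        also have "\<bar>\<dots>\<bar> \<le> gaussian v * (L2_norm F * L2_norm F)"
          using le gaussian_pos[of v] by (simp add: abs_mult integral_nonneg_AE)
        finally show "norm (LINT s|lborel. norm (case (v, s) of (v, s) \<Rightarrow> complex_of_real (gaussian v) * (F s * cnj (F (s - e *\<^sub>R v)))))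
          \<le> norm (gaussian v * (L2_norm F * L2_norm F))" by simp
      qed
      show "(\<lambda>v. LINT s|lborel. norm (case (v, s) of (v, s) \<Rightarrow> complex_of_real (gaussian v) * (F s * cnj (F (s - e *\<^sub>R v))))) \<in> borel_measurable lborel"
        by (rule lborel.borel_measurable_lebesgue_integral) measurable
    qed
  qed measurable
  also have "\<dots> = (LINT v|lborel. of_real (gaussian v) * L2_inner F (\<lambda>s. F (s - e *\<^sub>R v)))"
    by (simp only: integral_mult_right_zero L2_inner_def)
  finally show ?thesis .
qed

text \<open>
  As the scale of the Gaussian regularization tends to \<open>0\<close>, the left side of
  \<open>fourier_gaussian_mean\<close> increases to \<open>\<integral> |fourier F|\<^sup>2\<close> and the right side tends to the value of the
  autocorrelation at the origin. With a nonnegative integral the finiteness of \<open>\<integral> |fourier F|\<^sup>2\<close> is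
  part of the conclusion.
\<close>

theorem Plancherel:
  fixes F :: "'a::euclidean_space \<Rightarrow> complex"
  assumes F1: "integrable lborel F" and F2: "F \<in> L2"
  shows "(\<integral>\<^sup>+\<xi>. ennreal ((norm (fourier F \<xi>))\<^sup>2) \<partial>lborel) = ennreal ((L2_norm F)\<^sup>2)"
proof -
  have [measurable]: "F \<in> borel_measurable borel" using F2 by (rule L2_measurable)
  let ?e = "\<lambda>n. 1 / real (Suc n)"
  let ?N = "LINT t|lborel. norm (F t)"
  let ?W = "\<lambda>n \<xi>. gaussian (?e n *\<^sub>R \<xi>) * (norm (fourier F \<xi>))\<^sup>2"
  have e: "(\<lambda>n. ?e n *\<^sub>R v) \<longlonglongrightarrow> 0" for v :: 'a
    using tendsto_scaleR[OF LIMSEQ_inverse_real_of_nat tendsto_const, of v] by (simp add: inverse_eq_divide)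
  have iW: "integrable lborel (?W n)" for n
  proof (rule Bochner_Integration.integrable_bound)
    show "integrable lborel (\<lambda>\<xi>::'a. gaussian (?e n *\<^sub>R \<xi>) * ?N\<^sup>2)"
      using integral_lborel_scaleR(2)[of "gaussian :: 'a \<Rightarrow> real" "?e n"] integrable_gaussian
      by (intro integrable_mult_left) auto
    show "AE \<xi> in lborel. norm (?W n \<xi>) \<le> norm (gaussian (?e n *\<^sub>R \<xi>) * ?N\<^sup>2)"
    proof (rule AE_I2)
      fix \<xi> :: 'a
      have "(norm (fourier F \<xi>))\<^sup>2 \<le> ?N\<^sup>2" by (intro power_mono norm_fourier_le) auto
      thus "norm (?W n \<xi>) \<le> norm (gaussian (?e n *\<^sub>R \<xi>) * ?N\<^sup>2)"
        using gaussian_pos[of "?e n *\<^sub>R \<xi>"] by (simp add: abs_mult)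
    qed
  qed measurable
  have "(\<lambda>n. \<integral>\<^sup>+\<xi>. ennreal (?W n \<xi>) \<partial>lborel) \<longlonglongrightarrow> (\<integral>\<^sup>+\<xi>. ennreal ((norm (fourier F \<xi>))\<^sup>2) \<partial>lborel)"
  proof (rule nn_integral_LIMSEQ)
    show "incseq (\<lambda>n \<xi>. ennreal (?W n \<xi>))"
    proof (rule incseq_SucI, rule le_funI, rule ennreal_leI)
      fix n and \<xi> :: 'a
      have "?e (Suc n) \<le> ?e n" by (simp add: divide_simps)
      hence "norm (?e (Suc n) *\<^sub>R \<xi>) \<le> norm (?e n *\<^sub>R \<xi>)"
        by (simp only: norm_scaleR) (intro mult_right_mono, auto)
      hence "(norm (?e (Suc n) *\<^sub>R \<xi>))\<^sup>2 \<le> (norm (?e n *\<^sub>R \<xi>))\<^sup>2" by (rule power_mono) simp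
      hence "gaussian (?e n *\<^sub>R \<xi>) \<le> gaussian (?e (Suc n) *\<^sub>R \<xi>)"
        unfolding gaussian_def by (simp only: exp_le_cancel_iff neg_le_iff_le) (rule mult_left_mono, auto)
      thus "?W n \<xi> \<le> ?W (Suc n) \<xi>" by (intro mult_right_mono) auto
    qed
    fix \<xi> :: 'a
    have "(\<lambda>n. exp (- (pi * (norm (?e n *\<^sub>R \<xi>))\<^sup>2)) * (norm (fourier F \<xi>))\<^sup>2) \<longlonglongrightarrow> exp (- (pi * (norm (0::'a))\<^sup>2)) * (norm (fourier F \<xi>))\<^sup>2"
      by (intro tendsto_intros e)
    thus "(\<lambda>n. ennreal (?W n \<xi>)) \<longlonglongrightarrow> ennreal ((norm (fourier F \<xi>))\<^sup>2)"
      unfolding gaussian_def by (intro tendsto_ennrealI) simp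
  qed measurable
  moreover have "(\<lambda>n. \<integral>\<^sup>+\<xi>. ennreal (?W n \<xi>) \<partial>lborel) \<longlonglongrightarrow> ennreal ((L2_norm F)\<^sup>2)"
  proof -
    let ?A = "\<lambda>n v. L2_inner F (\<lambda>s. F (s - ?e n *\<^sub>R v))"
    have A: "norm (?A n v) \<le> L2_norm F * L2_norm F" for n v
      using L2_Cauchy_Schwarz[OF F2 L2_translate(1)[OF F2, of "?e n *\<^sub>R v"]] by (simp only: L2_translate(2)[OF F2])
    have "(\<lambda>n. LINT v|lborel. of_real (gaussian v) * ?A n v) \<longlonglongrightarrow> (LINT v|lborel. of_real (gaussian (v::'a)) * of_real ((L2_norm F)\<^sup>2))"
    proof (rule integral_dominated_convergence[where w="\<lambda>v. gaussian v * (L2_norm F * L2_norm F)"])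
      show "integrable lborel (\<lambda>v::'a. gaussian v * (L2_norm F * L2_norm F))"
        by (intro integrable_mult_left integrable_gaussian)
      show "AE v in lborel. (\<lambda>n. of_real (gaussian v) * ?A n v) \<longlonglongrightarrow> of_real (gaussian (v::'a)) * of_real ((L2_norm F)\<^sup>2)"
        by (intro AE_I2 tendsto_mult tendsto_const L2_autocorrelation_continuous F2 e)
      show "AE v in lborel. norm (of_real (gaussian v) * ?A n v) \<le> gaussian (v::'a) * (L2_norm F * L2_norm F)" for n
      proof (rule AE_I2)
        fix v :: 'a
        show "norm (of_real (gaussian v) * ?A n v) \<le> gaussian v * (L2_norm F * L2_norm F)"
          using A[of n v] gaussian_pos[of v] by (simp add: norm_mult)
      qed
      show "(\<lambda>v. of_real (gaussian v) * ?A n v) \<in> borel_measurable lborel" for n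
      proof -
        have "(\<lambda>v. ?A n v) \<in> borel_measurable lborel"
          unfolding L2_inner_def by (rule lborel.borel_measurable_lebesgue_integral) measurable
        thus ?thesis by measurable
      qed
    qed measurable
    also have "(LINT v|lborel. of_real (gaussian (v::'a)) * of_real ((L2_norm F)\<^sup>2)) = complex_of_real ((L2_norm F)\<^sup>2)"
      by (simp only: integral_mult_left_zero integral_complex_of_real integral_gaussian) simp
    finally have lim: "(\<lambda>n. LINT v|lborel. of_real (gaussian (v::'a)) * ?A n v) \<longlonglongrightarrow> complex_of_real ((L2_norm F)\<^sup>2)" .
    have eq: "complex_of_real (LINT \<xi>|lborel. ?W n \<xi>) = (LINT v|lborel. of_real (gaussian v) * ?A n v)" for n
    proof -
      have "complex_of_real (LINT \<xi>|lborel. ?W n \<xi>) = (LINT \<xi>|lborel. of_real (gaussian (?e n *\<^sub>R \<xi>)) * (fourier F \<xi> * cnj (fourier F \<xi>)))"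
        by (simp only: integral_complex_of_real[symmetric] of_real_mult complex_norm_square)
      also have "\<dots> = (LINT v|lborel. of_real (gaussian v) * ?A n v)"
        by (rule fourier_gaussian_mean[OF F1 F2]) simp
      finally show ?thesis .
    qed
    have "(\<lambda>n. LINT \<xi>|lborel. ?W n \<xi>) \<longlonglongrightarrow> (L2_norm F)\<^sup>2"
      using lim unfolding eq[symmetric] by (simp only: tendsto_of_real_iff)
    hence "(\<lambda>n. ennreal (LINT \<xi>|lborel. ?W n \<xi>)) \<longlonglongrightarrow> ennreal ((L2_norm F)\<^sup>2)" by (rule tendsto_ennrealI)
    moreover have "(\<integral>\<^sup>+\<xi>. ennreal (?W n \<xi>) \<partial>lborel) = ennreal (LINT \<xi>|lborel. ?W n \<xi>)" for n
      by (rule nn_integral_eq_integral[OF iW]) (simp add: less_imp_le[OF gaussian_pos])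
    ultimately show ?thesis by simp
  qed
  ultimately show ?thesis by (rule LIMSEQ_unique)
qed

section \<open>The short-time Fourier transform\<close>

text \<open>
  The time-frequency shift, for which \<open>V\<^sub>g f(z)\<close> is the inner product of \<open>f\<close> with the shift of \<open>g\<close> by
  \<open>z\<close>.
\<close>

definition tf_shift :: "('a::euclidean_space \<Rightarrow> complex) \<Rightarrow> 'a \<times> 'a \<Rightarrow> 'a \<Rightarrow> complex" where
  "tf_shift g z t = g (t - fst z) * phase (- (snd z \<bullet> t))"

lemma tf_shift_L2:
  assumes g: "g \<in> L2"
  shows "tf_shift g z \<in> L2" and "L2_norm (tf_shift g z) = L2_norm g"
proof -
  have [measurable]: "g \<in> borel_measurable borel" using g by (rule L2_measurable)
  have n: "norm (tf_shift g z t) = norm (g (t - fst z))" for t by (simp add: tf_shift_def norm_mult)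
  have m: "tf_shift g z \<in> borel_measurable borel" unfolding tf_shift_def[abs_def] by measurable
  show "tf_shift g z \<in> L2"
    using m L2_square_integrable[OF L2_translate(1)[OF g, of "fst z"]] by (simp add: L2_def n)
  show "L2_norm (tf_shift g z) = L2_norm g"
    using L2_translate(2)[OF g, of "fst z"] by (simp add: L2_norm_def n)
qed

lemma stft_eq_fourier: "stft g f (x, \<xi>) = fourier (\<lambda>t. f t * cnj (g (t - x))) \<xi>"
  by (simp add: stft_def fourier_def phase_def)

lemma stft_eq_inner: "stft g f z = L2_inner f (tf_shift g z)"
  by (cases z) (simp add: stft_eq_fourier fourier_def L2_inner_def tf_shift_def mult.assoc)

lemma stft_measurable:
  fixes f g :: "real ^ 'n \<Rightarrow> complex"
  assumes [measurable]: "f \<in> borel_measurable borel" "g \<in> borel_measurable borel"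
  shows "stft g f \<in> borel_measurable borel"
proof -
  have "(\<lambda>z. LINT t|lborel. f t * cnj (g (t - fst z)) * phase (snd z \<bullet> t)) \<in> borel_measurable (borel \<Otimes>\<^sub>M borel)"
    by measurable
  moreover have "stft g f = (\<lambda>z. LINT t|lborel. f t * cnj (g (t - fst z)) * phase (snd z \<bullet> t))"
    by (auto simp: stft_eq_fourier fourier_def fun_eq_iff)
  ultimately show ?thesis by (simp add: borel_prod)
qed

lemma norm_stft_le:
  assumes "f \<in> L2" "g \<in> L2"
  shows "norm (stft g f z) \<le> L2_norm f * L2_norm g"
  using L2_Cauchy_Schwarz[OF assms(1) tf_shift_L2(1)[OF assms(2), of z]]
  by (simp only: stft_eq_inner tf_shift_L2(2)[OF assms(2)])

text \<open>
  Covariance: shifting the signal translates its short-time Fourier transform, up to a phase factor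
  that disappears in the absolute value.
\<close>

lemma norm_stft_tf_shift:
  fixes g :: "real ^ 'n \<Rightarrow> complex"
  assumes g: "g \<in> L2"
  shows "norm (stft g (tf_shift g z) w) = norm (stft g g (w - z))"
proof -
  have [measurable]: "g \<in> borel_measurable borel" using g by (rule L2_measurable)
  obtain x \<xi> y \<eta> where z: "z = (x, \<xi>)" and w: "w = (y, \<eta>)" by (cases z; cases w)
  have "stft g (tf_shift g z) w
      = (LINT t|lborel. g (t - x) * phase (- (\<xi> \<bullet> t)) * cnj (g (t - y)) * phase (\<eta> \<bullet> t))"
    by (simp add: w z stft_eq_fourier fourier_def tf_shift_def)
  also have "\<dots> = (LINT t|lborel. g (t + x - x) * phase (- (\<xi> \<bullet> (t + x))) * cnj (g (t + x - y)) * phase (\<eta> \<bullet> (t + x)))"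
    by (subst integral_shift(2)[symmetric, where u=x]) simp_all
  also have "\<dots> = (LINT t|lborel. phase ((\<eta> - \<xi>) \<bullet> x) * (g t * cnj (g (t - (y - x))) * phase ((\<eta> - \<xi>) \<bullet> t)))"
  proof (intro Bochner_Integration.integral_cong refl)
    fix t
    have ph: "phase (- (\<xi> \<bullet> (t + x))) * phase (\<eta> \<bullet> (t + x)) = phase ((\<eta> - \<xi>) \<bullet> x) * phase ((\<eta> - \<xi>) \<bullet> t)"
      by (simp add: phase_add[symmetric] inner_diff_left inner_add_right algebra_simps)
    have sh: "t + x - y = t - (y - x)" by simp
    have "g (t + x - x) * phase (- (\<xi> \<bullet> (t + x))) * cnj (g (t + x - y)) * phase (\<eta> \<bullet> (t + x))
      = (phase (- (\<xi> \<bullet> (t + x))) * phase (\<eta> \<bullet> (t + x))) * (g t * cnj (g (t + x - y)))"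
      by (simp add: mult_ac)
    also have "\<dots> = phase ((\<eta> - \<xi>) \<bullet> x) * (g t * cnj (g (t - (y - x))) * phase ((\<eta> - \<xi>) \<bullet> t))"
      unfolding ph sh by (simp only: mult_ac)
    finally show "g (t + x - x) * phase (- (\<xi> \<bullet> (t + x))) * cnj (g (t + x - y)) * phase (\<eta> \<bullet> (t + x))
      = phase ((\<eta> - \<xi>) \<bullet> x) * (g t * cnj (g (t - (y - x))) * phase ((\<eta> - \<xi>) \<bullet> t))" .
  qed
  also have "\<dots> = phase ((\<eta> - \<xi>) \<bullet> x) * stft g g (w - z)"
    by (simp add: w z stft_eq_fourier fourier_def)
  finally show ?thesis by (simp add: norm_mult)
qed

text \<open>
  For almost every \<open>x\<close> the function \<open>t \<mapsto> f(t) cnj (g(t - x))\<close> is square integrable, and \<open>V\<^sub>g f(x, _)\<close>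
  is its Fourier transform. Plancherel in the frequency variable and Tonelli's theorem give the
  identity.
\<close>

theorem Moyal:
  fixes f g :: "real ^ 'n \<Rightarrow> complex"
  assumes f: "f \<in> L2" and g: "g \<in> L2"
  shows "(\<integral>\<^sup>+z. ennreal ((norm (stft g f z))\<^sup>2) \<partial>lborel) = ennreal ((L2_norm f * L2_norm g)\<^sup>2)"
proof -
  have [measurable]: "f \<in> borel_measurable borel" "g \<in> borel_measurable borel"
    using f g by (simp_all add: L2_measurable)
  have m: "stft g f \<in> borel_measurable (lborel \<Otimes>\<^sub>M lborel)"
    using stft_measurable[of f g] by (simp add: lborel_prod)
  let ?F = "\<lambda>x t. f t * cnj (g (t - x))"
  have F1: "integrable lborel (?F x)" for x
    using f L2_translate(1)[OF g] by (rule L2_mult_integrable)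
  have split: "ennreal ((norm (?F x t))\<^sup>2) = ennreal ((norm (f t))\<^sup>2) * ennreal ((norm (g (t - x)))\<^sup>2)" for x t
    by (simp add: norm_mult power_mult_distrib ennreal_mult)
  have tot: "(\<integral>\<^sup>+x. \<integral>\<^sup>+t. ennreal ((norm (?F x t))\<^sup>2) \<partial>lborel \<partial>lborel) = ennreal ((L2_norm f * L2_norm g)\<^sup>2)"
  proof -
    have "(\<integral>\<^sup>+x. \<integral>\<^sup>+t. ennreal ((norm (?F x t))\<^sup>2) \<partial>lborel \<partial>lborel)
        = (\<integral>\<^sup>+t. \<integral>\<^sup>+x. ennreal ((norm (?F x t))\<^sup>2) \<partial>lborel \<partial>lborel)"
      by (rule lborel_pair.Fubini'[symmetric]) measurable
    also have "\<dots> = (\<integral>\<^sup>+t. ennreal ((norm (f t))\<^sup>2) * (\<integral>\<^sup>+x. ennreal ((norm (g (t - x)))\<^sup>2) \<partial>lborel) \<partial>lborel)"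
      unfolding split by (intro nn_integral_cong nn_integral_cmult) measurable
    also have "\<dots> = (\<integral>\<^sup>+t. ennreal ((norm (f t))\<^sup>2) * ennreal ((L2_norm g)\<^sup>2) \<partial>lborel)"
      using nn_integral_reflect[of "\<lambda>x. ennreal ((norm (g x))\<^sup>2)"] nn_integral_L2[OF g] by simp
    also have "\<dots> = ennreal ((L2_norm f)\<^sup>2) * ennreal ((L2_norm g)\<^sup>2)"
      by (subst nn_integral_multc) (auto simp: nn_integral_L2[OF f])
    finally show ?thesis by (simp only: power_mult_distrib ennreal_mult zero_le_power2)
  qed
  have "AE x in lborel. (\<integral>\<^sup>+t. ennreal ((norm (?F x t))\<^sup>2) \<partial>lborel) \<noteq> \<infinity>"
    by (rule nn_integral_PInf_AE) (measurable, simp add: tot)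
  hence ae: "AE x in lborel. (\<integral>\<^sup>+\<xi>. ennreal ((norm (stft g f (x, \<xi>)))\<^sup>2) \<partial>lborel) = (\<integral>\<^sup>+t. ennreal ((norm (?F x t))\<^sup>2) \<partial>lborel)"
  proof (rule AE_mp, intro AE_I2 impI)
    fix x assume fin: "(\<integral>\<^sup>+t. ennreal ((norm (?F x t))\<^sup>2) \<partial>lborel) \<noteq> \<infinity>"
    have F2: "?F x \<in> L2" using fin
      by (simp add: L2_def integrable_iff_bounded less_top[symmetric])
    show "(\<integral>\<^sup>+\<xi>. ennreal ((norm (stft g f (x, \<xi>)))\<^sup>2) \<partial>lborel) = (\<integral>\<^sup>+t. ennreal ((norm (?F x t))\<^sup>2) \<partial>lborel)"
      unfolding stft_eq_fourier Plancherel[OF F1 F2] nn_integral_L2[OF F2] ..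
  qed
  have "(\<integral>\<^sup>+z. ennreal ((norm (stft g f z))\<^sup>2) \<partial>lborel) = (\<integral>\<^sup>+x. \<integral>\<^sup>+\<xi>. ennreal ((norm (stft g f (x, \<xi>)))\<^sup>2) \<partial>lborel \<partial>lborel)"
    unfolding lborel_prod[symmetric] by (rule lborel.nn_integral_fst[symmetric]) (use m in measurable)
  also have "\<dots> = (\<integral>\<^sup>+x. \<integral>\<^sup>+t. ennreal ((norm (?F x t))\<^sup>2) \<partial>lborel \<partial>lborel)"
    by (rule nn_integral_cong_AE[OF ae])
  finally show ?thesis unfolding tot .
qed

section \<open>The weak form of the localization operator\<close>

text \<open>
  An explicit superposition of time-frequency shifts with bounded coefficients supported in a set of
  finite measure. The Cauchy-Schwarz inequality over that set shows that it is square integrable,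
  and Fubini's theorem that it represents the expected functional.
\<close>

lemma tf_synthesis:
  fixes g :: "real ^ 'n \<Rightarrow> complex"
  assumes g: "g \<in> L2" and c[measurable]: "c \<in> borel_measurable borel"
    and \<Omega>[measurable]: "\<Omega> \<in> sets borel" and fin: "emeasure lborel \<Omega> < \<infinity>"
    and bd: "\<And>z. norm (c z) \<le> C * indicator \<Omega> z"
  defines "u \<equiv> \<lambda>t. LINT z|lborel. c z * tf_shift g z t"
  shows "u \<in> L2" and "\<And>h. h \<in> L2 \<Longrightarrow> L2_inner u h = (LINT z|lborel. c z * cnj (stft g h z))"
proof -
  have [measurable]: "g \<in> borel_measurable borel" using g by (rule L2_measurable)
  have tfm: "(\<lambda>(z, t). tf_shift g z t) \<in> borel_measurable (lborel \<Otimes>\<^sub>M lborel)"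
  proof -
    have "(\<lambda>(z, t). tf_shift g z t) \<in> borel_measurable ((lborel \<Otimes>\<^sub>M lborel) \<Otimes>\<^sub>M lborel)"
      unfolding tf_shift_def by measurable
    thus ?thesis by (simp only: lborel_prod)
  qed
  have tfm': "(\<lambda>(t, z). tf_shift g z t) \<in> borel_measurable (lborel \<Otimes>\<^sub>M lborel)"
    using measurable_pair_swap[OF tfm] by (simp add: case_prod_beta)
  have tfm1[measurable]: "(\<lambda>z. tf_shift g z t) \<in> borel_measurable borel" for t
    using measurable_compose_Pair1[OF _ tfm', of t] by simp
  have um[measurable]: "u \<in> borel_measurable borel"
  proof -
    have "(\<lambda>(t, z). c z * tf_shift g z t) \<in> borel_measurable (lborel \<Otimes>\<^sub>M lborel)"
      using tfm' unfolding case_prod_beta by measurable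
    hence "u \<in> borel_measurable lborel" unfolding u_def by (rule lborel.borel_measurable_lebesgue_integral)
    thus ?thesis by simp
  qed
  let ?C = "\<integral>\<^sup>+z. (ennreal (norm (c z)))\<^sup>2 \<partial>lborel"
  have Cfin: "?C < \<infinity>"
  proof -
    have "?C \<le> (\<integral>\<^sup>+z. ennreal (C\<^sup>2) * indicator \<Omega> z \<partial>lborel)"
    proof (rule nn_integral_mono)
      fix z
      have "(norm (c z))\<^sup>2 \<le> (C * indicator \<Omega> z)\<^sup>2" by (intro power_mono bd) simp
      thus "(ennreal (norm (c z)))\<^sup>2 \<le> ennreal (C\<^sup>2) * indicator \<Omega> z"
        by (cases "z \<in> \<Omega>") (auto simp: ennreal_power)
    qed
    also have "\<dots> = ennreal (C\<^sup>2) * emeasure lborel \<Omega>" by (rule nn_integral_cmult_indicator) simp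
    also have "\<dots> < \<infinity>" using fin by (simp add: ennreal_mult_less_top)
    finally show ?thesis .
  qed
  have point: "ennreal ((norm (u t))\<^sup>2) \<le> ?C * (\<integral>\<^sup>+z. indicator \<Omega> z * ennreal ((norm (tf_shift g z t))\<^sup>2) \<partial>lborel)" for t
  proof -
    have "ennreal (norm (u t)) \<le> (\<integral>\<^sup>+z. ennreal (norm (c z * tf_shift g z t)) \<partial>lborel)"
    proof (cases "integrable lborel (\<lambda>z. c z * tf_shift g z t)")
      case True thus ?thesis unfolding u_def by (rule integral_norm_bound_ennreal)
    qed (simp add: u_def not_integrable_integral_eq)
    also have "\<dots> = (\<integral>\<^sup>+z. ennreal (norm (c z)) * (indicator \<Omega> z * ennreal (norm (tf_shift g z t))) \<partial>lborel)"
    proof (intro nn_integral_cong)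
      fix z
      show "ennreal (norm (c z * tf_shift g z t)) = ennreal (norm (c z)) * (indicator \<Omega> z * ennreal (norm (tf_shift g z t)))"
        using bd[of z] by (cases "z \<in> \<Omega>") (auto simp: norm_mult ennreal_mult)
    qed
    finally have "(ennreal (norm (u t)))\<^sup>2 \<le> (\<integral>\<^sup>+z. ennreal (norm (c z)) * (indicator \<Omega> z * ennreal (norm (tf_shift g z t))) \<partial>lborel)\<^sup>2"
      by (rule power_mono) simp
    also have "\<dots> \<le> ?C * (\<integral>\<^sup>+z. (indicator \<Omega> z * ennreal (norm (tf_shift g z t)))\<^sup>2 \<partial>lborel)"
      by (rule Cauchy_Schwarz_nn_integral) measurable
    also have "(\<lambda>z. (indicator \<Omega> z * ennreal (norm (tf_shift g z t)))\<^sup>2) = (\<lambda>z. indicator \<Omega> z * ennreal ((norm (tf_shift g z t))\<^sup>2))"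
      by (auto simp: indicator_def ennreal_power)
    finally show ?thesis by (simp add: ennreal_power)
  qed
  have m2: "(\<lambda>(t, z). indicator \<Omega> z * ennreal ((norm (tf_shift g z t))\<^sup>2)) \<in> borel_measurable (lborel \<Otimes>\<^sub>M lborel)"
    using tfm' unfolding case_prod_beta by measurable
  have m3: "(\<lambda>t. \<integral>\<^sup>+z. indicator \<Omega> z * ennreal ((norm (tf_shift g z t))\<^sup>2) \<partial>lborel) \<in> borel_measurable lborel"
    using lborel.borel_measurable_nn_integral[OF m2] by simp
  have "(\<integral>\<^sup>+t. ennreal ((norm (u t))\<^sup>2) \<partial>lborel)
      \<le> (\<integral>\<^sup>+t. ?C * (\<integral>\<^sup>+z. indicator \<Omega> z * ennreal ((norm (tf_shift g z t))\<^sup>2) \<partial>lborel) \<partial>lborel)"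
    by (intro nn_integral_mono point)
  also have "\<dots> = ?C * (\<integral>\<^sup>+t. \<integral>\<^sup>+z. indicator \<Omega> z * ennreal ((norm (tf_shift g z t))\<^sup>2) \<partial>lborel \<partial>lborel)"
    by (rule nn_integral_cmult[OF m3])
  also have "(\<integral>\<^sup>+t. \<integral>\<^sup>+z. indicator \<Omega> z * ennreal ((norm (tf_shift g z t))\<^sup>2) \<partial>lborel \<partial>lborel)
      = (\<integral>\<^sup>+z. \<integral>\<^sup>+t. indicator \<Omega> z * ennreal ((norm (tf_shift g z t))\<^sup>2) \<partial>lborel \<partial>lborel)"
    by (rule lborel_pair.Fubini'[OF m2, symmetric])
  also have "\<dots> = (\<integral>\<^sup>+z. ennreal ((L2_norm g)\<^sup>2) * indicator \<Omega> z \<partial>lborel)"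
  proof (intro nn_integral_cong)
    fix z
    show "(\<integral>\<^sup>+t. indicator \<Omega> z * ennreal ((norm (tf_shift g z t))\<^sup>2) \<partial>lborel) = ennreal ((L2_norm g)\<^sup>2) * indicator \<Omega> z"
      using nn_integral_L2[OF tf_shift_L2(1)[OF g, of z]] by (cases "z \<in> \<Omega>") (simp_all add: tf_shift_L2(2)[OF g])
  qed
  also have "\<dots> = ennreal ((L2_norm g)\<^sup>2) * emeasure lborel \<Omega>" by (rule nn_integral_cmult_indicator) simp
  also have "?C * (ennreal ((L2_norm g)\<^sup>2) * emeasure lborel \<Omega>) < \<infinity>"
    using Cfin fin by (simp add: ennreal_mult_less_top)
  finally have "(\<integral>\<^sup>+t. ennreal ((norm (u t))\<^sup>2) \<partial>lborel) < \<infinity>" .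
  thus "u \<in> L2" using um by (simp add: L2_def integrable_iff_bounded)
  fix h :: "real ^ 'n \<Rightarrow> complex" assume h: "h \<in> L2"
  have [measurable]: "h \<in> borel_measurable borel" using h by (rule L2_measurable)
  have C0: "0 \<le> C * indicator \<Omega> z" for z using bd[of z] norm_ge_zero[of "c z"] by linarith
  have i: "integrable lborel (\<lambda>t. tf_shift g z t * cnj (h t))" for z
    by (rule L2_mult_integrable[OF tf_shift_L2(1)[OF g] h])
  have mm: "(\<lambda>(z, t). c z * tf_shift g z t * cnj (h t)) \<in> borel_measurable (lborel \<Otimes>\<^sub>M lborel)"
    using tfm unfolding case_prod_beta by measurable
  have F: "integrable (lborel \<Otimes>\<^sub>M lborel) (\<lambda>(z, t). c z * tf_shift g z t * cnj (h t))"
  proof (rule lborel_pair.Fubini_integrable[OF mm])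
    show "AE z in lborel. integrable lborel (\<lambda>t. case (z, t) of (z, t) \<Rightarrow> c z * tf_shift g z t * cnj (h t))"
      using integrable_mult_right[OF i] by (simp add: mult.assoc)
    show "integrable lborel (\<lambda>z. LINT t|lborel. norm (case (z, t) of (z, t) \<Rightarrow> c z * tf_shift g z t * cnj (h t)))"
    proof (rule Bochner_Integration.integrable_bound)
      show "integrable lborel (\<lambda>z. C * indicator \<Omega> z * (L2_norm g * L2_norm h))"
        using fin by (intro integrable_mult_left integrable_mult_right integrable_real_indicator) auto
      show "AE z in lborel. norm (LINT t|lborel. norm (case (z, t) of (z, t) \<Rightarrow> c z * tf_shift g z t * cnj (h t)))
          \<le> norm (C * indicator \<Omega> z * (L2_norm g * L2_norm h))"
      proof (rule AE_I2)
        fix z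
        have "ennreal (LINT t|lborel. norm (tf_shift g z t * cnj (h t))) = (\<integral>\<^sup>+t. ennreal (norm (tf_shift g z t) * norm (h t)) \<partial>lborel)"
          using integrable_norm[OF i[of z]] by (subst nn_integral_eq_integral[symmetric]) (auto simp: norm_mult)
        also have "\<dots> \<le> ennreal (L2_norm g * L2_norm h)"
          using L2_Cauchy_Schwarz_nn[OF tf_shift_L2(1)[OF g, of z] h] by (simp only: tf_shift_L2(2)[OF g])
        finally have le: "(LINT t|lborel. norm (tf_shift g z t * cnj (h t))) \<le> L2_norm g * L2_norm h"
          by (simp add: ennreal_le_iff L2_norm_nonneg)
        have "(LINT t|lborel. norm (case (z, t) of (z, t) \<Rightarrow> c z * tf_shift g z t * cnj (h t)))
            = norm (c z) * (LINT t|lborel. norm (tf_shift g z t * cnj (h t)))"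
          by (simp add: norm_mult mult.assoc)
        also have "\<bar>\<dots>\<bar> \<le> C * indicator \<Omega> z * (L2_norm g * L2_norm h)"
          using le bd[of z] C0[of z] by (simp add: abs_mult integral_nonneg_AE mult_mono)
        finally show "norm (LINT t|lborel. norm (case (z, t) of (z, t) \<Rightarrow> c z * tf_shift g z t * cnj (h t)))
          \<le> norm (C * indicator \<Omega> z * (L2_norm g * L2_norm h))" by simp
      qed
      have "(\<lambda>(z, t). norm (c z * tf_shift g z t * cnj (h t))) \<in> borel_measurable (lborel \<Otimes>\<^sub>M lborel)"
        using measurable_compose[OF mm borel_measurable_norm] by (simp add: case_prod_beta)
      thus "(\<lambda>z. LINT t|lborel. norm (case (z, t) of (z, t) \<Rightarrow> c z * tf_shift g z t * cnj (h t))) \<in> borel_measurable lborel"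
        unfolding prod.case by (rule lborel.borel_measurable_lebesgue_integral)
    qed
  qed
  have "L2_inner u h = (LINT t|lborel. LINT z|lborel. c z * tf_shift g z t * cnj (h t))"
    unfolding L2_inner_def u_def by (simp only: integral_mult_left_zero)
  also have "\<dots> = (LINT z|lborel. LINT t|lborel. c z * tf_shift g z t * cnj (h t))"
    by (rule lborel_pair.Fubini_integral[OF F])
  also have "\<dots> = (LINT z|lborel. c z * cnj (stft g h z))"
  proof (rule Bochner_Integration.integral_cong[OF refl])
    fix z
    have "(LINT t|lborel. c z * tf_shift g z t * cnj (h t)) = c z * L2_inner (tf_shift g z) h"
      unfolding L2_inner_def mult.assoc by (simp only: integral_mult_right_zero)
    thus "(LINT t|lborel. c z * tf_shift g z t * cnj (h t)) = c z * cnj (stft g h z)"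
      by (simp only: stft_eq_inner L2_inner_commute[of "tf_shift g z" h])
  qed
  finally show "L2_inner u h = (LINT z|lborel. c z * cnj (stft g h z))" .
qed

text \<open>
  The localization operator is defined by choice; the superposition above with coefficients
  \<open>V\<^sub>g f\<close> on \<open>\<Omega>\<close> shows that there is something to choose.
\<close>

lemma localization_operator_weak:
  fixes f g :: "real ^ 'n \<Rightarrow> complex"
  assumes g: "g \<in> L2" and f: "f \<in> L2" and \<Omega>: "\<Omega> \<in> sets borel" "emeasure lborel \<Omega> < \<infinity>"
  shows "localization_operator g \<Omega> f \<in> L2"
    and "h \<in> L2 \<Longrightarrow> L2_inner (localization_operator g \<Omega> f) h
           = (LINT z:\<Omega>|lborel. stft g f z * cnj (stft g h z))"
proof -
  have sm: "stft g f \<in> borel_measurable borel" using f g by (intro stft_measurable L2_measurable)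
  let ?c = "\<lambda>z. indicator \<Omega> z *\<^sub>R stft g f z"
  have c: "?c \<in> borel_measurable borel" using sm \<Omega> by measurable
  have bd: "norm (?c z) \<le> (L2_norm f * L2_norm g) * indicator \<Omega> z" for z
    using norm_stft_le[OF f g, of z] by (auto simp: indicator_def)
  note syn = tf_synthesis[OF g c \<Omega> bd]
  have ex: "\<exists>u. u \<in> L2 \<and> (\<forall>h\<in>L2. L2_inner u h = (LINT z:\<Omega>|lborel. stft g f z * cnj (stft g h z)))"
    using syn by (intro exI[of _ "\<lambda>t. LINT z|lborel. ?c z * tf_shift g z t"])
      (simp add: set_lebesgue_integral_def)
  show "localization_operator g \<Omega> f \<in> L2"
    and "h \<in> L2 \<Longrightarrow> L2_inner (localization_operator g \<Omega> f) h
           = (LINT z:\<Omega>|lborel. stft g f z * cnj (stft g h z))"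
    using someI_ex[OF ex] unfolding localization_operator_def by blast+
qed

section \<open>Translates of sets of finite perimeter\<close>

text \<open>
  The derivative is kept as a continuous family of bounded linear maps, the form in which one can
  differentiate under the integral sign.
\<close>

definition C1 :: "('a::euclidean_space \<Rightarrow> real) \<Rightarrow> bool" where
  "C1 f \<longleftrightarrow> (\<exists>f'. continuous_on UNIV f' \<and> (\<forall>x. (f has_derivative blinfun_apply (f' x)) (at x)))"

lemma C1_continuous: "C1 f \<Longrightarrow> continuous_on UNIV f"
  unfolding C1_def by (meson continuous_at_imp_continuous_on has_derivative_continuous)

lemma C1_mult:
  assumes "C1 f" "C1 g" shows "C1 (\<lambda>x. f x * g x)"
proof -
  obtain f' g' where f': "continuous_on UNIV f'" "\<And>x. (f has_derivative blinfun_apply (f' x)) (at x)"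
    and g': "continuous_on UNIV g'" "\<And>x. (g has_derivative blinfun_apply (g' x)) (at x)"
    using assms unfolding C1_def by blast
  show ?thesis unfolding C1_def
  proof (intro exI[of _ "\<lambda>x. f x *\<^sub>R g' x + g x *\<^sub>R f' x"] conjI allI)
    show "continuous_on UNIV (\<lambda>x. f x *\<^sub>R g' x + g x *\<^sub>R f' x)"
      using f'(1) g'(1) C1_continuous[OF assms(1)] C1_continuous[OF assms(2)] by (intro continuous_intros)
    fix x
    have "((\<lambda>x. f x * g x) has_derivative (\<lambda>v. f x * blinfun_apply (g' x) v + blinfun_apply (f' x) v * g x)) (at x)"
      by (rule has_derivative_mult[OF f'(2) g'(2)])
    thus "((\<lambda>x. f x * g x) has_derivative blinfun_apply (f x *\<^sub>R g' x + g x *\<^sub>R f' x)) (at x)"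
      by (simp add: plus_blinfun.rep_eq scaleR_blinfun.rep_eq mult.commute)
  qed
qed

lemma C1_add:
  assumes "C1 f" "C1 g" shows "C1 (\<lambda>x. f x + g x)"
proof -
  obtain f' g' where f': "continuous_on UNIV f'" "\<And>x. (f has_derivative blinfun_apply (f' x)) (at x)"
    and g': "continuous_on UNIV g'" "\<And>x. (g has_derivative blinfun_apply (g' x)) (at x)"
    using assms unfolding C1_def by blast
  show ?thesis unfolding C1_def
  proof (intro exI[of _ "\<lambda>x. f' x + g' x"] conjI allI)
    show "continuous_on UNIV (\<lambda>x. f' x + g' x)" using f'(1) g'(1) by (intro continuous_intros)
    fix x
    show "((\<lambda>x. f x + g x) has_derivative blinfun_apply (f' x + g' x)) (at x)"
      using has_derivative_add[OF f'(2)[of x] g'(2)[of x]] by (simp add: plus_blinfun.rep_eq)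
  qed
qed

lemma C1_const: "C1 (\<lambda>x. c)"
  unfolding C1_def by (intro exI[of _ "\<lambda>x. 0"]) (auto simp: zero_blinfun.rep_eq)

lemma C1_real_polynomial: "real_polynomial_function p \<Longrightarrow> C1 p"
proof (induction p rule: real_polynomial_function.induct)
  case (linear f)
  thus ?case unfolding C1_def
    by (intro exI[of _ "\<lambda>x. Blinfun f"])
      (auto simp: bounded_linear_Blinfun_apply bounded_linear_imp_has_derivative)
qed (auto intro: C1_const C1_add C1_mult)

lemma C1_compose:
  assumes f: "C1 f" and h: "\<And>s. (h has_field_derivative h' s) (at s)" "continuous_on UNIV h'"
  shows "C1 (\<lambda>x. h (f x))"
proof -
  obtain f' where f': "continuous_on UNIV f'" "\<And>x. (f has_derivative blinfun_apply (f' x)) (at x)"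
    using f unfolding C1_def by blast
  show ?thesis unfolding C1_def
  proof (intro exI[of _ "\<lambda>x. h' (f x) *\<^sub>R f' x"] conjI allI)
    show "continuous_on UNIV (\<lambda>x. h' (f x) *\<^sub>R f' x)"
      using f'(1) by (intro continuous_intros continuous_on_compose2[OF h(2) C1_continuous[OF f]]) auto
    fix x
    have "((\<lambda>x. h (f x)) has_derivative (\<lambda>v. h' (f x) * blinfun_apply (f' x) v)) (at x)"
      using has_derivative_compose[OF f'(2)[of x] h(1)[of "f x", unfolded has_field_derivative_def]] by simp
    thus "((\<lambda>x. h (f x)) has_derivative blinfun_apply (h' (f x) *\<^sub>R f' x)) (at x)"
      by (simp add: scaleR_blinfun.rep_eq)
  qed
qed

text \<open>
  The squared positive part is the simplest profile that vanishes on a half-line and is continuously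
  differentiable.
\<close>

lemma has_derivative_pos_part_square:
  "((\<lambda>s::real. (max 0 s)\<^sup>2) has_field_derivative 2 * max 0 s) (at s)"
proof -
  consider "s > 0" | "s < 0" | "s = 0" by linarith
  thus ?thesis
  proof cases
    case 1
    have "((\<lambda>s::real. s\<^sup>2) has_field_derivative 2 * max 0 s) (at s)"
      using 1 by (auto intro!: derivative_eq_intros)
    thus ?thesis by (rule has_field_derivative_transform_within_open[where S="{0<..}"]) (use 1 in auto)
  next
    case 2
    have "((\<lambda>s::real. 0) has_field_derivative 2 * max 0 s) (at s)"
      using 2 by (auto intro!: derivative_eq_intros)
    thus ?thesis by (rule has_field_derivative_transform_within_open[where S="{..<0}"]) (use 2 in auto)
  next
    case 3
    have "((\<lambda>h::real. (max 0 h)\<^sup>2 / h) \<longlongrightarrow> 0) (at 0)"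
    proof (rule Lim_null_comparison[where g="\<lambda>h. \<bar>h\<bar>"])
      show "\<forall>\<^sub>F h in at 0. norm ((max 0 h)\<^sup>2 / h) \<le> \<bar>h :: real\<bar>"
        by (intro always_eventually allI) (auto simp: max_def power2_eq_square)
      show "((\<lambda>h::real. \<bar>h\<bar>) \<longlongrightarrow> 0) (at 0)" using tendsto_rabs[OF tendsto_ident_at[of "0::real"]] by simp
    qed
    thus ?thesis using 3 by (simp add: DERIV_def)
  qed
qed

text \<open>
  A cutoff without plateau suffices: on a fixed ball it tends to \<open>1\<close> uniformly as \<open>N\<close> grows, by the last
  claim.
\<close>

lemma C1_cutoff:
  fixes N :: real and cut :: "'a::euclidean_space \<Rightarrow> real"
  assumes N: "N > 0"
    and cut_def: "cut = (\<lambda>x. (max 0 (1 - (norm x)\<^sup>2 / N\<^sup>2))\<^sup>2)"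
  shows "C1 cut" and "\<And>x. 0 \<le> cut x" and "\<And>x. cut x \<le> 1" and "\<And>x. norm x > N \<Longrightarrow> cut x = 0"
    and "\<And>x. 1 - cut x \<le> 2 * (norm x)\<^sup>2 / N\<^sup>2"
proof -
  have "real_polynomial_function (\<lambda>x::'a. 1 - (\<Sum>b\<in>Basis. (x \<bullet> b) * (x \<bullet> b)) / N\<^sup>2)"
    by (intro real_polynomial_function_diff real_polynomial_function.intros(2) real_polynomial_function_divide
        real_polynomial_function_sum real_polynomial_function.intros(4) real_polynomial_function.intros(1))
      (auto intro: bounded_linear_inner_left)
  moreover have "(\<Sum>b\<in>Basis. (x \<bullet> b) * (x \<bullet> b)) = (norm x)\<^sup>2" for x :: 'a
    by (simp only: power2_norm_eq_inner euclidean_inner[of x x])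
  ultimately have p: "C1 (\<lambda>x::'a. 1 - (norm x)\<^sup>2 / N\<^sup>2)" by (simp add: C1_real_polynomial)
  show "C1 cut" unfolding cut_def
    by (rule C1_compose[OF p has_derivative_pos_part_square]) (intro continuous_intros)
  fix x :: 'a
  show "0 \<le> cut x" by (simp add: cut_def)
  show "cut x \<le> 1" unfolding cut_def by (intro power_le_one) auto
  show "cut x = 0" if "norm x > N"
  proof -
    have "N\<^sup>2 \<le> (norm x)\<^sup>2" using that N by (intro power_mono) auto
    thus ?thesis using N by (simp add: cut_def)
  qed
  let ?r = "(norm x)\<^sup>2 / N\<^sup>2"
  have "1 - 2 * ?r \<le> (max 0 (1 - ?r))\<^sup>2"
  proof (cases "?r \<le> 1")
    case True
    have "1 - 2 * ?r \<le> (1 - ?r)\<^sup>2" by (simp add: power2_diff)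
    thus ?thesis using True by simp
  next
    case False thus ?thesis by (intro order_trans[OF _ zero_le_power2]) linarith
  qed
  thus "1 - cut x \<le> 2 * (norm x)\<^sup>2 / N\<^sup>2" by (simp add: cut_def)
qed

text \<open>
  For a function with values in \<open>{-1, 0, 1}\<close> the \<open>L\<^sup>1\<close> norm is \<open>\<integral> u\<^sup>2\<close>, so it is almost attained by pairing
  \<open>u\<close> with a test function close to \<open>u\<close>. That function is made in three steps: a continuous
  approximation of \<open>u\<close> in \<open>L\<^sup>1\<close>, clamped to \<open>[-1, 1]\<close>; a polynomial close to it on a large ball,
  rescaled so that it stays in \<open>[-1, 1]\<close>; and multiplication by a cutoff.
\<close>

lemma sign_approx_C1:
  fixes u :: "'a::euclidean_space \<Rightarrow> real"
  assumes u: "integrable lborel u" and u1: "\<And>x. u x = 0 \<or> \<bar>u x\<bar> = 1"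
    and supp: "\<And>x. norm x > R \<Longrightarrow> u x = 0" and e: "0 < e"
  obtains \<psi> N where "C1 \<psi>" "\<And>x. \<bar>\<psi> x\<bar> \<le> 1" "\<And>x. norm x > N \<Longrightarrow> \<psi> x = 0"
    "(LINT x|lborel. \<bar>u x\<bar>) \<le> (LINT x|lborel. u x * \<psi> x) + e"
proof -
  have um[measurable]: "u \<in> borel_measurable borel" using u by auto
  define m where "m = measure lborel (cball (0::'a) R)"
  have m0: "0 \<le> m" by (simp add: m_def)
  \<comment> \<open>The \<open>L\<^sup>1\<close> approximation costs \<open>\<delta>\<close>; polynomial, rescaling and cutoff cost \<open>\<delta>\<close> each, uniformly on the ball.\<close>
  define \<delta> where "\<delta> = e / (1 + 3 * m)"
  have \<delta>: "0 < \<delta>" using e m0 by (simp add: \<delta>_def)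
  obtain \<psi>0 where \<psi>0: "continuous_on UNIV \<psi>0" "(LINT x|lborel. norm (u x - \<psi>0 x)) < \<delta>"
    and i0: "integrable lborel \<psi>0"
    using integrable_approx_continuous[OF u \<delta>] continuous_bounded_support_integrable by metis
  define \<psi>1 where "\<psi>1 x = max (-1) (min 1 (\<psi>0 x))" for x
  have \<psi>1: "continuous_on UNIV \<psi>1" unfolding \<psi>1_def by (intro continuous_intros \<psi>0(1))
  have \<psi>1b: "\<bar>\<psi>1 x\<bar> \<le> 1" for x by (auto simp: \<psi>1_def)
  have \<psi>1u: "\<bar>u x - \<psi>1 x\<bar> \<le> norm (u x - \<psi>0 x)" for x
    using u1[of x] by (auto simp: \<psi>1_def max_def min_def abs_if split: if_splits)
  obtain N where N: "N > 0" "2 * R\<^sup>2 / N\<^sup>2 \<le> \<delta>" "\<bar>R\<bar> \<le> N"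
  proof
    let ?N = "\<bar>R\<bar> + 1 + 2 * R\<^sup>2 / \<delta>"
    have q: "0 \<le> 2 * R\<^sup>2 / \<delta>" using \<delta> by simp
    show "?N > 0" "\<bar>R\<bar> \<le> ?N" using q by linarith+
    have "2 * R\<^sup>2 / \<delta> \<le> ?N * 1" by simp
    also have "\<dots> \<le> ?N * ?N" using q by (intro mult_left_mono) auto
    finally have "2 * R\<^sup>2 / \<delta> \<le> ?N\<^sup>2" by (simp add: power2_eq_square)
    moreover have "0 < ?N\<^sup>2" using \<open>?N > 0\<close> by simp
    ultimately show "2 * R\<^sup>2 / ?N\<^sup>2 \<le> \<delta>" using \<delta> by (simp add: pos_divide_le_eq mult.commute)
  qed
  define cut where "cut = (\<lambda>x::'a. (max 0 (1 - (norm x)\<^sup>2 / N\<^sup>2))\<^sup>2)"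
  note cut = C1_cutoff[OF N(1) cut_def]
  have cN: "continuous_on (cball 0 N) \<psi>1" using \<psi>1 continuous_on_subset by blast
  obtain p where p: "real_polynomial_function p" "\<And>x. x \<in> cball 0 N \<Longrightarrow> \<bar>\<psi>1 x - p x\<bar> < \<delta>"
    using Stone_Weierstrass_real_polynomial_function[OF compact_cball cN \<delta>] by blast
  \<comment> \<open>The polynomial may exceed \<open>1\<close> by \<open>\<delta>\<close> on the ball.\<close>
  define q where "q x = p x / (1 + \<delta>)" for x
  have q1: "\<bar>q x\<bar> \<le> 1" and q2: "\<bar>q x - \<psi>1 x\<bar> \<le> 2 * \<delta>" if "x \<in> cball 0 N" for x
  proof -
    have "\<bar>p x\<bar> \<le> 1 + \<delta>" using p(2)[OF that] \<psi>1b[of x] by linarith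
    thus "\<bar>q x\<bar> \<le> 1" using \<delta> by (simp add: q_def)
    hence "\<bar>\<delta> * q x\<bar> \<le> \<delta>" using \<delta> by (simp add: abs_mult)
    moreover have "p x = (1 + \<delta>) * q x" using \<delta> by (simp add: q_def)
    hence "p x = q x + \<delta> * q x" by (simp only: distrib_right mult_1_left)
    ultimately show "\<bar>q x - \<psi>1 x\<bar> \<le> 2 * \<delta>" using p(2)[OF that] by linarith
  qed
  define \<psi> where "\<psi> x = cut x * q x" for x
  have "real_polynomial_function q" unfolding q_def[abs_def]
    using p(1) by (intro real_polynomial_function_divide)
  hence \<psi>C: "C1 \<psi>" unfolding \<psi>_def[abs_def] by (intro C1_mult cut(1) C1_real_polynomial)
  have \<psi>s: "\<psi> x = 0" if "norm x > N" for x using cut(4)[OF that] by (simp add: \<psi>_def)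
  have \<psi>b: "\<bar>\<psi> x\<bar> \<le> 1" for x
  proof (cases "norm x > N")
    case False
    hence "\<bar>cut x\<bar> * \<bar>q x\<bar> \<le> 1 * 1" using cut(2,3)[of x] q1[of x] by (intro mult_mono) auto
    thus ?thesis by (simp add: \<psi>_def abs_mult)
  qed (simp add: \<psi>s)
  have near: "\<bar>\<psi> x - \<psi>1 x\<bar> \<le> 3 * \<delta>" if "norm x \<le> R" for x
  proof -
    have xN: "x \<in> cball 0 N" using that N(3) by simp
    have "(norm x)\<^sup>2 \<le> R\<^sup>2" using that by (intro power_mono) auto
    hence "2 * (norm x)\<^sup>2 / N\<^sup>2 \<le> \<delta>"
      by (intro order_trans[OF _ N(2)] divide_right_mono mult_left_mono) auto
    hence c: "\<bar>1 - cut x\<bar> \<le> \<delta>" using cut(3,5)[of x] by linarith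
    have "\<bar>(1 - cut x) * q x\<bar> \<le> \<delta> * 1" unfolding abs_mult using c q1[OF xN] by (intro mult_mono) auto
    moreover have "\<psi> x = q x - (1 - cut x) * q x" by (simp add: \<psi>_def algebra_simps)
    ultimately show ?thesis using q2[OF xN] by linarith
  qed
  have \<psi>m[measurable]: "\<psi> \<in> borel_measurable borel"
    using C1_continuous[OF \<psi>C] by (rule borel_measurable_continuous_onI)
  have iu\<psi>: "integrable lborel (\<lambda>x. u x * \<psi> x)"
    by (rule Bochner_Integration.integrable_bound[OF u]) (auto simp: abs_mult intro!: mult_left_le \<psi>b)
  have icb: "integrable lborel (indicat_real (cball (0::'a) R))"
    using emeasure_lborel_cball_finite[of "0::'a" R] by (intro integrable_real_indicator) auto
  have "(LINT x|lborel. \<bar>u x\<bar>) \<le> (LINT x|lborel. u x * \<psi> x + (norm (u x - \<psi>0 x) + 3 * \<delta> * indicator (cball 0 R) x))"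
  proof (rule integral_mono)
    show "integrable lborel (\<lambda>x. \<bar>u x\<bar>)" using u by (rule integrable_abs)
    show "integrable lborel (\<lambda>x. u x * \<psi> x + (norm (u x - \<psi>0 x) + 3 * \<delta> * indicator (cball 0 R) x))"
      using u i0 iu\<psi> icb by (intro Bochner_Integration.integrable_add integrable_norm integrable_mult_right Bochner_Integration.integrable_diff)
    fix x
    show "\<bar>u x\<bar> \<le> u x * \<psi> x + (norm (u x - \<psi>0 x) + 3 * \<delta> * indicator (cball 0 R) x)"
    proof (cases "norm x \<le> R")
      case True
      have "\<bar>u x - \<psi> x\<bar> \<le> norm (u x - \<psi>0 x) + 3 * \<delta>" using near[OF True] \<psi>1u[of x] by linarith
      moreover have "\<bar>u x\<bar> - u x * \<psi> x \<le> \<bar>u x - \<psi> x\<bar>" using u1[of x] \<psi>b[of x] by (auto simp: abs_if split: if_splits)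
      ultimately show ?thesis using True by simp
    qed (simp add: supp)
  qed
  also have "\<dots> = (LINT x|lborel. u x * \<psi> x) + ((LINT x|lborel. norm (u x - \<psi>0 x)) + 3 * \<delta> * m)"
    using u i0 iu\<psi> icb by (simp add: m_def)
  also have "\<dots> \<le> (LINT x|lborel. u x * \<psi> x) + (\<delta> + 3 * \<delta> * m)" using \<psi>0(2) by simp
  also have "\<delta> + 3 * \<delta> * m = \<delta> * (1 + 3 * m)" by (simp add: algebra_simps)
  also have "\<dots> = e" using m0 by (simp add: \<delta>_def)
  finally show ?thesis using that[OF \<psi>C \<psi>b \<psi>s] by blast
qed

text \<open>
  The field is \<open>\<phi>(x) = - (\<integral>\<^sub>0\<^sup>1 \<psi>(x - \<tau> w) d\<tau>) w / |w|\<close>. Its divergence is the integral of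
  \<open>\<tau> \<mapsto> d/d\<tau> \<psi>(x - \<tau> w)\<close> up to the factor \<open>1 / |w|\<close>, and it inherits the bound by \<open>1\<close> from \<open>\<psi>\<close>.
\<close>

lemma difference_is_divergence:
  fixes \<psi> :: "'a::euclidean_space \<Rightarrow> real"
  assumes \<psi>: "C1 \<psi>" and bd: "\<And>x. \<bar>\<psi> x\<bar> \<le> 1" and supp: "\<And>x. norm x > N \<Longrightarrow> \<psi> x = 0" and w: "w \<noteq> 0"
  obtains \<phi> where "\<phi> \<in> C1_compact_support" "\<And>x. norm (\<phi> x) \<le> 1"
    "\<And>x. divergence \<phi> x = (\<psi> (x - w) - \<psi> x) / norm w"
proof -
  obtain \<psi>' where \<psi>': "continuous_on UNIV \<psi>'" "\<And>x. (\<psi> has_derivative blinfun_apply (\<psi>' x)) (at x)"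
    using \<psi> unfolding C1_def by blast
  have c\<psi>: "continuous_on UNIV \<psi>" using \<psi> by (rule C1_continuous)
  define I where "I x = integral (cbox 0 1) (\<lambda>\<tau>::real. \<psi>' (x - \<tau> *\<^sub>R w))" for x
  define \<Psi> where "\<Psi> x = integral (cbox 0 1) (\<lambda>\<tau>::real. \<psi> (x - \<tau> *\<^sub>R w))" for x
  have cont2: "continuous_on (UNIV \<times> cbox 0 1) (\<lambda>(x, \<tau>::real). \<psi>' (x - \<tau> *\<^sub>R w))"
    unfolding case_prod_beta by (rule continuous_on_compose2[OF \<psi>'(1)]) (auto intro!: continuous_intros)
  have cont1: "continuous_on S (\<lambda>\<tau>::real. \<psi>' (x - \<tau> *\<^sub>R w))" for x S
    by (rule continuous_on_compose2[OF \<psi>'(1)]) (auto intro!: continuous_intros)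
  have cont1': "continuous_on S (\<lambda>\<tau>::real. \<psi> (x - \<tau> *\<^sub>R w))" for x S
    by (rule continuous_on_compose2[OF c\<psi>]) (auto intro!: continuous_intros)
  have dshift: "((\<lambda>x. \<psi> (x - \<tau> *\<^sub>R w)) has_derivative blinfun_apply (\<psi>' (x - \<tau> *\<^sub>R w))) (at x within UNIV)" for x and \<tau> :: real
    using has_derivative_compose[OF has_derivative_diff[OF has_derivative_ident has_derivative_const] \<psi>'(2)]
    by simp
  have D\<Psi>: "(\<Psi> has_derivative blinfun_apply (I x)) (at x)" for x
    unfolding \<Psi>_def[abs_def] I_def
    using leibniz_rule[of UNIV 0 1 "\<lambda>x \<tau>. \<psi> (x - \<tau> *\<^sub>R w)" "\<lambda>x \<tau>. \<psi>' (x - \<tau> *\<^sub>R w)" x]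
      dshift cont2 integrable_continuous[OF cont1'] by simp
  have cI: "continuous_on UNIV I"
    unfolding I_def[abs_def] by (rule integral_continuous_on_param[OF cont2])
  have Iw: "blinfun_apply (I x) w = \<psi> x - \<psi> (x - w)" for x
  proof -
    have "blinfun_apply (I x) w = integral {0..1} (\<lambda>\<tau>. blinfun_apply (\<psi>' (x - \<tau> *\<^sub>R w)) w)"
      unfolding I_def
      using integral_linear[OF integrable_continuous[OF cont1] blinfun.bounded_linear_left[of w], of 0 1 x] by (simp add: o_def)
    also have "\<dots> = (- \<psi> (x - 1 *\<^sub>R w)) - (- \<psi> (x - 0 *\<^sub>R w))"
    proof (rule integral_unique[OF fundamental_theorem_of_calculus])
      fix \<tau> :: real
      have "((\<lambda>\<tau>. \<psi> (x - \<tau> *\<^sub>R w)) has_derivative (\<lambda>h. blinfun_apply (\<psi>' (x - \<tau> *\<^sub>R w)) (0 - h *\<^sub>R w))) (at \<tau> within {0..1})"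
        by (rule has_derivative_compose[OF _ \<psi>'(2)]) (auto intro!: derivative_eq_intros)
      hence "((\<lambda>\<tau>. - \<psi> (x - \<tau> *\<^sub>R w)) has_derivative (\<lambda>h. - blinfun_apply (\<psi>' (x - \<tau> *\<^sub>R w)) (0 - h *\<^sub>R w))) (at \<tau> within {0..1})"
        by (rule has_derivative_minus)
      thus "((\<lambda>\<tau>. - \<psi> (x - \<tau> *\<^sub>R w)) has_vector_derivative blinfun_apply (\<psi>' (x - \<tau> *\<^sub>R w)) w) (at \<tau> within {0..1})"
        by (simp add: has_vector_derivative_def blinfun.minus_right blinfun.scaleR_right)
    qed simp
    finally show ?thesis by simp
  qed
  define v where "v = (1 / norm w) *\<^sub>R w"
  have v1: "norm v = 1" using w by (simp add: v_def)
  define \<phi> where "\<phi> x = - (\<Psi> x *\<^sub>R v)" for x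
  have D\<phi>: "(\<phi> has_derivative (\<lambda>h. - (blinfun_apply (I x) h *\<^sub>R v))) (at x)" for x
    unfolding \<phi>_def[abs_def] by (intro has_derivative_minus has_derivative_scaleR_left D\<Psi>)
  have fd: "frechet_derivative \<phi> (at x) = (\<lambda>h. - (blinfun_apply (I x) h *\<^sub>R v))" for x
    using frechet_derivative_at[OF D\<phi>[of x]] by simp
  have zero: "\<phi> x = 0" if "norm x > N + norm w" for x
  proof -
    have "\<psi> (x - \<tau> *\<^sub>R w) = 0" if t: "\<tau> \<in> cbox 0 1" for \<tau> :: real
    proof (rule supp)
      have "norm (\<tau> *\<^sub>R w) \<le> 1 * norm w" using t unfolding norm_scaleR by (intro mult_right_mono) auto
      thus "norm (x - \<tau> *\<^sub>R w) > N" using \<open>norm x > N + norm w\<close> norm_triangle_ineq2[of x "\<tau> *\<^sub>R w"] by linarith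
    qed
    hence "\<Psi> x = integral (cbox 0 1) (\<lambda>\<tau>::real. 0)" unfolding \<Psi>_def by (intro integral_cong) auto
    thus ?thesis by (simp add: \<phi>_def)
  qed
  show ?thesis
  proof
    have "{x. \<phi> x \<noteq> 0} \<subseteq> cball 0 (N + norm w)" using zero by force
    hence "compact (closure {x. \<phi> x \<noteq> 0})" using bounded_subset bounded_cball by (metis compact_closure)
    moreover have "continuous_on UNIV (\<lambda>x. frechet_derivative \<phi> (at x) h)" for h
      unfolding fd by (intro continuous_intros cI)
    moreover have "\<phi> differentiable (at x)" for x using D\<phi>[of x] unfolding differentiable_def by blast
    ultimately show "\<phi> \<in> C1_compact_support" by (simp add: C1_compact_support_def)
    fix x
    have "norm (\<Psi> x) \<le> integral (cbox 0 1) (\<lambda>\<tau>::real. 1)"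
      unfolding \<Psi>_def by (rule integral_norm_bound_integral[OF integrable_continuous[OF cont1']]) (use bd in auto)
    thus "norm (\<phi> x) \<le> 1" by (simp add: \<phi>_def v1)
    have "divergence \<phi> x = - (\<Sum>b\<in>Basis. blinfun_apply (I x) b * (v \<bullet> b))"
      by (simp add: divergence_def fd sum_negf)
    also have "(\<Sum>b\<in>Basis. blinfun_apply (I x) b * (v \<bullet> b)) = blinfun_apply (I x) (\<Sum>b\<in>Basis. (v \<bullet> b) *\<^sub>R b)"
      by (simp add: blinfun.sum_right blinfun.scaleR_right mult.commute)
    also have "\<dots> = (\<psi> x - \<psi> (x - w)) / norm w"
      by (simp only: euclidean_representation) (simp add: v_def blinfun.scaleR_right Iw)
    finally show "divergence \<phi> x = (\<psi> (x - w) - \<psi> x) / norm w" by (simp add: minus_divide_left)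
  qed
qed

text \<open>
  The zero field is admissible in the supremum, so for a set of finite perimeter the real number
  \<open>perimeter E\<close> represents the variation faithfully.
\<close>

lemma perimeter_nonneg:
  assumes "finite_perimeter E" shows "0 \<le> perimeter E" and "variation (indicat_real E) = ereal (perimeter E)"
proof -
  have "(\<lambda>x::'a. 0::'a) \<in> C1_compact_support" by (simp add: C1_compact_support_def)
  moreover have "divergence (\<lambda>x::'a. 0::'a) x = 0" for x by (simp add: divergence_def)
  ultimately have "ereal 0 \<le> variation (indicat_real E)"
    unfolding variation_def by (intro SUP_upper2[of "\<lambda>x. 0"]) auto
  moreover have "variation (indicat_real E) < \<infinity>" using assms by (simp add: finite_perimeter_def)
  ultimately show "0 \<le> perimeter E" and "variation (indicat_real E) = ereal (perimeter E)"
    unfolding perimeter_def by (cases "variation (indicat_real E)"; simp)+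
qed

text \<open>
  After testing against \<open>\<psi>\<close> with \<open>|\<psi>| \<le> 1\<close>, the translation moves from the indicator function to \<open>\<psi>\<close>,
  and the difference of \<open>\<psi>\<close> is \<open>|w|\<close> times the divergence of an admissible field.
\<close>

theorem translation_le_perimeter:
  fixes E :: "'a::euclidean_space set"
  assumes E: "E \<in> sets borel" "bounded E" and fp: "finite_perimeter E"
  shows "(LINT x|lborel. \<bar>indicat_real E (x + w) - indicat_real E x\<bar>) \<le> norm w * perimeter E"
proof (cases "w = 0")
  case False
  have [measurable]: "E \<in> sets borel" by (rule E(1))
  obtain R where R: "\<And>x. x \<in> E \<Longrightarrow> norm x \<le> R" using E(2) bounded_iff by metis
  let ?u = "\<lambda>x. indicat_real E (x + w) - indicat_real E x"
  have iE: "integrable lborel (indicat_real E)" using fp by (simp add: finite_perimeter_def)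
  have iEw: "integrable lborel (\<lambda>x. indicat_real E (x + w))" using iE integral_shift(5)[of "indicat_real E" w] by simp
  have u: "integrable lborel ?u" using iEw iE by (rule Bochner_Integration.integrable_diff)
  have u1: "?u x = 0 \<or> \<bar>?u x\<bar> = 1" for x by (auto simp: indicator_def)
  have us: "?u x = 0" if "norm x > R + norm w" for x
  proof -
    have "norm (x + w) \<ge> norm x - norm w" using norm_triangle_ineq2[of x "- w"] by simp
    hence "x + w \<notin> E" "x \<notin> E" using R[of "x + w"] R[of x] that norm_ge_zero[of w] by linarith+
    thus ?thesis by simp
  qed
  have "(LINT x|lborel. \<bar>?u x\<bar>) \<le> norm w * perimeter E + e" if e: "0 < e" for e
  proof -
    obtain \<psi> N where \<psi>: "C1 \<psi>" "\<And>x. \<bar>\<psi> x\<bar> \<le> 1" "\<And>x. norm x > N \<Longrightarrow> \<psi> x = 0"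
      "(LINT x|lborel. \<bar>?u x\<bar>) \<le> (LINT x|lborel. ?u x * \<psi> x) + e"
      using sign_approx_C1[OF u u1 us e] by blast
    obtain \<phi> where \<phi>: "\<phi> \<in> C1_compact_support" "\<And>x. norm (\<phi> x) \<le> 1"
      "\<And>x. divergence \<phi> x = (\<psi> (x - w) - \<psi> x) / norm w"
      using difference_is_divergence[OF \<psi>(1-3) False] by blast
    have [measurable]: "\<psi> \<in> borel_measurable borel"
      using C1_continuous[OF \<psi>(1)] by (rule borel_measurable_continuous_onI)
    have i\<psi>: "integrable lborel (\<lambda>x. indicat_real E (x + y) * \<psi> (x - z))" for y z
    proof (rule Bochner_Integration.integrable_bound)
      show "integrable lborel (\<lambda>x. indicat_real E (x + y))" using iE integral_shift(5)[of "indicat_real E" y] by simp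
    qed (use \<psi>(2) in \<open>auto simp: abs_mult indicator_def\<close>)
    have "(LINT x|lborel. ?u x * \<psi> x) = (LINT x|lborel. indicat_real E (x + w) * \<psi> x) - (LINT x|lborel. indicat_real E x * \<psi> x)"
      using i\<psi>[of w 0] i\<psi>[of 0 0] by (simp add: left_diff_distrib)
    also have "(LINT x|lborel. indicat_real E (x + w) * \<psi> x) = (LINT x|lborel. indicat_real E x * \<psi> (x - w))"
      using integral_shift(2)[of "\<lambda>x. indicat_real E x * \<psi> (x - w)" w] by simp
    also have "(LINT x|lborel. indicat_real E x * \<psi> (x - w)) - (LINT x|lborel. indicat_real E x * \<psi> x)
      = (LINT x|lborel. norm w * (indicat_real E x * divergence \<phi> x))"
    proof -
      have "norm w * (indicat_real E x * divergence \<phi> x) = indicat_real E x * \<psi> (x - w) - indicat_real E x * \<psi> x" for x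
        using False by (simp add: \<phi>(3) right_diff_distrib[symmetric])
      thus ?thesis using i\<psi>[of 0 w] i\<psi>[of 0 0] by simp
    qed
    also have "\<dots> = norm w * (LINT x|lborel. indicat_real E x * divergence \<phi> x)" by simp
    also have "\<dots> \<le> norm w * perimeter E"
    proof (intro mult_left_mono)
      have "ereal (LINT x|lborel. indicat_real E x * divergence \<phi> x) \<le> variation (indicat_real E)"
        unfolding variation_def using \<phi>(1,2) by (intro SUP_upper) auto
      thus "(LINT x|lborel. indicat_real E x * divergence \<phi> x) \<le> perimeter E"
        by (simp add: perimeter_nonneg(2)[OF fp])
    qed simp
    finally show ?thesis using \<psi>(4) by linarith
  qed
  thus ?thesis by (rule field_le_epsilon)
qed (simp add: perimeter_nonneg(1)[OF fp])

section \<open>Smoothing an indicator function\<close>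

text \<open>
  As \<open>k\<close> has integral \<open>1\<close>, the error is the average over \<open>k(v) dv\<close> of the difference between the
  indicator function and its translate by \<open>v\<close>.
\<close>

lemma smoothing_error:
  fixes k :: "'a::euclidean_space \<Rightarrow> real"
  assumes k: "integrable lborel k" "\<And>z. 0 \<le> k z" "(LINT z|lborel. k z) = 1"
    and mom: "integrable lborel (\<lambda>z. norm z * k z)"
    and E: "E \<in> sets borel" "bounded E" "finite_perimeter E"
  shows "(\<integral>\<^sup>+z. ennreal \<bar>(LINT w:E|lborel. k (w - z)) - indicat_real E z\<bar> \<partial>lborel)
     \<le> ennreal ((LINT z|lborel. norm z * k z) * perimeter E)"
proof -
  have [measurable]: "E \<in> sets borel" "k \<in> borel_measurable borel" using E(1) k(1) by auto
  have iE: "integrable lborel (indicat_real E)" using E(3) by (simp add: finite_perimeter_def)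
  have P0: "0 \<le> perimeter E" by (rule perimeter_nonneg(1)[OF E(3)])
  let ?d = "\<lambda>v z. \<bar>indicat_real E (z + v) - indicat_real E z\<bar>"
  have ik: "integrable lborel (\<lambda>v. indicat_real E (z + v) * k v)" for z
    by (rule Bochner_Integration.integrable_bound[OF k(1)]) (auto simp: indicator_def k(2))
  have diff: "(LINT w:E|lborel. k (w - z)) - indicat_real E z = (LINT v|lborel. (indicat_real E (z + v) - indicat_real E z) * k v)" for z
  proof -
    have "(LINT w:E|lborel. k (w - z)) = (LINT v|lborel. indicat_real E (z + v) * k v)"
      unfolding set_lebesgue_integral_def
      using integral_shift(2)[of "\<lambda>w. indicat_real E w * k (w - z)" z] by (simp add: add.commute)
    moreover have "indicat_real E z = (LINT v|lborel. indicat_real E z * k v)" by (simp add: k(3))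
    ultimately show ?thesis using ik[of z] k(1) by (simp add: left_diff_distrib)
  qed
  have "(\<integral>\<^sup>+z. ennreal \<bar>(LINT w:E|lborel. k (w - z)) - indicat_real E z\<bar> \<partial>lborel)
     \<le> (\<integral>\<^sup>+z. \<integral>\<^sup>+v. ennreal (?d v z) * ennreal (k v) \<partial>lborel \<partial>lborel)"
  proof (rule nn_integral_mono)
    fix z
    have "integrable lborel (\<lambda>v. (indicat_real E (z + v) - indicat_real E z) * k v)"
      using ik[of z] k(1) by (simp add: left_diff_distrib)
    from integral_norm_bound_ennreal[OF this]
    show "ennreal \<bar>(LINT w:E|lborel. k (w - z)) - indicat_real E z\<bar> \<le> (\<integral>\<^sup>+v. ennreal (?d v z) * ennreal (k v) \<partial>lborel)"
      unfolding diff by (simp add: abs_mult k(2) ennreal_mult)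
  qed
  also have "\<dots> = (\<integral>\<^sup>+v. \<integral>\<^sup>+z. ennreal (?d v z) * ennreal (k v) \<partial>lborel \<partial>lborel)"
    by (rule lborel_pair.Fubini'[symmetric]) measurable
  also have "\<dots> = (\<integral>\<^sup>+v. (\<integral>\<^sup>+z. ennreal (?d v z) \<partial>lborel) * ennreal (k v) \<partial>lborel)"
    by (intro nn_integral_cong nn_integral_multc) measurable
  also have "\<dots> \<le> (\<integral>\<^sup>+v. ennreal (perimeter E * (norm v * k v)) \<partial>lborel)"
  proof (rule nn_integral_mono)
    fix v :: 'a
    have "integrable lborel (\<lambda>z. indicat_real E (z + v))" using iE integral_shift(5)[of "indicat_real E" v] by simp
    hence "integrable lborel (?d v)" using iE by (intro integrable_abs Bochner_Integration.integrable_diff)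
    hence "(\<integral>\<^sup>+z. ennreal (?d v z) \<partial>lborel) = ennreal (LINT z|lborel. ?d v z)"
      by (intro nn_integral_eq_integral) auto
    also have "\<dots> \<le> ennreal (norm v * perimeter E)"
      by (intro ennreal_leI translation_le_perimeter E)
    finally have "(\<integral>\<^sup>+z. ennreal (?d v z) \<partial>lborel) * ennreal (k v) \<le> ennreal (norm v * perimeter E) * ennreal (k v)"
      by (rule mult_right_mono) simp
    also have "\<dots> = ennreal (perimeter E * (norm v * k v))"
      using P0 k(2)[of v] by (simp add: ennreal_mult[symmetric] mult_ac)
    finally show "(\<integral>\<^sup>+z. ennreal (?d v z) \<partial>lborel) * ennreal (k v) \<le> ennreal (perimeter E * (norm v * k v))" .
  qed
  also have "\<dots> = ennreal (LINT v|lborel. perimeter E * (norm v * k v))"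
    using mom P0 k(2) by (intro nn_integral_eq_integral) auto
  also have "\<dots> = ennreal ((LINT z|lborel. norm z * k z) * perimeter E)" by (simp add: mult.commute)
  finally show ?thesis .
qed

lemma nn_integral_convolution_indicator:
  fixes k :: "'a::euclidean_space \<Rightarrow> real"
  assumes k: "integrable lborel k" "\<And>z. 0 \<le> k z" "(LINT z|lborel. k z) = 1"
    and E: "E \<in> sets borel"
  shows "(\<integral>\<^sup>+z. ennreal (LINT w:E|lborel. k (w - z)) \<partial>lborel) = emeasure lborel E"
proof -
  have [measurable]: "E \<in> sets borel" "k \<in> borel_measurable borel" using E k(1) by auto
  have "ennreal (LINT w:E|lborel. k (w - z)) = (\<integral>\<^sup>+w. indicator E w * ennreal (k (w - z)) \<partial>lborel)" for z
  proof -
    have i: "integrable lborel (\<lambda>w. k (w - z))" using k(1) integral_shift(4)[of k z] by simp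
    have "integrable lborel (\<lambda>w. indicat_real E w * k (w - z))"
      by (rule Bochner_Integration.integrable_bound[OF i]) (auto simp: indicator_def k(2))
    hence "ennreal (LINT w:E|lborel. k (w - z)) = (\<integral>\<^sup>+w. ennreal (indicat_real E w * k (w - z)) \<partial>lborel)"
      unfolding set_lebesgue_integral_def
      by (subst nn_integral_eq_integral) (auto simp: k(2))
    thus ?thesis by (simp add: ennreal_mult k(2) ennreal_indicator)
  qed
  hence "(\<integral>\<^sup>+z. ennreal (LINT w:E|lborel. k (w - z)) \<partial>lborel)
       = (\<integral>\<^sup>+z. \<integral>\<^sup>+w. indicator E w * ennreal (k (w - z)) \<partial>lborel \<partial>lborel)" by simp
  also have "\<dots> = (\<integral>\<^sup>+w. \<integral>\<^sup>+z. indicator E w * ennreal (k (w - z)) \<partial>lborel \<partial>lborel)"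
    by (rule lborel_pair.Fubini'[symmetric]) measurable
  also have "\<dots> = (\<integral>\<^sup>+w. indicator E w * (\<integral>\<^sup>+z. ennreal (k (w - z)) \<partial>lborel) \<partial>lborel)"
    by (intro nn_integral_cong nn_integral_cmult) measurable
  also have "\<dots> = (\<integral>\<^sup>+w. indicator E w \<partial>lborel)"
    using nn_integral_reflect[of "\<lambda>z. ennreal (k z)"] nn_integral_eq_integral[OF k(1)] k(2,3) by simp
  also have "\<dots> = emeasure lborel E" by simp
  finally show ?thesis .
qed

section \<open>Eigenvalues of the localization operator\<close>

lemma ennreal_sumsI:
  fixes l :: "nat \<Rightarrow> real"
  assumes l: "\<And>k. 0 \<le> l k" and s: "(\<Sum>k. ennreal (l k)) = ennreal V" and V: "0 \<le> V"
  shows "l sums V"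
proof -
  have sm: "summable l" by (rule summable_suminf_not_top[OF l]) (simp add: s)
  have "ennreal (suminf l) = ennreal V" using suminf_ennreal_eq[OF l summable_sums[OF sm]] s by simp
  hence "suminf l = V" using V suminf_nonneg[OF sm l] by simp
  thus ?thesis using summable_sums[OF sm] by simp
qed

text \<open>
  The index set of the eigenvalues. The two families below are extended by \<open>0\<close> outside of it, so that
  finite and infinite rank are treated alike by series over all natural numbers.
\<close>

definition eig_index :: "enat \<Rightarrow> nat set" where
  "eig_index r = {k. 1 \<le> k \<and> enat k \<le> r}"

definition eig_value :: "enat \<Rightarrow> (nat \<Rightarrow> real) \<Rightarrow> nat \<Rightarrow> real" where
  "eig_value r \<mu> k = (if k \<in> eig_index r then \<mu> k else 0)"

definition eig_spectrogram ::
  "(real ^ 'n \<Rightarrow> complex) \<Rightarrow> enat \<Rightarrow> (nat \<Rightarrow> real ^ 'n \<Rightarrow> complex) \<Rightarrow> nat \<Rightarrow> (real ^ 'n) \<times> (real ^ 'n) \<Rightarrow> real" where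
  "eig_spectrogram g r h k z = (if k \<in> eig_index r then (norm (stft g (h k) z))\<^sup>2 else 0)"

lemma eigensystemD:
  assumes "eigensystem g \<Omega> r \<mu> h"
  shows "\<And>j k. j \<in> eig_index r \<Longrightarrow> k \<in> eig_index r \<Longrightarrow> j \<le> k \<Longrightarrow> \<mu> k \<le> \<mu> j"
    and "\<And>k. k \<in> eig_index r \<Longrightarrow> h k \<in> L2"
    and "\<And>k. k \<in> eig_index r \<Longrightarrow> L2_inner (h k) (h k) = 1"
    and "\<And>k. k \<in> eig_index r \<Longrightarrow> AE t in lborel. localization_operator g \<Omega> (h k) t = of_real (\<mu> k) * h k t"
    and "\<And>f. f \<in> L2 \<Longrightarrow> (\<lambda>n. L2_norm (\<lambda>t. localization_operator g \<Omega> f t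
                 - (\<Sum>k\<in>eig_index r \<inter> {..n}. of_real (\<mu> k) * L2_inner f (h k) * h k t))) \<longlonglongrightarrow> 0"
proof -
  let ?K = "eig_index r"
  note D = assms[unfolded eigensystem_def Let_def, folded eig_index_def]
  have d: "\<forall>j\<in>?K. \<forall>k\<in>?K. j \<le> k \<longrightarrow> \<mu> k \<le> \<mu> j" using D by (elim conjE)
  have d2: "\<forall>k\<in>?K. h k \<in> L2" using D by (elim conjE)
  have d3: "\<forall>j\<in>?K. \<forall>k\<in>?K. L2_inner (h j) (h k) = (if j = k then 1 else 0)" using D by (elim conjE)
  have d4: "\<forall>k\<in>?K. AE t in lborel. localization_operator g \<Omega> (h k) t = of_real (\<mu> k) * h k t"
    using D by (elim conjE)
  have d5: "\<forall>f\<in>L2. (\<lambda>n. L2_norm (\<lambda>t. localization_operator g \<Omega> f t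
                 - (\<Sum>k\<in>?K \<inter> {..n}. of_real (\<mu> k) * L2_inner f (h k) * h k t))) \<longlonglongrightarrow> 0"
    using D by (elim conjE)
  show "\<mu> k \<le> \<mu> j" if "j \<in> ?K" "k \<in> ?K" "j \<le> k" for j k using d that by blast
  show "h k \<in> L2" if "k \<in> ?K" for k using d2 that by blast
  show "L2_inner (h k) (h k) = 1" if "k \<in> ?K" for k using d3 that by simp
  show "AE t in lborel. localization_operator g \<Omega> (h k) t = of_real (\<mu> k) * h k t" if "k \<in> ?K" for k
    using d4 that by blast
  show "(\<lambda>n. L2_norm (\<lambda>t. localization_operator g \<Omega> f t
                 - (\<Sum>k\<in>?K \<inter> {..n}. of_real (\<mu> k) * L2_inner f (h k) * h k t))) \<longlonglongrightarrow> 0"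
    if "f \<in> L2" for f using d5 that by (rule bspec)
qed

lemma eig_spectrogram_nonneg: "0 \<le> eig_spectrogram g r h k z"
  by (simp add: eig_spectrogram_def)

lemma eig_spectrogram_measurable:
  assumes e: "eigensystem g \<Omega> r \<mu> h" and g: "g \<in> L2"
  shows "eig_spectrogram g r h k \<in> borel_measurable borel"
proof (cases "k \<in> eig_index r")
  case True
  have [measurable]: "stft g (h k) \<in> borel_measurable borel"
    using eigensystemD(2)[OF e True] g by (intro stft_measurable L2_measurable)
  show ?thesis using True unfolding eig_spectrogram_def[abs_def] by simp
qed (simp add: eig_spectrogram_def[abs_def])

lemma eigenfunction_norm:
  assumes e: "eigensystem g \<Omega> r \<mu> h" and k: "k \<in> eig_index r"
  shows "L2_norm (h k) = 1"
proof -
  have "complex_of_real ((L2_norm (h k))\<^sup>2) = of_real 1"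
    using eigensystemD(3)[OF e k] by (simp only: L2_inner_self of_real_1)
  hence "(L2_norm (h k))\<^sup>2 = 1" by (simp only: of_real_eq_iff)
  thus ?thesis using L2_norm_nonneg[of "h k"] by (simp add: power2_eq_1_iff)
qed

lemma nn_integral_eig_spectrogram:
  assumes e: "eigensystem g \<Omega> r \<mu> h" and g: "g \<in> L2" "L2_norm g = 1"
  shows "(\<integral>\<^sup>+z. ennreal (eig_spectrogram g r h k z) \<partial>lborel) = (if k \<in> eig_index r then 1 else 0)"
proof (cases "k \<in> eig_index r")
  case True
  thus ?thesis using Moyal[OF eigensystemD(2)[OF e True] g(1)] eigenfunction_norm[OF e True] g(2)
    by (simp add: eig_spectrogram_def)
qed (simp add: eig_spectrogram_def)

text \<open>
  Pairing the eigenvalue equation with the normalized eigenfunction shows that an eigenvalue is the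
  mass that the spectrogram of its eigenfunction has in \<open>\<Omega>\<close>.
\<close>

lemma eig_value_concentration:
  assumes e: "eigensystem g \<Omega> r \<mu> h" and g: "g \<in> L2" "L2_norm g = 1"
    and \<Omega>: "\<Omega> \<in> sets borel" "emeasure lborel \<Omega> < \<infinity>"
  shows "0 \<le> eig_value r \<mu> k"
    and "(\<integral>\<^sup>+z. indicator \<Omega> z * ennreal (eig_spectrogram g r h k z) \<partial>lborel) = ennreal (eig_value r \<mu> k)"
proof -
  let ?I = "\<integral>\<^sup>+z. indicator \<Omega> z * ennreal (eig_spectrogram g r h k z) \<partial>lborel"
  have "0 \<le> eig_value r \<mu> k \<and> ?I = ennreal (eig_value r \<mu> k)"
  proof (cases "k \<in> eig_index r")
    case True
    have hL: "h k \<in> L2" by (rule eigensystemD(2)[OF e True])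
    have HL: "localization_operator g \<Omega> (h k) \<in> L2" by (rule localization_operator_weak(1)[OF g(1) hL \<Omega>])
    have [measurable]: "h k \<in> borel_measurable borel" "localization_operator g \<Omega> (h k) \<in> borel_measurable borel"
      using hL HL by (simp_all only: L2_measurable)
    have [measurable]: "eig_spectrogram g r h k \<in> borel_measurable borel"
      by (rule eig_spectrogram_measurable[OF e g(1)])
    have [measurable]: "\<Omega> \<in> sets borel" by (rule \<Omega>(1))
    have "L2_inner (localization_operator g \<Omega> (h k)) (h k) = (LINT t|lborel. of_real (\<mu> k) * (h k t * cnj (h k t)))"
      unfolding L2_inner_def using eigensystemD(4)[OF e True]
      by (intro integral_cong_AE) (measurable, auto elim!: eventually_mono simp: mult.assoc)
    also have "\<dots> = of_real (\<mu> k)"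
      using eigensystemD(3)[OF e True] by (simp add: L2_inner_def)
    finally have "of_real (\<mu> k) = (LINT z:\<Omega>|lborel. stft g (h k) z * cnj (stft g (h k) z))"
      using localization_operator_weak(2)[OF g(1) hL \<Omega> hL] by simp
    also have "\<dots> = (LINT z|lborel. complex_of_real (indicator \<Omega> z * eig_spectrogram g r h k z))"
      unfolding set_lebesgue_integral_def eig_spectrogram_def using True
      by (intro Bochner_Integration.integral_cong refl)
        (simp only: if_True of_real_mult complex_norm_square scaleR_conv_of_real)
    also have "\<dots> = of_real (LINT z|lborel. indicator \<Omega> z * eig_spectrogram g r h k z)"
      by (rule integral_complex_of_real)
    finally have \<mu>: "\<mu> k = (LINT z|lborel. indicator \<Omega> z * eig_spectrogram g r h k z)"
      by (simp only: of_real_eq_iff)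
    have "integrable lborel (eig_spectrogram g r h k)"
      using nn_integral_eig_spectrogram[OF e g, of k] True
      by (simp add: integrable_iff_bounded eig_spectrogram_nonneg)
    hence "integrable lborel (\<lambda>z. indicator \<Omega> z * eig_spectrogram g r h k z)"
      using integrable_mult_indicator[of \<Omega> lborel "eig_spectrogram g r h k"] by simp
    hence "(\<integral>\<^sup>+z. ennreal (indicator \<Omega> z * eig_spectrogram g r h k z) \<partial>lborel) = ennreal (\<mu> k)"
      unfolding \<mu> by (intro nn_integral_eq_integral) (simp_all add: eig_spectrogram_nonneg)
    moreover have "ennreal (indicator \<Omega> z * eig_spectrogram g r h k z) = indicator \<Omega> z * ennreal (eig_spectrogram g r h k z)" for z
      by (simp add: indicator_def)
    moreover have "0 \<le> \<mu> k" unfolding \<mu> by (intro integral_nonneg_AE) (simp add: eig_spectrogram_nonneg)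
    ultimately show ?thesis using True by (simp add: eig_value_def)
  qed (simp add: eig_value_def eig_spectrogram_def)
  thus "0 \<le> eig_value r \<mu> k" "?I = ennreal (eig_value r \<mu> k)" by simp_all
qed

lemma eig_value_le_1:
  assumes e: "eigensystem g \<Omega> r \<mu> h" and g: "g \<in> L2" "L2_norm g = 1"
    and \<Omega>: "\<Omega> \<in> sets borel" "emeasure lborel \<Omega> < \<infinity>"
  shows "eig_value r \<mu> k \<le> 1"
proof -
  have "ennreal (eig_value r \<mu> k) = (\<integral>\<^sup>+z. indicator \<Omega> z * ennreal (eig_spectrogram g r h k z) \<partial>lborel)"
    by (rule eig_value_concentration(2)[OF e g \<Omega>, symmetric])
  also have "\<dots> \<le> (\<integral>\<^sup>+z. ennreal (eig_spectrogram g r h k z) \<partial>lborel)"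
    by (intro nn_integral_mono) (simp add: indicator_def)
  also have "\<dots> \<le> 1" by (simp add: nn_integral_eig_spectrogram[OF e g])
  finally show ?thesis by simp
qed

lemma eig_value_decreasing:
  assumes e: "eigensystem g \<Omega> r \<mu> h" and g: "g \<in> L2" "L2_norm g = 1"
    and \<Omega>: "\<Omega> \<in> sets borel" "emeasure lborel \<Omega> < \<infinity>" and jk: "1 \<le> j" "j \<le> k"
  shows "eig_value r \<mu> k \<le> eig_value r \<mu> j"
proof (cases "k \<in> eig_index r")
  case True
  have "enat j \<le> r" using True jk(2) by (auto simp: eig_index_def intro: order_trans[of _ "enat k"])
  hence "j \<in> eig_index r" using jk(1) by (simp add: eig_index_def)
  thus ?thesis using eigensystemD(1)[OF e _ True jk(2)] True by (simp add: eig_value_def)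
next
  case False
  thus ?thesis using eig_value_concentration(1)[OF e g \<Omega>, of j] by (simp add: eig_value_def[of r \<mu> k])
qed

text \<open>
  The spectral expansion is applied to the shift of \<open>g\<close> by \<open>z\<close> and paired with this same function, a
  unit vector; norm convergence of the expansion then becomes convergence of numbers.
\<close>

lemma weighted_spectrogram_sums:
  assumes e: "eigensystem g \<Omega> r \<mu> h" and g: "g \<in> L2" "L2_norm g = 1"
    and \<Omega>: "\<Omega> \<in> sets borel" "emeasure lborel \<Omega> < \<infinity>"
  shows "(\<lambda>k. eig_value r \<mu> k * eig_spectrogram g r h k z) sums
           (LINT w:\<Omega>|lborel. (norm (stft g g (w - z)))\<^sup>2)"
proof -
  let ?f = "tf_shift g z"
  let ?H = "localization_operator g \<Omega> ?f"
  let ?K = "\<lambda>n. eig_index r \<inter> {..n}"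
  let ?p = "\<lambda>n t. \<Sum>k\<in>?K n. of_real (\<mu> k) * L2_inner ?f (h k) * h k t"
  let ?T = "LINT w:\<Omega>|lborel. (norm (stft g g (w - z)))\<^sup>2"
  have f: "?f \<in> L2" "L2_norm ?f = 1" using tf_shift_L2[OF g(1), of z] g(2) by simp_all
  have H: "?H \<in> L2" by (rule localization_operator_weak(1)[OF g(1) f(1) \<Omega>])
  have hL: "h k \<in> L2" if "k \<in> ?K n" for k n using that eigensystemD(2)[OF e] by blast
  have p: "?p n \<in> L2" for n by (intro L2_sum L2_cmult hL) auto
  have Hf: "L2_inner ?H ?f = of_real ?T"
  proof -
    have "L2_inner ?H ?f = (LINT w:\<Omega>|lborel. stft g ?f w * cnj (stft g ?f w))"
      by (rule localization_operator_weak(2)[OF g(1) f(1) \<Omega> f(1)])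
    also have "\<dots> = (LINT w|lborel. complex_of_real (indicator \<Omega> w * (norm (stft g g (w - z)))\<^sup>2))"
      unfolding set_lebesgue_integral_def
      by (intro Bochner_Integration.integral_cong refl)
        (simp only: norm_stft_tf_shift[OF g(1), symmetric] of_real_mult complex_norm_square scaleR_conv_of_real)
    also have "\<dots> = of_real ?T"
      unfolding set_lebesgue_integral_def by (subst integral_complex_of_real) simp
    finally show ?thesis .
  qed
  have pf: "L2_inner (?p n) ?f = of_real (\<Sum>k\<le>n. eig_value r \<mu> k * eig_spectrogram g r h k z)" for n
  proof -
    have "L2_inner (?p n) ?f = (\<Sum>k\<in>?K n. L2_inner (\<lambda>t. of_real (\<mu> k) * L2_inner ?f (h k) * h k t) ?f)"
      by (rule L2_inner_sum_left) (auto intro!: L2_cmult hL f)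
    also have "\<dots> = (\<Sum>k\<in>?K n. of_real (\<mu> k * (norm (stft g (h k) z))\<^sup>2))"
    proof (rule sum.cong[OF refl])
      fix k
      have "L2_inner (\<lambda>t. of_real (\<mu> k) * L2_inner ?f (h k) * h k t) ?f
          = of_real (\<mu> k) * (stft g (h k) z * cnj (stft g (h k) z))"
        unfolding L2_inner_cmult_left stft_eq_inner
        by (subst L2_inner_commute[of ?f "h k"]) (simp only: mult_ac)
      thus "L2_inner (\<lambda>t. of_real (\<mu> k) * L2_inner ?f (h k) * h k t) ?f = of_real (\<mu> k * (norm (stft g (h k) z))\<^sup>2)"
        by (simp only: of_real_mult complex_norm_square)
    qed
    also have "\<dots> = of_real (\<Sum>k\<in>?K n. eig_value r \<mu> k * eig_spectrogram g r h k z)"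
      unfolding of_real_sum by (intro sum.cong refl) (auto simp: eig_value_def eig_spectrogram_def)
    also have "(\<Sum>k\<in>?K n. eig_value r \<mu> k * eig_spectrogram g r h k z) = (\<Sum>k\<le>n. eig_value r \<mu> k * eig_spectrogram g r h k z)"
      by (intro sum.mono_neutral_left) (auto simp: eig_value_def)
    finally show ?thesis .
  qed
  have bound: "norm ((\<Sum>k\<le>n. eig_value r \<mu> k * eig_spectrogram g r h k z) - ?T) \<le> L2_norm (\<lambda>t. ?H t - ?p n t)" for n
  proof -
    have "norm ((\<Sum>k\<le>n. eig_value r \<mu> k * eig_spectrogram g r h k z) - ?T)
       = norm (complex_of_real (?T - (\<Sum>k\<le>n. eig_value r \<mu> k * eig_spectrogram g r h k z)))"
      by (simp only: norm_of_real real_norm_def abs_minus_commute)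
    also have "\<dots> = norm (L2_inner (\<lambda>t. ?H t - ?p n t) ?f)"
      by (simp only: L2_inner_diff_left[OF H p f(1)] Hf pf of_real_diff)
    also have "\<dots> \<le> L2_norm (\<lambda>t. ?H t - ?p n t) * L2_norm ?f"
      by (rule L2_Cauchy_Schwarz[OF L2_diff[OF H p] f(1)])
    finally show ?thesis by (simp only: f(2) mult_1_right)
  qed
  have "(\<lambda>n. (\<Sum>k\<le>n. eig_value r \<mu> k * eig_spectrogram g r h k z) - ?T) \<longlonglongrightarrow> 0"
    by (rule Lim_null_comparison[OF always_eventually[OF allI[OF bound]] eigensystemD(5)[OF e f(1)]])
  thus ?thesis unfolding sums_def_le by (rule LIM_zero_cancel)
qed

lemma stft_norm_square_integral:
  assumes g: "g \<in> L2" "L2_norm g = 1"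
  shows "integrable lborel (\<lambda>z. (norm (stft g g z))\<^sup>2)" and "(LINT z|lborel. (norm (stft g g z))\<^sup>2) = 1"
proof -
  have [measurable]: "stft g g \<in> borel_measurable borel" using g(1) by (intro stft_measurable L2_measurable)
  have 1: "(\<integral>\<^sup>+z. ennreal ((norm (stft g g z))\<^sup>2) \<partial>lborel) = ennreal 1"
    using Moyal[OF g(1) g(1)] g(2) by simp
  show "integrable lborel (\<lambda>z. (norm (stft g g z))\<^sup>2)" using 1 by (simp add: integrable_iff_bounded)
  show "(LINT z|lborel. (norm (stft g g z))\<^sup>2) = 1"
    using 1 by (intro integral_eq_nn_integral[THEN trans]) auto
qed

text \<open>
  These are the trace and the squared Hilbert-Schmidt norm of the operator, computed by integrating
  the series for \<open>\<Theta>\<close> term by term, once over phase space and once over \<open>\<Omega>\<close>.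
\<close>

lemma eig_value_sums:
  assumes e: "eigensystem g \<Omega> r \<mu> h" and g: "g \<in> L2" "L2_norm g = 1"
    and \<Omega>: "\<Omega> \<in> sets borel" "emeasure lborel \<Omega> < \<infinity>"
  defines "\<Theta> \<equiv> \<lambda>z. LINT w:\<Omega>|lborel. (norm (stft g g (w - z)))\<^sup>2"
  shows "eig_value r \<mu> sums measure lborel \<Omega>"
    and "(\<Sum>k. ennreal (eig_value r \<mu> k * eig_value r \<mu> k)) = (\<integral>\<^sup>+z. indicator \<Omega> z * ennreal (\<Theta> z) \<partial>lborel)"
proof -
  let ?l = "eig_value r \<mu>" and ?a = "eig_spectrogram g r h"
  have [measurable]: "?a k \<in> borel_measurable borel" for k by (rule eig_spectrogram_measurable[OF e g(1)])
  have [measurable]: "\<Omega> \<in> sets borel" by (rule \<Omega>(1))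
  have l0: "0 \<le> ?l k" for k by (rule eig_value_concentration(1)[OF e g \<Omega>])
  have la0: "0 \<le> ?l k * ?a k z" for k z using l0 eig_spectrogram_nonneg by (rule mult_nonneg_nonneg)
  have \<Theta>: "ennreal (\<Theta> z) = (\<Sum>k. ennreal (?l k) * ennreal (?a k z))" for z
    using suminf_ennreal_eq[OF la0 weighted_spectrogram_sums[OF e g \<Omega>, of z]]
    by (simp add: \<Theta>_def ennreal_mult l0 eig_spectrogram_nonneg)
  have ik: "integrable lborel (\<lambda>z. (norm (stft g g z))\<^sup>2)" and k1: "(LINT z|lborel. (norm (stft g g z))\<^sup>2) = 1"
    using stft_norm_square_integral[OF g] by simp_all
  have V: "emeasure lborel \<Omega> = ennreal (measure lborel \<Omega>)"
    using \<Omega>(2) by (intro emeasure_eq_ennreal_measure) auto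
  have "emeasure lborel \<Omega> = (\<integral>\<^sup>+z. ennreal (\<Theta> z) \<partial>lborel)"
    unfolding \<Theta>_def by (rule nn_integral_convolution_indicator[OF ik _ k1 \<Omega>(1), symmetric]) simp
  also have "\<dots> = (\<Sum>k. \<integral>\<^sup>+z. ennreal (?l k) * ennreal (?a k z) \<partial>lborel)"
    unfolding \<Theta> by (rule nn_integral_suminf) measurable
  also have "\<dots> = (\<Sum>k. ennreal (?l k) * (\<integral>\<^sup>+z. ennreal (?a k z) \<partial>lborel))"
    by (intro suminf_cong nn_integral_cmult) measurable
  also have "\<dots> = (\<Sum>k. ennreal (?l k))"
    unfolding nn_integral_eig_spectrogram[OF e g] by (intro suminf_cong) (simp add: eig_value_def)
  finally have "(\<Sum>k. ennreal (?l k)) = ennreal (measure lborel \<Omega>)" using V by simp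
  thus "?l sums measure lborel \<Omega>" by (intro ennreal_sumsI l0) auto
  have "(\<integral>\<^sup>+z. indicator \<Omega> z * ennreal (\<Theta> z) \<partial>lborel)
      = (\<integral>\<^sup>+z. (\<Sum>k. ennreal (?l k) * (indicator \<Omega> z * ennreal (?a k z))) \<partial>lborel)"
    unfolding \<Theta> ennreal_suminf_cmult[symmetric] by (simp only: mult.left_commute)
  also have "\<dots> = (\<Sum>k. \<integral>\<^sup>+z. ennreal (?l k) * (indicator \<Omega> z * ennreal (?a k z)) \<partial>lborel)"
    by (rule nn_integral_suminf) measurable
  also have "\<dots> = (\<Sum>k. ennreal (?l k) * (\<integral>\<^sup>+z. indicator \<Omega> z * ennreal (?a k z) \<partial>lborel))"
    by (intro suminf_cong nn_integral_cmult) measurable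
  also have "\<dots> = (\<Sum>k. ennreal (?l k * ?l k))"
    unfolding eig_value_concentration(2)[OF e g \<Omega>] by (simp add: ennreal_mult l0)
  finally show "(\<Sum>k. ennreal (?l k * ?l k)) = (\<integral>\<^sup>+z. indicator \<Omega> z * ennreal (\<Theta> z) \<partial>lborel)" by simp
qed

text \<open>
  Eigenvalues at most \<open>1\<close> that add up to \<open>V\<close> number at least \<open>V\<close>. Thus the accumulated spectrogram never
  involves an index beyond the rank, where \<open>h\<close> is arbitrary.
\<close>

lemma summands_are_eigenfunctions:
  assumes l: "eig_value r \<mu> sums V" and l1: "\<And>k. eig_value r \<mu> k \<le> 1"
  shows "{1..nat \<lceil>V\<rceil>} \<subseteq> eig_index r"
proof
  fix k assume k: "k \<in> {1..nat \<lceil>V\<rceil>}"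
  show "k \<in> eig_index r"
  proof (rule ccontr)
    assume "k \<notin> eig_index r"
    hence "r < enat k" using k by (auto simp: eig_index_def not_le)
    then obtain n where n: "r = enat n" "n < k" by (cases r) auto
    hence K: "eig_index r = {1..n}" by (auto simp: eig_index_def)
    have "eig_value r \<mu> sums (\<Sum>j\<in>{1..n}. eig_value r \<mu> j)"
      by (rule sums_finite) (auto simp: eig_value_def K)
    hence "V = (\<Sum>j\<in>{1..n}. eig_value r \<mu> j)" using l by (rule sums_unique2[symmetric])
    also have "\<dots> \<le> (\<Sum>j\<in>{1..n}. 1)" by (intro sum_mono l1)
    finally have "V \<le> real n" by simp
    hence "nat \<lceil>V\<rceil> \<le> n" by (simp add: nat_le_iff ceiling_le_iff)
    thus False using n(2) k by (meson atLeastAtMost_iff leD le_trans)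
  qed
qed

text \<open>
  Let \<open>s\<close> be the first sum, \<open>t\<close> the tail and \<open>\<theta> = l\<^sub>N\<close>. By monotonicity \<open>l\<^sub>k (1 - l\<^sub>k)\<close> is at least
  \<open>\<theta> (1 - l\<^sub>k)\<close> for \<open>k \<le> N\<close> and at least \<open>(1 - \<theta>) l\<^sub>k\<close> for \<open>k > N\<close>, so \<open>\<theta> s + (1 - \<theta>) t \<le> B\<close>. The choice
  of \<open>N\<close> gives \<open>t \<le> s \<le> t + 1\<close>, and therefore \<open>t \<le> B\<close> for whatever value of \<open>\<theta>\<close>.
\<close>

lemma truncated_spectrum_defect:
  fixes l :: "nat \<Rightarrow> real"
  assumes l01: "\<And>k. 0 \<le> l k" "\<And>k. l k \<le> 1" and l0: "l 0 = 0"
    and anti: "\<And>j k. 1 \<le> j \<Longrightarrow> j \<le> k \<Longrightarrow> l k \<le> l j"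
    and V: "l sums V" and B: "(\<lambda>k. l k * (1 - l k)) sums B"
    and N: "N = nat \<lceil>V\<rceil>"
  shows "(\<Sum>k=1..N. 1 - l k) + (V - (\<Sum>k=1..N. l k)) \<le> 2 * B + 1"
proof -
  \<comment> \<open>For \<open>N = 0\<close> all \<open>l k\<close> vanish, and any \<open>\<theta>\<close> in \<open>[0, 1]\<close> will do.\<close>
  define \<theta> where "\<theta> = (if N = 0 then 0 else l N)"
  have \<theta>: "0 \<le> \<theta>" "\<theta> \<le> 1" using l01 by (auto simp: \<theta>_def)
  define s where "s = (\<Sum>k=1..N. 1 - l k)"
  define t where "t = V - (\<Sum>k=1..N. l k)"
  have V0: "0 \<le> V" using V l01(1) by (metis sums_iff suminf_nonneg)
  have N': "V \<le> real N" "real N < V + 1" using N V0 by linarith+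
  have st: "s = real N - V + t" by (simp add: s_def t_def sum_subtractf)
  have chi: "(\<lambda>k. if k \<in> {1..N} then c k else 0) sums (\<Sum>k=1..N. c k)" for c :: "nat \<Rightarrow> real"
    by (rule sums_If_finite_set) simp
  have "(\<lambda>k. \<theta> * (if k \<in> {1..N} then 1 - l k else 0) + (1 - \<theta>) * (l k - (if k \<in> {1..N} then l k else 0)))
     sums (\<theta> * s + (1 - \<theta>) * t)"
    unfolding s_def t_def by (intro sums_add sums_mult sums_diff V chi)
  moreover have le: "\<theta> * (if k \<in> {1..N} then 1 - l k else 0) + (1 - \<theta>) * (l k - (if k \<in> {1..N} then l k else 0))
     \<le> l k * (1 - l k)" for k
  proof (cases "k \<in> {1..N}")
    case True
    hence "\<theta> \<le> l k" using anti[of k N] by (auto simp: \<theta>_def)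
    thus ?thesis using True l01(2)[of k] by (simp add: mult_right_mono)
  next
    case False
    show ?thesis
    proof (cases "k = 0")
      case True thus ?thesis using l0 by simp
    next
      case k: False
      have "1 - \<theta> \<le> 1 - l k \<or> N = 0" using False k anti[of N k] by (auto simp: \<theta>_def)
      moreover have "l k = 0" if "N = 0"
      proof -
        have "V = 0" using that N' V0 by simp
        hence "l sums 0" using V by simp
        thus ?thesis using l01(1) by (metis sums_iff suminf_eq_zero_iff)
      qed
      ultimately show ?thesis using False l01(1)[of k] by (auto simp: mult.commute[of "l k"] mult_right_mono)
    qed
  qed
  ultimately have "\<theta> * s + (1 - \<theta>) * t \<le> B" using B by (intro sums_le[OF le])
  moreover have "\<theta> * t \<le> \<theta> * s" using \<theta>(1) N' st by (intro mult_left_mono) auto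
  ultimately have "t \<le> B" by (simp add: algebra_simps)
  hence "s + t \<le> 2 * B + 1" using st N' by linarith
  thus ?thesis unfolding s_def t_def .
qed

section \<open>The accumulated spectrogram\<close>

text \<open>
  The difference is the series of \<open>|V\<^sub>g h\<^sub>k|\<^sup>2\<close> with coefficients \<open>1 - \<lambda>\<^sub>k\<close> for \<open>k \<le> N\<close> and \<open>- \<lambda>\<^sub>k\<close>
  otherwise, and each of these functions has integral \<open>1\<close>.
\<close>

lemma accumulated_spectrogram_error:
  assumes e: "eigensystem g \<Omega> r \<mu> h" and g: "g \<in> L2" "L2_norm g = 1"
    and \<Omega>: "\<Omega> \<in> sets borel" "emeasure lborel \<Omega> < \<infinity>"
  defines "N \<equiv> nat \<lceil>measure lborel \<Omega>\<rceil>" and "\<Theta> \<equiv> \<lambda>z. LINT w:\<Omega>|lborel. (norm (stft g g (w - z)))\<^sup>2"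
  shows "(\<integral>\<^sup>+z. ennreal \<bar>accumulated_spectrogram g \<Omega> h z - \<Theta> z\<bar> \<partial>lborel)
     \<le> ennreal ((\<Sum>k=1..N. 1 - eig_value r \<mu> k) + (measure lborel \<Omega> - (\<Sum>k=1..N. eig_value r \<mu> k)))"
proof -
  let ?l = "eig_value r \<mu>" and ?a = "eig_spectrogram g r h" and ?V = "measure lborel \<Omega>"
  have [measurable]: "?a k \<in> borel_measurable borel" for k by (rule eig_spectrogram_measurable[OF e g(1)])
  have l0: "0 \<le> ?l k" and l1: "?l k \<le> 1" for k
    using eig_value_concentration(1)[OF e g \<Omega>] eig_value_le_1[OF e g \<Omega>] by auto
  have lV: "?l sums ?V" by (rule eig_value_sums(1)[OF e g \<Omega>])
  have NK: "{1..N} \<subseteq> eig_index r" unfolding N_def by (rule summands_are_eigenfunctions[OF lV l1])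
  define d where "d k = (if k \<in> {1..N} then 1 - ?l k else ?l k)" for k
  define D where "D = (\<Sum>k=1..N. 1 - ?l k) + (?V - (\<Sum>k=1..N. ?l k))"
  have d0: "0 \<le> d k" for k using l0 l1 by (simp add: d_def)
  have fin: "(\<lambda>k. if k \<in> {1..N} then c k else 0) sums (\<Sum>k=1..N. c k)" for c :: "nat \<Rightarrow> real"
    by (rule sums_If_finite_set) simp
  have "(\<lambda>k. (if k \<in> {1..N} then 1 - ?l k else 0) + (?l k - (if k \<in> {1..N} then ?l k else 0))) sums D"
    unfolding D_def by (intro sums_add sums_diff fin lV)
  moreover have "(if k \<in> {1..N} then 1 - ?l k else 0) + (?l k - (if k \<in> {1..N} then ?l k else 0)) = d k" for k
    by (simp add: d_def)
  ultimately have dD: "d sums D" by (simp only:)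
  have acc: "accumulated_spectrogram g \<Omega> h z = (\<Sum>k=1..N. ?a k z)" for z
    unfolding accumulated_spectrogram_def N_def[symmetric] using NK
    by (intro sum.cong refl) (auto simp: eig_spectrogram_def)
  have point: "ennreal \<bar>accumulated_spectrogram g \<Omega> h z - \<Theta> z\<bar> \<le> (\<Sum>k. ennreal (d k) * ennreal (?a k z))" for z
  proof -
    let ?s = "\<lambda>k. (if k \<in> {1..N} then ?a k z else 0) - ?l k * ?a k z"
    have s: "?s sums (accumulated_spectrogram g \<Omega> h z - \<Theta> z)"
      unfolding acc \<Theta>_def by (intro sums_diff fin weighted_spectrogram_sums[OF e g \<Omega>])
    have ns: "norm (?s k) = d k * ?a k z" for k
    proof -
      have "?a k z - ?l k * ?a k z = (1 - ?l k) * ?a k z" by (simp add: algebra_simps)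
      thus ?thesis using l0[of k] l1[of k] eig_spectrogram_nonneg[of g r h k z] by (auto simp: d_def abs_mult)
    qed
    have "summable (\<lambda>k. (if k \<in> {1..N} then (1 - 2 * ?l k) * ?a k z else 0) + ?l k * ?a k z)"
      using fin[of "\<lambda>k. (1 - 2 * ?l k) * ?a k z"] weighted_spectrogram_sums[OF e g \<Omega>, of z]
      by (intro summable_add) (auto intro: sums_summable)
    moreover have "(if k \<in> {1..N} then (1 - 2 * ?l k) * ?a k z else 0) + ?l k * ?a k z = norm (?s k)" for k
      unfolding ns by (simp add: d_def algebra_simps)
    ultimately have sm: "summable (\<lambda>k. norm (?s k))" by (simp only:)
    have "\<bar>accumulated_spectrogram g \<Omega> h z - \<Theta> z\<bar> = norm (suminf ?s)" using s by (simp add: sums_iff)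
    also have "\<dots> \<le> (\<Sum>k. norm (?s k))" by (rule summable_norm[OF sm])
    finally have "ennreal \<bar>accumulated_spectrogram g \<Omega> h z - \<Theta> z\<bar> \<le> ennreal (\<Sum>k. norm (?s k))"
      by (rule ennreal_leI)
    also have "\<dots> = (\<Sum>k. ennreal (norm (?s k)))"
      using suminf_ennreal_eq[OF norm_ge_zero summable_sums[OF sm]] by simp
    also have "\<dots> = (\<Sum>k. ennreal (d k) * ennreal (?a k z))"
      unfolding ns by (simp add: ennreal_mult d0 eig_spectrogram_nonneg)
    finally show ?thesis .
  qed
  have "(\<integral>\<^sup>+z. ennreal \<bar>accumulated_spectrogram g \<Omega> h z - \<Theta> z\<bar> \<partial>lborel)
      \<le> (\<integral>\<^sup>+z. (\<Sum>k. ennreal (d k) * ennreal (?a k z)) \<partial>lborel)"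
    by (rule nn_integral_mono) (rule point)
  also have "\<dots> = (\<Sum>k. \<integral>\<^sup>+z. ennreal (d k) * ennreal (?a k z) \<partial>lborel)"
    by (rule nn_integral_suminf) measurable
  also have "\<dots> = (\<Sum>k. ennreal (d k) * (\<integral>\<^sup>+z. ennreal (?a k z) \<partial>lborel))"
    by (intro suminf_cong nn_integral_cmult) measurable
  also have "\<dots> \<le> (\<Sum>k. ennreal (d k))"
    unfolding nn_integral_eig_spectrogram[OF e g] by (intro suminf_le) auto
  also have "\<dots> = ennreal D" by (rule suminf_ennreal_eq[OF d0 dD])
  finally show ?thesis unfolding D_def .
qed

text \<open>
  The constant is \<open>1 + 3 M\<close> with \<open>M\<close> the first moment of \<open>|V\<^sub>g g|\<^sup>2\<close>.
\<close>

theorem theorem1p5: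
  fixes g :: "real ^ 'n \<Rightarrow> complex"
  assumes "g \<in> M_star" and "L2_norm g = 1"
  shows "\<exists>C>0. \<forall>\<Omega> :: ((real ^ 'n) \<times> (real ^ 'n)) set.
           compact \<Omega> \<and> finite_perimeter \<Omega> \<and> perimeter \<Omega> \<ge> 1 \<longrightarrow>
           (\<forall>r \<mu> h. eigensystem g \<Omega> r \<mu> h \<longrightarrow>
              integrable lborel (\<lambda>z. accumulated_spectrogram g \<Omega> h z - indicat_real \<Omega> z) \<and>
              (LINT z|lborel. \<bar>accumulated_spectrogram g \<Omega> h z - indicat_real \<Omega> z\<bar>)
                \<le> C * perimeter \<Omega>)"
proof -
  have gL: "g \<in> L2" and mom: "integrable lborel (\<lambda>z. norm z * (norm (stft g g z))\<^sup>2)"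
    using assms(1) by (simp_all add: M_star_def)
  note g = gL assms(2)
  let ?k = "\<lambda>z. (norm (stft g g z))\<^sup>2"
  note k = stft_norm_square_integral[OF g]
  define M where "M = (LINT z|lborel. norm z * ?k z)"
  have M0: "0 \<le> M" unfolding M_def by (intro integral_nonneg_AE) simp
  show ?thesis
  proof (intro exI[of _ "1 + 3 * M"] conjI allI impI; (elim conjE)?)
    show "0 < 1 + 3 * M" using M0 by simp
    fix \<Omega> :: "((real ^ 'n) \<times> (real ^ 'n)) set" and r \<mu> h
    assume cpt: "compact \<Omega>" and fp: "finite_perimeter \<Omega>" and P1: "1 \<le> perimeter \<Omega>" and e: "eigensystem g \<Omega> r \<mu> h"
    have \<Omega>: "\<Omega> \<in> sets borel" "emeasure lborel \<Omega> < \<infinity>"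
      using cpt borel_compact emeasure_compact_finite by auto
    have [measurable]: "\<Omega> \<in> sets borel" by (rule \<Omega>(1))
    let ?P = "perimeter \<Omega>" and ?V = "measure lborel \<Omega>" and ?l = "eig_value r \<mu>"
    let ?\<rho> = "accumulated_spectrogram g \<Omega> h"
    define \<Theta> where "\<Theta> z = (LINT w:\<Omega>|lborel. ?k (w - z))" for z
    have [measurable]: "stft g g \<in> borel_measurable borel" using gL by (intro stft_measurable L2_measurable)
    have \<Theta>m[measurable]: "\<Theta> \<in> borel_measurable borel"
    proof -
      have "\<Theta> \<in> borel_measurable lborel"
        unfolding \<Theta>_def[abs_def] set_lebesgue_integral_def
        by (rule lborel.borel_measurable_lebesgue_integral) measurable
      thus ?thesis by simp
    qed
    have l0: "0 \<le> ?l k" and l1: "?l k \<le> 1" for k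
      using eig_value_concentration(1)[OF e g \<Omega>] eig_value_le_1[OF e g \<Omega>] by auto
    have lV: "?l sums ?V" by (rule eig_value_sums(1)[OF e g \<Omega>])
    have smooth: "(\<integral>\<^sup>+z. ennreal \<bar>\<Theta> z - indicat_real \<Omega> z\<bar> \<partial>lborel) \<le> ennreal (M * ?P)"
      unfolding \<Theta>_def M_def
      by (rule smoothing_error[OF k(1) _ k(2) mom \<Omega>(1) compact_imp_bounded[OF cpt] fp]) simp
    have "summable (\<lambda>k. ?l k * ?l k)"
      using l0 l1 by (intro summable_comparison_test'[OF sums_summable[OF lV]]) (simp add: abs_mult mult_left_le)
    then obtain S where S: "(\<lambda>k. ?l k * ?l k) sums S" by (auto simp: summable_def)
    have S0: "0 \<le> S" by (rule sums_le[OF _ sums_zero S]) (simp add: l0)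
    have "ennreal ?V = (\<integral>\<^sup>+z. indicator \<Omega> z \<partial>lborel)"
      using \<Omega>(2) by (simp add: emeasure_eq_ennreal_measure)
    also have "\<dots> \<le> (\<integral>\<^sup>+z. indicator \<Omega> z * ennreal (\<Theta> z) + ennreal \<bar>\<Theta> z - indicat_real \<Omega> z\<bar> \<partial>lborel)"
    proof (rule nn_integral_mono)
      fix z
      have "0 \<le> \<Theta> z" unfolding \<Theta>_def set_lebesgue_integral_def by (intro integral_nonneg_AE) simp
      hence "1 \<le> ennreal (\<Theta> z) + ennreal \<bar>\<Theta> z - 1\<bar>" 
        by (simp add: ennreal_plus[symmetric] del: ennreal_plus)
      thus "indicator \<Omega> z \<le> indicator \<Omega> z * ennreal (\<Theta> z) + ennreal \<bar>\<Theta> z - indicat_real \<Omega> z\<bar>"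
        by (cases "z \<in> \<Omega>") simp_all
    qed
    also have "\<dots> = (\<integral>\<^sup>+z. indicator \<Omega> z * ennreal (\<Theta> z) \<partial>lborel) + (\<integral>\<^sup>+z. ennreal \<bar>\<Theta> z - indicat_real \<Omega> z\<bar> \<partial>lborel)"
      by (rule nn_integral_add) measurable
    also have "(\<integral>\<^sup>+z. indicator \<Omega> z * ennreal (\<Theta> z) \<partial>lborel) = ennreal S"
      unfolding \<Theta>_def eig_value_sums(2)[OF e g \<Omega>, symmetric]
      by (rule suminf_ennreal_eq[OF _ S]) (simp add: l0)
    also have "ennreal S + (\<integral>\<^sup>+z. ennreal \<bar>\<Theta> z - indicat_real \<Omega> z\<bar> \<partial>lborel) \<le> ennreal S + ennreal (M * ?P)"
      by (intro add_left_mono smooth)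
    also have "\<dots> = ennreal (S + M * ?P)" using S0 M0 P1 by (simp add: ennreal_plus)
    finally have "ennreal ?V \<le> ennreal (S + M * ?P)" .
    moreover have "0 \<le> S + M * ?P" using S0 M0 P1 by simp
    ultimately have "?V \<le> S + M * ?P" by (simp only: ennreal_le_iff)
    hence B: "?V - S \<le> M * ?P" by linarith
    have "(\<lambda>k. ?l k * (1 - ?l k)) sums (?V - S)"
      using sums_diff[OF lV S] by (simp add: right_diff_distrib)
    hence defect: "(\<Sum>k=1..nat \<lceil>?V\<rceil>. 1 - ?l k) + (?V - (\<Sum>k=1..nat \<lceil>?V\<rceil>. ?l k)) \<le> 2 * (?V - S) + 1"
      using lV l0 l1 eig_value_decreasing[OF e g \<Omega>]
      by (intro truncated_spectrum_defect[where l="?l"]) (auto simp: eig_value_def eig_index_def)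
    have spec: "(\<integral>\<^sup>+z. ennreal \<bar>?\<rho> z - \<Theta> z\<bar> \<partial>lborel) \<le> ennreal (2 * (M * ?P) + 1)"
    proof -
      have "2 * (?V - S) + 1 \<le> 2 * (M * ?P) + 1" using B by simp
      from ennreal_leI[OF order_trans[OF defect this]]
      show ?thesis by (rule order_trans[OF accumulated_spectrogram_error[OF e g \<Omega>, folded \<Theta>_def]])
    qed
    have \<rho>m[measurable]: "?\<rho> \<in> borel_measurable borel"
    proof -
      have "{1..nat \<lceil>?V\<rceil>} \<subseteq> eig_index r" by (rule summands_are_eigenfunctions[OF lV l1])
      hence "?\<rho> = (\<lambda>z. \<Sum>k=1..nat \<lceil>?V\<rceil>. eig_spectrogram g r h k z)"
        unfolding accumulated_spectrogram_def[abs_def]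
        by (intro ext sum.cong refl) (auto simp: eig_spectrogram_def)
      thus ?thesis using eig_spectrogram_measurable[OF e gL] by simp
    qed
    have "(\<integral>\<^sup>+z. ennreal \<bar>?\<rho> z - indicat_real \<Omega> z\<bar> \<partial>lborel)
        \<le> (\<integral>\<^sup>+z. ennreal \<bar>?\<rho> z - \<Theta> z\<bar> + ennreal \<bar>\<Theta> z - indicat_real \<Omega> z\<bar> \<partial>lborel)"
      by (intro nn_integral_mono) (simp add: ennreal_plus[symmetric] ennreal_leI del: ennreal_plus)
    also have "\<dots> = (\<integral>\<^sup>+z. ennreal \<bar>?\<rho> z - \<Theta> z\<bar> \<partial>lborel) + (\<integral>\<^sup>+z. ennreal \<bar>\<Theta> z - indicat_real \<Omega> z\<bar> \<partial>lborel)"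
      by (rule nn_integral_add) measurable
    also have "\<dots> \<le> ennreal (2 * (M * ?P) + 1) + ennreal (M * ?P)" by (intro add_mono spec smooth)
    also have "\<dots> = ennreal (3 * (M * ?P) + 1)" using M0 P1 by (simp add: ennreal_plus[symmetric] del: ennreal_plus)
    also have "\<dots> \<le> ennreal ((1 + 3 * M) * ?P)" using P1 by (intro ennreal_leI) (simp add: algebra_simps)
    finally have bound: "(\<integral>\<^sup>+z. ennreal \<bar>?\<rho> z - indicat_real \<Omega> z\<bar> \<partial>lborel) \<le> ennreal ((1 + 3 * M) * ?P)" .
    show int: "integrable lborel (\<lambda>z. ?\<rho> z - indicat_real \<Omega> z)"
      unfolding integrable_iff_bounded using order_le_less_trans[OF bound] by simp
    have "ennreal (LINT z|lborel. \<bar>?\<rho> z - indicat_real \<Omega> z\<bar>) \<le> ennreal ((1 + 3 * M) * ?P)"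
      using bound nn_integral_eq_integral[OF integrable_abs[OF int]] by simp
    thus "(LINT z|lborel. \<bar>?\<rho> z - indicat_real \<Omega> z\<bar>) \<le> (1 + 3 * M) * ?P"
      using M0 P1 by (simp add: ennreal_le_iff)
  qed
qed

end
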